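(* Let $k\ge 2$ be a fixed integer. For each $n$ let $(d_i)_{i=1}^n=(d_i^{(n)})_{i=1}^n$ be a sequence of non-negative integers with $\sum_{i=1}^n d_i$ even, and write $2m=\sum_{i=1}^n d_i$. Assume that there is a probability distribution $(p_r)_{r=0}^\infty$, independent of $n$, such that (a) $\#\{i:d_i=r\}/n\to p_r$ for every $r\ge 0$ as $n\to\infty$; (b) $\lambda:=\sum_r r p_r\in(0,\infty)$; (c) $2m/n\to\lambda$ as $n\to\infty$. Let $G^*(n,(d_i))$ be the random multigraph with degree sequence $(d_i)_1^n$ given by the configuration model, and let $\mathrm{Cr}^*_k$ be its $k$-core. Define $h$ and $h_1$ on $[0,1]$ as in the context, and let $\hat p$ be the largest $p\le 1$ such that $\lambda p^2=h(p)$. (i) If $\hat p=0$, i.e. $\lambda p^2>h(p)$ for all $p\in(0,1]$, then $\mathrm{Cr}^*_k$ has $o_p(n)$ vertices and $o_p(n)$ edges with high probability (if it exists at all). Furthermore, if also $k\ge 3$ and $\sum_{i=1}^n e^{\alpha d_i}=O(n)$ for some $\alpha>0$, then $\mathrm{Cr}^*_k$ is empty with high probability. (ii) If $\hat p>0$, and further $\lambda p^2<h(p)$ for all $p$ in some interval $(\hat p-\varepsilon,\hat p)$ with $\varepsilon>0$, then with high probability $\mathrm{Cr}^*_k$ is non-empty, and $v(\mathrm{Cr}^*_k)/n\to h_1(\hat p)$ and $e(\mathrm{Cr}^*_k)/n\to h(\hat p)/2=\lambda\hat p^2/2$ in probability.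
   Context: The $k$-core of a (multi)graph is its largest induced subgraph with minimum degree at least $k$ (possibly empty); $v(G)$ and $e(G)$ denote the numbers of vertices and edges. Configuration model: give vertex $i$ exactly $d_i$ half-edges and pair all $2m$ half-edges by a uniformly random perfect matching; each pair forms an edge (loops and multiple edges allowed). Asymptotics are as $n\to\infty$; "with high probability" means with probability tending to 1; $o_p(n)$ means a quantity $X_n$ with $X_n/n\to 0$ in probability. Let $W$ be a random variable with $P(W=r)=p_r$, and for $0\le p\le 1$ let $W_p$ be the thinning of $W$ (each of the $W$ points kept independently with probability $p$). With $\pi_{lr}(p)=\binom{l}{r}p^r(1-p)^{l-r}$ (and $\pi_{00}(p)=1$), define $h(p)=E(W_p\mathbf 1\{W_p\ge k\})=\sum_{r=k}^\infty\sum_{l=r}^\infty r p_l\pi_{lr}(p)$ and $h_1(p)=P(W_p\ge k)=\sum_{r=k}^\infty\sum_{l=r}^\infty p_l\pi_{lr}(p)$. *)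

theory Defs
  imports "HOL-Probability.Probability" "HOL-Library.Landau_Symbols"
begin

text \<open>An edge is the two-element multiset of its endpoints, so that a loop at \<open>v\<close> is
  \<open>{#v, v#}\<close>; parallel edges are repeated entries of the outer multiset.\<close>

datatype 'a multigraph = Multigraph (verts: "'a set") (edges: "'a multiset multiset")

text \<open>A loop contributes 2 to the degree of its vertex.\<close>

definition vertex_degree :: "'a multigraph \<Rightarrow> 'a \<Rightarrow> nat" where
  "vertex_degree G v = count (\<Sum>\<^sub># (edges G)) v"

definition induced_subgraph :: "'a multigraph \<Rightarrow> 'a set \<Rightarrow> 'a multigraph" where
  "induced_subgraph G S = Multigraph S (filter_mset (\<lambda>e. set_mset e \<subseteq> S) (edges G))"

definition min_degree_ge :: "nat \<Rightarrow> 'a multigraph \<Rightarrow> bool" where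
  "min_degree_ge k G \<longleftrightarrow> (\<forall>v\<in>verts G. vertex_degree G v \<ge> k)"

text \<open>The greatest element is taken with respect to inclusion of vertex sets; the empty
  vertex set is always admissible.\<close>

definition kcore :: "nat \<Rightarrow> 'a multigraph \<Rightarrow> 'a multigraph" where
  "kcore k G = induced_subgraph G
     (GREATEST S. S \<subseteq> verts G \<and> min_degree_ge k (induced_subgraph G S))"

lemma degree_induced_subgraph_mono:
  assumes "S \<subseteq> T"
  shows "vertex_degree (induced_subgraph G S) v \<le> vertex_degree (induced_subgraph G T) v"
proof -
  have "filter_mset (\<lambda>e. set_mset e \<subseteq> S) (edges G)
        \<subseteq># filter_mset (\<lambda>e. set_mset e \<subseteq> T) (edges G)"
    using assms by (auto simp: subseteq_mset_def)
  then have "\<Sum>\<^sub># (filter_mset (\<lambda>e. set_mset e \<subseteq> S) (edges G))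
        \<subseteq># \<Sum>\<^sub># (filter_mset (\<lambda>e. set_mset e \<subseteq> T) (edges G))"
    by (metis subset_mset.le_iff_add sum_mset.union)
  then show ?thesis
    by (simp add: vertex_degree_def induced_subgraph_def mset_subset_eq_count)
qed

lemma kcore_eq_Union:
  "kcore k G = induced_subgraph G
     (\<Union>{S. S \<subseteq> verts G \<and> min_degree_ge k (induced_subgraph G S)})"
proof -
  let ?A = "{S. S \<subseteq> verts G \<and> min_degree_ge k (induced_subgraph G S)}"
  have "min_degree_ge k (induced_subgraph G (\<Union>?A))"
  proof (subst min_degree_ge_def, intro ballI)
    fix v assume "v \<in> verts (induced_subgraph G (\<Union>?A))"
    then obtain S where S: "S \<in> ?A" "v \<in> S" by (auto simp: induced_subgraph_def)
    then have "k \<le> vertex_degree (induced_subgraph G S) v"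
      by (auto simp: min_degree_ge_def induced_subgraph_def)
    also have "\<dots> \<le> vertex_degree (induced_subgraph G (\<Union>?A)) v"
      using S by (intro degree_induced_subgraph_mono) blast
    finally show "vertex_degree (induced_subgraph G (\<Union>?A)) v \<ge> k" .
  qed
  then have "(GREATEST S. S \<subseteq> verts G \<and> min_degree_ge k (induced_subgraph G S)) = \<Union>?A"
    by (intro Greatest_equality) blast+
  then show ?thesis by (simp add: kcore_def)
qed

text \<open>The half-edges at vertex \<open>i\<close> are the pairs \<open>(i, j)\<close> with \<open>j < d i\<close>.\<close>

definition half_edges :: "nat \<Rightarrow> (nat \<Rightarrow> nat) \<Rightarrow> (nat \<times> nat) set" where
  "half_edges n d = (SIGMA i:{1..n}. {..<d i})"

definition perfect_matchings :: "'a set \<Rightarrow> 'a set set set" where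
  "perfect_matchings H = {M. partition_on H M \<and> (\<forall>e\<in>M. card e = 2)}"

definition matching_multigraph :: "nat \<Rightarrow> (nat \<times> nat) set set \<Rightarrow> nat multigraph" where
  "matching_multigraph n M =
     Multigraph {1..n} (image_mset (\<lambda>e. image_mset fst (mset_set e)) (mset_set M))"

definition config_model :: "nat \<Rightarrow> (nat \<Rightarrow> nat) \<Rightarrow> nat multigraph pmf" where
  "config_model n d =
     map_pmf (matching_multigraph n) (pmf_of_set (perfect_matchings (half_edges n d)))"

text \<open>The set of matchings is finite and non-empty, so that the use of
  \<^const>\<open>pmf_of_set\<close> above is meaningful.\<close>

lemma finite_half_edges: "finite (half_edges n d)"
  by (simp add: half_edges_def)

lemma card_half_edges: "card (half_edges n d) = (\<Sum>i=1..n. d i)"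
  by (simp add: half_edges_def)

lemma finite_perfect_matchings: "finite H \<Longrightarrow> finite (perfect_matchings H)"
  by (rule finite_subset[of _ "Pow (Pow H)"])
     (auto simp: perfect_matchings_def partition_on_def)

lemma perfect_matchings_nonempty:
  assumes "finite H" "even (card H)"
  shows "perfect_matchings H \<noteq> {}"
  using assms
proof (induction "card H" arbitrary: H rule: less_induct)
  case less
  show ?case
  proof (cases "H = {}")
    case True
    then have "{} \<in> perfect_matchings H" by (simp add: perfect_matchings_def partition_on_def)
    then show ?thesis by blast
  next
    case False
    then have "card H \<ge> 2" using less.prems
      by (metis card_0_eq even_Suc le_SucE le_zero_eq not_less_eq_eq numeral_2_eq_2 odd_one One_nat_def)
    then obtain e where e: "e \<subseteq> H" "card e = 2" by (meson obtain_subset_with_card_n)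
    have fe: "finite e" using e card.infinite by fastforce
    have c: "card (H - e) = card H - 2" using e fe by (simp add: card_Diff_subset)
    then have "perfect_matchings (H - e) \<noteq> {}"
      using less.prems \<open>card H \<ge> 2\<close> by (intro less.hyps) auto
    then obtain M where M: "partition_on (H - e) M" "\<forall>e\<in>M. card e = 2"
      by (auto simp: perfect_matchings_def)
    have "disjnt (H - e) e" by (auto simp: disjnt_def)
    moreover have "partition_on e {e}" using e by (intro partition_on_space) auto
    ultimately have "partition_on ((H - e) \<union> e) (M \<union> {e})"
      using M(1) by (auto simp: partition_on_def disjnt_def disjoint_def)
    then have "insert e M \<in> perfect_matchings H"
      using e M(2) by (simp add: perfect_matchings_def Un_absorb2)
    then show ?thesis by blast
  qed
qed

lemma vertex_degree_matching_multigraph: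
  assumes "M \<in> perfect_matchings (half_edges n d)" "i \<in> {1..n}"
  shows "vertex_degree (matching_multigraph n M) i = d i"
proof -
  have M: "\<Union>M = half_edges n d" "disjoint M"
    using assms(1) by (auto simp: perfect_matchings_def partition_on_def)
  have fin: "finite e" if "e \<in> M" for e
    using that M(1) finite_half_edges[of n d] by (metis Union_upper finite_subset)
  have finM: "finite M" using M(1) finite_half_edges[of n d] by (metis finite_UnionD)
  have "vertex_degree (matching_multigraph n M) i
      = (\<Sum>e\<in>M. count (image_mset fst (mset_set e)) i)"
    by (simp add: vertex_degree_def matching_multigraph_def sum_unfold_sum_mset count_sum
        flip: sum_unfold_sum_mset)
  also have "\<dots> = (\<Sum>e\<in>M. card {x\<in>e. fst x = i})"
    by (intro sum.cong refl)
       (simp add: count_image_mset fin Collect_conj_eq vimage_def Int_commute)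
  also have "\<dots> = card (\<Union>e\<in>M. {x\<in>e. fst x = i})"
    using M(2) finM fin by (intro card_UN_disjoint[symmetric]) (auto simp: disjoint_def)
  also have "(\<Union>e\<in>M. {x\<in>e. fst x = i}) = {x\<in>\<Union>M. fst x = i}"
    by auto
  also have "\<dots> = {i} \<times> {..<d i}"
    using assms(2) by (auto simp: M(1) half_edges_def)
  finally show ?thesis by (simp add: card_cartesian_product)
qed

text \<open>Meaningful for \<open>0 \<le> q \<le> 1\<close> only.\<close>

definition thinning :: "nat pmf \<Rightarrow> real \<Rightarrow> nat pmf" where
  "thinning p q = bind_pmf p (\<lambda>l. binomial_pmf l q)"

definition core_h :: "nat \<Rightarrow> nat pmf \<Rightarrow> real \<Rightarrow> real" where
  "core_h k p q =
     measure_pmf.expectation (thinning p q) (\<lambda>w. real w * indicator {k..} w)"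

definition core_h1 :: "nat \<Rightarrow> nat pmf \<Rightarrow> real \<Rightarrow> real" where
  "core_h1 k p q = measure_pmf.prob (thinning p q) {k..}"

definition p_hat :: "nat \<Rightarrow> real \<Rightarrow> nat pmf \<Rightarrow> real" where
  "p_hat k lam p = (GREATEST q. 0 \<le> q \<and> q \<le> 1 \<and> lam * q\<^sup>2 = core_h k p q)"

text \<open>The underlying probability space may change with \<open>n\<close>.\<close>

definition whp :: "(nat \<Rightarrow> 'a pmf) \<Rightarrow> (nat \<Rightarrow> 'a \<Rightarrow> bool) \<Rightarrow> bool" where
  "whp M A \<longleftrightarrow> (\<lambda>n. measure_pmf.prob (M n) {x. A n x}) \<longlonglongrightarrow> 1"

definition converges_in_prob ::
    "(nat \<Rightarrow> 'a pmf) \<Rightarrow> (nat \<Rightarrow> 'a \<Rightarrow> real) \<Rightarrow> real \<Rightarrow> bool" where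
  "converges_in_prob M X c \<longleftrightarrow>
     (\<forall>\<epsilon>>0. (\<lambda>n. measure_pmf.prob (M n) {x. \<bar>X n x - c\<bar> > \<epsilon>}) \<longlonglongrightarrow> 0)"

definition little_op :: "(nat \<Rightarrow> 'a pmf) \<Rightarrow> (nat \<Rightarrow> 'a \<Rightarrow> real) \<Rightarrow> bool" where
  "little_op M X \<longleftrightarrow> converges_in_prob M (\<lambda>n x. X n x / real n) 0"

end

theory Submission
  imports Defs
begin

text \<open>The matching is revealed along the peeling process: as long as some vertex has fewer than
  \<open>k\<close> remaining half-edges, one of its half-edges is chosen by a deterministic rule and deleted
  together with its mate, which is uniform among the other remaining half-edges; what survives is the
  core. A vertex with at least \<open>k\<close> remaining half-edges is only ever hit as a mate, so for a function
  \<open>f\<close> vanishing below \<open>k\<close> the sum of the conditional means of \<open>f\<close> at the final degrees is a martingale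
  with bounded increments. By Chebyshev, when a proportion \<open>u = q\<^sup>2\<close> of the half-edges is left, about
  \<open>n h(q)\<close> of them lie at vertices of degree at least \<open>k\<close>, while \<open>\<lambda> q\<^sup>2 n\<close> are left in total. Hence the
  process does not stop while \<open>\<lambda> q\<^sup>2 > h(q)\<close> and has stopped before \<open>\<lambda> q\<^sup>2 < h(q)\<close>. Emptiness of the
  core under an exponential moment is a first moment bound over the sets of \<open>2 a\<close> half-edges that are
  unions of edges and meet each vertex in no or at least three half-edges.\<close>

section \<open>Uniform perfect matchings\<close>

text \<open>The square root in \<open>u = q^2\<close> has this origin: each step deletes two
  half-edges, but only the mate is random. With \<open>r\<close> half-edges left, a given half-edge
  of a heavy vertex survives a step with probability \<open>1 - 1 / (r - 1)\<close>, and the product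
  of these factors with \<open>r\<close> decreasing by 2 is about \<open>sqrt u\<close>. Degrees of
  heavy vertices thus look thinned with parameter \<open>sqrt u\<close>. Degree frequencies converge
  only pointwise, and the increment bound requires degrees below the number of half-edges left.
  Hence only vertices of degree at most \<open>K\<close> are followed; the others carry few
  half-edges because the average degree converges to the mean of the limit law. The stopping time is
  never estimated directly. Inspection at fixed times excludes whole windows of core sizes, and
  finitely many windows are chained down to the largest root. In the first moment bound three is the
  first fibre size that works: an edge costs a factor of order \<open>a / n\<close>, the weight
  optimal for fibres of size three gives back \<open>(a / n) ^ (2 / 3)\<close>, and for size two it
  would give back everything.\<close>

lemma perfect_matchings_insert:
  assumes "x \<in> H" "y \<in> H" "x \<noteq> y" "M \<in> perfect_matchings (H - {x, y})"
  shows "insert {x, y} M \<in> perfect_matchings H" "{x, y} \<notin> M"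
    "x \<notin> \<Union>M" "y \<notin> \<Union>M"
proof -
  have M: "partition_on (H - {x, y}) M" "\<forall>e\<in>M. card e = 2"
    using assms(4) by (auto simp: perfect_matchings_def)
  have U: "\<Union>M = H - {x, y}" using M(1) by (auto simp: partition_on_def)
  show "x \<notin> \<Union>M" "y \<notin> \<Union>M" using U by auto
  then show "{x, y} \<notin> M" by auto
  have "partition_on H (insert {x, y} M)"
    unfolding partition_on_def
  proof (intro conjI)
    show "\<Union>(insert {x, y} M) = H" using U assms by auto
    show "disjoint (insert {x, y} M)"
      using M(1) U by (auto simp: partition_on_def disjoint_def)
    show "{} \<notin> insert {x, y} M" using M(1) by (auto simp: partition_on_def)
  qed
  then show "insert {x, y} M \<in> perfect_matchings H"
    using M(2) assms(3) by (auto simp: perfect_matchings_def)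
qed

lemma perfect_matchings_remove:
  assumes "e \<in> M" "M \<in> perfect_matchings H"
  shows "M - {e} \<in> perfect_matchings (H - e)"
proof -
  have M: "\<Union>M = H" "disjoint M" "{} \<notin> M"
    using assms by (auto simp: perfect_matchings_def partition_on_def)
  have "e' \<inter> e = {}" if "e' \<in> M - {e}" for e'
    using M(2) that assms(1) by (auto simp: disjoint_def)
  then have "\<Union>(M - {e}) = H - e" using M(1) by blast
  moreover have "disjoint (M - {e})" using M(2) by (auto simp: disjoint_def)
  ultimately have "partition_on (H - e) (M - {e})"
    using M(3) by (simp add: partition_on_def)
  then show ?thesis using assms by (auto simp: perfect_matchings_def)
qed

lemma perfect_matchings_mate:
  assumes "M \<in> perfect_matchings H" "x \<in> H"
  obtains y where "{x, y} \<in> M" "y \<in> H" "x \<noteq> y"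
proof -
  obtain e where e: "e \<in> M" "x \<in> e"
    using assms by (auto simp: perfect_matchings_def partition_on_def)
  then have "card e = 2" using assms by (auto simp: perfect_matchings_def)
  then obtain a b where "e = {a, b}" "a \<noteq> b" by (auto simp: card_2_iff)
  with e obtain y where y: "e = {x, y}" "x \<noteq> y" by auto
  moreover have "y \<in> H" using y e assms by (auto simp: perfect_matchings_def partition_on_def)
  ultimately show ?thesis using that e by auto
qed

text \<open>Sorting the matchings by the mate \<open>y\<close> of a fixed \<open>x\<close> is a
  bijection onto pairs of a mate and a matching of the rest. The recursions for counts and for
  expectations come from here.\<close>

lemma sum_perfect_matchings:
  fixes \<Phi> :: "'a set set \<Rightarrow> 'b :: comm_monoid_add"
  assumes "finite H" "x \<in> H"
  shows "(\<Sum>M\<in>perfect_matchings H. \<Phi> M)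
       = (\<Sum>y\<in>H - {x}. \<Sum>M\<in>perfect_matchings (H - {x, y}). \<Phi> (insert {x, y} M))"
proof -
  let ?S = "SIGMA y:H - {x}. perfect_matchings (H - {x, y})"
  let ?f = "\<lambda>(y, M). insert {x, y} M"
  have inj: "inj_on ?f ?S"
  proof (rule inj_onI)
    fix z z' assume z: "z \<in> ?S" "z' \<in> ?S" "?f z = ?f z'"
    obtain y M y' M' where zz: "z = (y, M)" "z' = (y', M')" by fastforce
    have h: "y \<in> H" "y \<noteq> x" "y' \<in> H" "y' \<noteq> x"
      "M \<in> perfect_matchings (H - {x, y})" "M' \<in> perfect_matchings (H - {x, y'})"
      "insert {x, y} M = insert {x, y'} M'"
      using z by (auto simp: zz)
    note a = perfect_matchings_insert[OF assms(2) h(1) h(2)[symmetric] h(5)]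
    note b = perfect_matchings_insert[OF assms(2) h(3) h(4)[symmetric] h(6)]
    have "{x, y} \<in> insert {x, y'} M'" using h(7) by auto
    then have "{x, y} = {x, y'}" using b(3) by auto
    then have yy: "y = y'" by (auto simp: doubleton_eq_iff)
    then have "M = M'" using h(7) a(2) b(2) by (metis insert_ident)
    then show "z = z'" using yy zz by simp
  qed
  have img: "?f ` ?S = perfect_matchings H"
  proof
    show "?f ` ?S \<subseteq> perfect_matchings H"
      using perfect_matchings_insert(1)[OF assms(2)] by auto
    show "perfect_matchings H \<subseteq> ?f ` ?S"
    proof
      fix M assume M: "M \<in> perfect_matchings H"
      then obtain y where y: "{x, y} \<in> M" "y \<in> H" "x \<noteq> y"
        using perfect_matchings_mate assms(2) by metis
      have "M - {{x, y}} \<in> perfect_matchings (H - {x, y})"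
        using perfect_matchings_remove[OF y(1) M] .
      moreover have "M = ?f (y, M - {{x, y}})" using y by auto
      ultimately show "M \<in> ?f ` ?S" using y by (intro image_eqI[of _ _ "(y, M - {{x, y}})"]) auto
    qed
  qed
  have fin: "\<forall>y\<in>H - {x}. finite (perfect_matchings (H - {x, y}))"
    using assms(1) by (auto intro: finite_perfect_matchings)
  have "(\<Sum>M\<in>perfect_matchings H. \<Phi> M) = (\<Sum>z\<in>?S. \<Phi> (?f z))"
    by (subst img[symmetric], subst sum.reindex[OF inj]) auto
  also have "\<dots> = (\<Sum>y\<in>H - {x}. \<Sum>M\<in>perfect_matchings (H - {x, y}). \<Phi> (insert {x, y} M))"
    using assms(1) fin by (subst sum.Sigma) (auto simp: case_prod_unfold)
  finally show ?thesis .
qed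

text \<open>This makes the mate of a half-edge uniform: every choice of the mate leaves equally many
  matchings of the rest.\<close>

lemma card_perfect_matchings_cong:
  assumes "finite H" "finite H'" "card H = card H'" "even (card H)"
  shows "card (perfect_matchings (H :: 'a set)) = card (perfect_matchings (H' :: 'a set))"
  using assms
proof (induction "card H" arbitrary: H H' rule: less_induct)
  case less
  show ?case
  proof (cases "H = {}")
    case True
    then show ?thesis using less.prems by auto
  next
    case False
    then obtain x where x: "x \<in> H" by auto
    have "H' \<noteq> {}" using False less.prems by auto
    then obtain x' where x': "x' \<in> H'" by auto
    obtain c where c: "\<And>y. y \<in> H - {x} \<Longrightarrow> card (perfect_matchings (H - {x, y})) = c"
      "\<And>y. y \<in> H' - {x'} \<Longrightarrow> card (perfect_matchings (H' - {x', y})) = c"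
    proof -
      have cd: "card (H - {x, y}) = card H - 2" if "y \<in> H - {x}" for y
        using that x less.prems by (subst card_Diff_subset) auto
      have cd': "card (H' - {x', y}) = card H - 2" if "y \<in> H' - {x'}" for y
        using that x' less.prems by (subst card_Diff_subset) auto
      have lt: "card H - 2 < card H" using False less.prems(1) by (simp add: card_gt_0_iff)
      have ev: "even (card H - 2)" using less.prems by auto
      have "2 \<le> card H" using False less.prems
        by (metis card_0_eq even_Suc le_SucE le_zero_eq not_less_eq_eq numeral_2_eq_2 odd_one One_nat_def)
      then have "card (H - {x}) \<noteq> 0" using x less.prems by simp
      then obtain z where z: "z \<in> H - {x}" by (metis card.empty ex_in_conv)
      have e1: "card (perfect_matchings (H - {x, y})) = card (perfect_matchings (H - {x, z}))"
        if "y \<in> H - {x}" for y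
        using less.hyps[of "H - {x, y}" "H - {x, z}"] cd[OF that] cd[OF z] lt ev less.prems by simp
      have e2: "card (perfect_matchings (H' - {x', y})) = card (perfect_matchings (H - {x, z}))"
        if "y \<in> H' - {x'}" for y
        using less.hyps[of "H - {x, z}" "H' - {x', y}"] cd'[OF that] cd[OF z] lt ev less.prems by simp
      show ?thesis using e1 e2 that by blast
    qed
    have "card (perfect_matchings H) = (\<Sum>y\<in>H - {x}. card (perfect_matchings (H - {x, y})))"
      using sum_perfect_matchings[OF less.prems(1) x, of "\<lambda>_. 1::nat"] by simp
    also have "\<dots> = (card H - 1) * c" using c x by simp
    also have "\<dots> = (\<Sum>y\<in>H' - {x'}. card (perfect_matchings (H' - {x', y})))"
      using c x' less.prems by simp
    also have "\<dots> = card (perfect_matchings H')"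
      using sum_perfect_matchings[OF less.prems(2) x', of "\<lambda>_. 1::nat"] by simp
    finally show ?thesis .
  qed
qed

abbreviation unif_matching :: "'a set \<Rightarrow> 'a set set pmf" where
  "unif_matching H \<equiv> pmf_of_set (perfect_matchings H)"

lemma set_unif_matching:
  "finite H \<Longrightarrow> even (card H) \<Longrightarrow> set_pmf (unif_matching H) = perfect_matchings H"
  by (simp add: finite_perfect_matchings perfect_matchings_nonempty)

text \<open>Principle of deferred decisions: the mate of \<open>x\<close> is uniform among the
  others, and given the mate the rest is again a uniform matching. It may be applied to any
  \<open>x\<close> chosen without looking at the matching.\<close>

lemma expectation_unif_matching:
  fixes \<Phi> :: "'a set set \<Rightarrow> real"
  assumes "finite H" "even (card H)" "x \<in> H"
  shows "measure_pmf.expectation (unif_matching H) \<Phi>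
       = (\<Sum>y\<in>H - {x}. measure_pmf.expectation (unif_matching (H - {x, y})) (\<lambda>M. \<Phi> (insert {x, y} M)))
         / (real (card H) - 1)"
proof -
  let ?c = "real (card (perfect_matchings H)) / (real (card H) - 1)"
  have c2: "2 \<le> card H"
    using assms by (metis card_0_eq empty_iff even_Suc le_SucE le_zero_eq not_less_eq_eq numeral_2_eq_2 odd_one One_nat_def)
  have fin: "finite (perfect_matchings (H - A))" for A
    using assms(1) by (auto intro: finite_perfect_matchings)
  have cd: "card (H - {x, y}) = card H - 2" if "y \<in> H - {x}" for y
    using that assms by (subst card_Diff_subset) auto
  have ne: "perfect_matchings (H - {x, y}) \<noteq> {}" if "y \<in> H - {x}" for y
    using cd[OF that] assms by (intro perfect_matchings_nonempty) auto
  have card_eq: "real (card (perfect_matchings (H - {x, y}))) = ?c" if y: "y \<in> H - {x}" for y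
  proof -
    have "card (perfect_matchings H) = (\<Sum>z\<in>H - {x}. card (perfect_matchings (H - {x, z})))"
      using sum_perfect_matchings[OF assms(1,3), of "\<lambda>_. 1::nat"] by simp
    also have "\<dots> = (\<Sum>z\<in>H - {x}. card (perfect_matchings (H - {x, y})))"
      using cd[OF y] cd assms by (intro sum.cong refl card_perfect_matchings_cong) auto
    also have "\<dots> = (card H - 1) * card (perfect_matchings (H - {x, y}))"
      using assms by simp
    finally have "real (card (perfect_matchings H))
        = (real (card H) - 1) * real (card (perfect_matchings (H - {x, y})))"
      using c2 by (simp add: of_nat_diff)
    then show ?thesis using c2 by simp
  qed
  have "measure_pmf.expectation (unif_matching H) \<Phi>
      = (\<Sum>M\<in>perfect_matchings H. \<Phi> M) / real (card (perfect_matchings H))"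
    using assms finite_perfect_matchings perfect_matchings_nonempty
    by (subst integral_pmf_of_set) auto
  also have "\<dots> = (\<Sum>y\<in>H - {x}. (\<Sum>M\<in>perfect_matchings (H - {x, y}). \<Phi> (insert {x, y} M)))
      / real (card (perfect_matchings H))"
    by (subst sum_perfect_matchings[OF assms(1,3)]) simp
  also have "\<dots> = (\<Sum>y\<in>H - {x}. (\<Sum>M\<in>perfect_matchings (H - {x, y}). \<Phi> (insert {x, y} M)) / ?c)
      / (real (card H) - 1)"
    using c2 by (simp add: sum_divide_distrib[symmetric] sum_distrib_right[symmetric])
  also have "\<dots> = (\<Sum>y\<in>H - {x}. measure_pmf.expectation (unif_matching (H - {x, y}))
        (\<lambda>M. \<Phi> (insert {x, y} M))) / (real (card H) - 1)"
  proof (intro arg_cong[where f = "\<lambda>t. t / _"] sum.cong refl)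
    fix y assume y: "y \<in> H - {x}"
    show "(\<Sum>M\<in>perfect_matchings (H - {x, y}). \<Phi> (insert {x, y} M)) / ?c
      = measure_pmf.expectation (unif_matching (H - {x, y})) (\<lambda>M. \<Phi> (insert {x, y} M))"
      using card_eq[OF y] integral_pmf_of_set[OF ne[OF y] fin, of "\<lambda>M. \<Phi> (insert {x, y} M)"] by simp
  qed
  finally show ?thesis .
qed

section \<open>Peeling\<close>

definition hdeg :: "('v \<times> 'b) set \<Rightarrow> 'v \<Rightarrow> nat" where
  "hdeg R v = card {x\<in>R. fst x = v}"

definition light :: "nat \<Rightarrow> ('v \<times> 'b) set \<Rightarrow> ('v \<times> 'b) set" where
  "light k R = {x\<in>R. hdeg R (fst x) < k}"

text \<open>The choice depends on \<open>R\<close> alone, never on the matching, so that exposing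
  the mate of \<open>pick k R\<close> leaves the rest uniform.\<close>

definition pick :: "nat \<Rightarrow> ('v \<times> 'b) set \<Rightarrow> 'v \<times> 'b" where
  "pick k R = (SOME x. x \<in> light k R)"

text \<open>For a perfect matching the family is a singleton, and the union names its member without
  a choice operator.\<close>

definition edge_at :: "'a set set \<Rightarrow> 'a \<Rightarrow> 'a set" where
  "edge_at M x = \<Union>{e\<in>M. x \<in> e}"

text \<open>The argument \<open>j\<close> is a fixed inspection time: the state after at most
  \<open>j\<close> deletions, frozen as soon as no light half-edge is left.\<close>

fun peel :: "nat \<Rightarrow> nat \<Rightarrow> ('v \<times> 'b) set \<Rightarrow> ('v \<times> 'b) set set \<Rightarrow> ('v \<times> 'b) set" where
  "peel k 0 R M = R"
| "peel k (Suc j) R M =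
    (if light k R = {} then R
     else peel k j (R - edge_at M (pick k R)) (M - {edge_at M (pick k R)}))"

lemma pick_light: "light k R \<noteq> {} \<Longrightarrow> pick k R \<in> light k R"
  by (simp add: pick_def some_in_eq)

lemma pick_in: "light k R \<noteq> {} \<Longrightarrow> pick k R \<in> R"
  using pick_light[of k R] by (simp add: light_def)

lemma hdeg_mono: "finite R \<Longrightarrow> A \<subseteq> R \<Longrightarrow> hdeg A v \<le> hdeg R v"
  unfolding hdeg_def by (intro card_mono) auto

lemma in_fst_image_if_hdeg:
  assumes "k \<ge> 1" "k \<le> hdeg A v"
  shows "v \<in> fst ` A"
proof (rule ccontr)
  assume "v \<notin> fst ` A"
  then have "{x\<in>A. fst x = v} = {}" by force
  then have "hdeg A v = 0" by (simp only: hdeg_def card.empty)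
  then show False using assms by simp
qed

lemma edge_at_insert:
  "x \<notin> \<Union>M \<Longrightarrow> edge_at (insert {x, y} M) x = {x, y}"
  unfolding edge_at_def by auto

lemma edge_at_eq:
  assumes "M \<in> perfect_matchings H" "e \<in> M" "x \<in> e"
  shows "edge_at M x = e"
proof -
  have "{e\<in>M. x \<in> e} = {e}"
    using assms by (auto simp: perfect_matchings_def partition_on_def disjoint_def)
  then show ?thesis by (simp add: edge_at_def)
qed

lemma edge_at_mate:
  assumes "M \<in> perfect_matchings H" "x \<in> H"
  obtains y where "edge_at M x = {x, y}" "{x, y} \<in> M" "y \<in> H" "x \<noteq> y"
  using perfect_matchings_mate[OF assms] edge_at_eq[OF assms(1)] by (metis insertI1)

lemma peel_step:
  assumes "M \<in> perfect_matchings R" "light k R \<noteq> {}"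
  obtains y where "{pick k R, y} \<in> M" "y \<in> R" "y \<noteq> pick k R"
    "peel k (Suc j) R M = peel k j (R - {pick k R, y}) (M - {{pick k R, y}})"
    "M - {{pick k R, y}} \<in> perfect_matchings (R - {pick k R, y})"
proof -
  obtain y where y: "edge_at M (pick k R) = {pick k R, y}" "{pick k R, y} \<in> M" "y \<in> R" "pick k R \<noteq> y"
    using edge_at_mate[OF assms(1) pick_in[OF assms(2)]] by metis
  then show ?thesis using that[of y] assms perfect_matchings_remove[OF y(2) assms(1)] by simp
qed

lemma peel_subset: "peel k j R M \<subseteq> R"
proof (induction j arbitrary: R M)
  case (Suc j)
  then show ?case by (simp del: Diff_subset) (meson Diff_subset subset_trans)
qed simp

text \<open>Each deletion removes two half-edges, and only a lack of light half-edges can prevent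
  one. The size of the state therefore tells whether the process is still on schedule.\<close>

lemma card_peel:
  assumes "finite R" "M \<in> perfect_matchings R"
  shows "card (peel k j R M) + 2 * j \<ge> card R \<and>
    (light k (peel k j R M) \<noteq> {} \<longrightarrow> card (peel k j R M) + 2 * j = card R)"
  using assms
proof (induction j arbitrary: R M)
  case (Suc j)
  show ?case
  proof (cases "light k R = {}")
    case False
    obtain y where y: "{pick k R, y} \<in> M" "y \<in> R" "y \<noteq> pick k R"
      "peel k (Suc j) R M = peel k j (R - {pick k R, y}) (M - {{pick k R, y}})"
      "M - {{pick k R, y}} \<in> perfect_matchings (R - {pick k R, y})"
      using peel_step[OF Suc.prems(2) False] by metis
    have "card (R - {pick k R, y}) + 2 = card R"
    proof -
      have "card (R - {pick k R, y}) = card R - card {pick k R, y}"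
        using pick_in[OF False] y by (intro card_Diff_subset) auto
      moreover have "card {pick k R, y} = 2" using y by auto
      moreover have "card {pick k R, y} \<le> card R"
        using pick_in[OF False] y Suc.prems by (intro card_mono) auto
      ultimately show ?thesis by simp
    qed
    then show ?thesis using Suc.IH[OF _ y(5)] Suc.prems y(4) by auto
  qed auto
qed auto

lemma even_card_peel:
  assumes "finite R" "M \<in> perfect_matchings R" "even (card R)"
  shows "even (card (peel k j R M))"
  using assms
proof (induction j arbitrary: R M)
  case (Suc j)
  show ?case
  proof (cases "light k R = {}")
    case False
    obtain y where y: "{pick k R, y} \<in> M" "y \<in> R" "y \<noteq> pick k R"
      "peel k (Suc j) R M = peel k j (R - {pick k R, y}) (M - {{pick k R, y}})"
      "M - {{pick k R, y}} \<in> perfect_matchings (R - {pick k R, y})"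
      using peel_step[OF Suc.prems(2) False] by metis
    have "card (R - {pick k R, y}) = card R - card {pick k R, y}"
      using pick_in[OF False] y by (intro card_Diff_subset) auto
    moreover have "card {pick k R, y} = 2" using y by auto
    ultimately have "even (card (R - {pick k R, y}))" using Suc.prems by simp
    then show ?thesis using Suc.IH[OF _ y(5)] Suc.prems y(4) by auto
  qed (use Suc in auto)
qed auto

lemma peel_stop: "light k R = {} \<Longrightarrow> peel k j R M = R"
  by (cases j) auto

lemma peel_add_stop:
  assumes "light k (peel k j R M) = {}" "j \<le> l"
  shows "peel k l R M = peel k j R M"
  using assms
proof (induction j arbitrary: R M l)
  case 0
  then show ?case by (simp add: peel_stop)
next
  case (Suc j)
  then obtain l' where l: "l = Suc l'" by (cases l) auto
  show ?case
  proof (cases "light k R = {}")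
    case False
    then show ?thesis using Suc.IH[of "R - edge_at M (pick k R)" "M - {edge_at M (pick k R)}" l'] Suc.prems l
      by simp
  qed (simp add: peel_stop)
qed

lemma peel_antimono: "j \<le> l \<Longrightarrow> peel k l R M \<subseteq> peel k j R M"
proof (induction j arbitrary: R M l)
  case 0
  then show ?case by (simp add: peel_subset)
next
  case (Suc j)
  then obtain l' where "l = Suc l'" by (cases l) auto
  with Suc show ?case by auto
qed

text \<open>\<open>card R\<close> rounds are always enough, since each removes two
  half-edges.\<close>

definition core_set :: "nat \<Rightarrow> ('v \<times> 'b) set \<Rightarrow> ('v \<times> 'b) set set \<Rightarrow> ('v \<times> 'b) set" where
  "core_set k R M = peel k (card R) R M"

lemma light_core_set:
  assumes "finite R" "M \<in> perfect_matchings R"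
  shows "light k (core_set k R M) = {}"
proof (rule ccontr)
  assume h: "light k (core_set k R M) \<noteq> {}"
  then have "card (core_set k R M) + 2 * card R = card R"
    using card_peel[OF assms, of k "card R"] by (auto simp: core_set_def)
  then have "card R = 0" by simp
  then show False using h assms by (auto simp: core_set_def light_def)
qed

lemma core_set_subset_peel:
  assumes "finite R" "M \<in> perfect_matchings R"
  shows "core_set k R M \<subseteq> peel k j R M"
proof (cases "j \<le> card R")
  case True
  then show ?thesis by (simp add: core_set_def peel_antimono)
next
  case False
  then show ?thesis
    using light_core_set[OF assms, of k] peel_add_stop[of k "card R" R M j]
    by (simp add: core_set_def)
qed

lemma peel_eq_core_set:
  assumes "finite R" "M \<in> perfect_matchings R" "light k (peel k j R M) = {}"
  shows "peel k j R M = core_set k R M"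
proof (cases "j \<le> card R")
  case True
  then show ?thesis using peel_add_stop[OF assms(3) True] by (simp add: core_set_def)
next
  case False
  then show ?thesis
    using light_core_set[OF assms(1,2), of k] peel_add_stop[of k "card R" R M j]
    by (simp add: core_set_def)
qed

lemma peel_eq_core_set_of_card:
  assumes "finite R" "M \<in> perfect_matchings R" "card (peel k j R M) + 2 * j \<noteq> card R"
  shows "peel k j R M = core_set k R M"
  using peel_eq_core_set[OF assms(1,2)] card_peel[OF assms(1,2)] assms(3) by blast

text \<open>If all \<open>j\<close> rounds took place, the count is exact. Otherwise the state is
  the core, and the assumed upper bound meets the lower bound of \<open>card_peel\<close>.\<close>

lemma card_peel_of_card_core_set:
  assumes "finite R" "M \<in> perfect_matchings R" "card (core_set k R M) + 2 * j \<le> card R"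
  shows "card (peel k j R M) + 2 * j = card R"
  using peel_eq_core_set_of_card[OF assms(1,2), of k j] assms(3)
    card_peel[OF assms(1,2), of k j] by force

text \<open>For \<open>A\<close> inside \<Union>M this says that \<open>A\<close> is a union of
  edges, that is, the half-edge set of a subgraph.\<close>

definition closed_in :: "'a set set \<Rightarrow> 'a set \<Rightarrow> bool" where
  "closed_in M A \<longleftrightarrow> (\<forall>e\<in>M. e \<inter> A \<noteq> {} \<longrightarrow> e \<subseteq> A)"

lemma closed_in_peel:
  assumes "M \<in> perfect_matchings R"
  shows "closed_in M (peel k j R M)"
  using assms
proof (induction j arbitrary: R M)
  case 0
  then show ?case by (auto simp: closed_in_def perfect_matchings_def partition_on_def)
next
  case (Suc j)
  show ?case
  proof (cases "light k R = {}")
    case True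
    then show ?thesis using Suc.prems by (auto simp: closed_in_def perfect_matchings_def partition_on_def)
  next
    case False
    obtain y where y: "{pick k R, y} \<in> M" "y \<in> R" "y \<noteq> pick k R"
      "peel k (Suc j) R M = peel k j (R - {pick k R, y}) (M - {{pick k R, y}})"
      "M - {{pick k R, y}} \<in> perfect_matchings (R - {pick k R, y})"
      using peel_step[OF Suc.prems False] by metis
    have "closed_in (M - {{pick k R, y}}) (peel k (Suc j) R M)"
      using Suc.IH[OF y(5)] y(4) by simp
    moreover have "peel k (Suc j) R M \<subseteq> R - {pick k R, y}" using peel_subset y(4) by metis
    ultimately show ?thesis unfolding closed_in_def by blast
  qed
qed

text \<open>Peeling never touches \<open>A\<close>: a half-edge that is light in \<open>R\<close>
  cannot lie in \<open>A\<close>, whose degrees are at least \<open>k\<close> and no larger than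
  those in \<open>R\<close>; its mate then lies outside \<open>A\<close> as well because
  \<open>A\<close> is closed. The outcome is thus the largest such set, whatever the order of
  deletions.\<close>

lemma subset_peel:
  assumes "finite R" "M \<in> perfect_matchings R" "A \<subseteq> R" "closed_in M A"
    "\<And>x. x \<in> A \<Longrightarrow> k \<le> hdeg A (fst x)"
  shows "A \<subseteq> peel k j R M"
  using assms(1-4)
proof (induction j arbitrary: R M)
  case (Suc j)
  show ?case
  proof (cases "light k R = {}")
    case True
    then show ?thesis using Suc.prems by auto
  next
    case False
    obtain y where y: "{pick k R, y} \<in> M" "y \<in> R" "y \<noteq> pick k R"
      "peel k (Suc j) R M = peel k j (R - {pick k R, y}) (M - {{pick k R, y}})"
      "M - {{pick k R, y}} \<in> perfect_matchings (R - {pick k R, y})"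
      using peel_step[OF Suc.prems(2) False] by metis
    have "pick k R \<notin> A"
    proof
      assume h: "pick k R \<in> A"
      have "hdeg A (fst (pick k R)) \<le> hdeg R (fst (pick k R))"
        using Suc.prems by (intro hdeg_mono) auto
      then show False using pick_light[OF False] assms(5)[OF h] by (auto simp: light_def)
    qed
    then have "{pick k R, y} \<inter> A = {}" using y(1) Suc.prems(4) by (auto simp: closed_in_def)
    then have "A \<subseteq> R - {pick k R, y}" "closed_in (M - {{pick k R, y}}) A"
      using Suc.prems by (auto simp: closed_in_def)
    then show ?thesis
      using Suc.IH[OF _ y(5)] Suc.prems(1) unfolding y(4) by simp
  qed
qed auto

section \<open>The core of the matching multigraph\<close>

definition inner_half_edges :: "(nat \<times> nat) set set \<Rightarrow> nat set \<Rightarrow> (nat \<times> nat) set" where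
  "inner_half_edges M S = \<Union>{e\<in>M. fst ` e \<subseteq> S}"

lemma perfect_matching_facts:
  assumes "M \<in> perfect_matchings (half_edges n d)"
  shows "\<Union>M = half_edges n d" "disjoint M" "finite M" "\<And>e. e \<in> M \<Longrightarrow> finite e"
    "\<And>e. e \<in> M \<Longrightarrow> card e = 2"
proof -
  show U: "\<Union>M = half_edges n d" and "disjoint M"
    using assms by (auto simp: perfect_matchings_def partition_on_def)
  show "finite M" using U finite_half_edges[of n d] by (metis finite_UnionD)
  show "\<And>e. e \<in> M \<Longrightarrow> card e = 2" using assms by (auto simp: perfect_matchings_def)
  then show "\<And>e. e \<in> M \<Longrightarrow> finite e" by (metis card.infinite zero_neq_numeral)
qed

lemma edges_induced_matching:
  assumes "M \<in> perfect_matchings (half_edges n d)"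
  shows "edges (induced_subgraph (matching_multigraph n M) S)
    = image_mset (\<lambda>e. image_mset fst (mset_set e)) (mset_set {e\<in>M. fst ` e \<subseteq> S})"
proof -
  note M = perfect_matching_facts[OF assms]
  have "edges (induced_subgraph (matching_multigraph n M) S)
    = image_mset (\<lambda>e. image_mset fst (mset_set e))
        (filter_mset (\<lambda>e. set_mset (image_mset fst (mset_set e)) \<subseteq> S) (mset_set M))"
    by (simp add: induced_subgraph_def matching_multigraph_def filter_mset_image_mset o_def)
  also have "filter_mset (\<lambda>e. set_mset (image_mset fst (mset_set e)) \<subseteq> S) (mset_set M)
    = filter_mset (\<lambda>e. fst ` e \<subseteq> S) (mset_set M)"
    using M by (intro filter_mset_cong refl) auto
  also have "\<dots> = mset_set {e\<in>M. fst ` e \<subseteq> S}"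
    using M by simp
  finally show ?thesis .
qed

lemma vertex_degree_induced_matching:
  assumes "M \<in> perfect_matchings (half_edges n d)"
  shows "vertex_degree (induced_subgraph (matching_multigraph n M) S) i = hdeg (inner_half_edges M S) i"
proof -
  note M = perfect_matching_facts[OF assms]
  let ?M = "{e\<in>M. fst ` e \<subseteq> S}"
  have "vertex_degree (induced_subgraph (matching_multigraph n M) S) i
      = (\<Sum>e\<in>?M. count (image_mset fst (mset_set e)) i)"
    by (simp add: vertex_degree_def edges_induced_matching[OF assms] sum_unfold_sum_mset count_sum
        flip: sum_unfold_sum_mset)
  also have "\<dots> = (\<Sum>e\<in>?M. card {x\<in>e. fst x = i})"
    using M by (intro sum.cong refl)
       (auto simp: count_image_mset Collect_conj_eq vimage_def Int_commute)
  also have "\<dots> = card (\<Union>e\<in>?M. {x\<in>e. fst x = i})"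
    using M by (intro card_UN_disjoint[symmetric]) (auto simp: disjoint_def)
  also have "(\<Union>e\<in>?M. {x\<in>e. fst x = i}) = {x\<in>inner_half_edges M S. fst x = i}"
    by (auto simp: inner_half_edges_def)
  finally show ?thesis by (simp add: hdeg_def)
qed

text \<open>The vertices met by \<open>core_set\<close> are admissible, and the half-edges inside
  any admissible \<open>S\<close> form a closed set with degrees at least \<open>k\<close>, so they
  survive peeling. The bound \<open>k \<ge> 1\<close> excludes isolated vertices, which sets of
  half-edges cannot see.\<close>

lemma kcore_matching_multigraph:
  assumes "M \<in> perfect_matchings (half_edges n d)" "k \<ge> 1"
  shows "verts (kcore k (matching_multigraph n M)) = fst ` core_set k (half_edges n d) M"
    "2 * size (edges (kcore k (matching_multigraph n M))) = card (core_set k (half_edges n d) M)"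
proof -
  let ?G = "matching_multigraph n M" and ?H = "half_edges n d"
  let ?C = "core_set k ?H M"
  note M = perfect_matching_facts[OF assms(1)]
  have finH: "finite ?H" by (rule finite_half_edges)
  have vG: "verts ?G = {1..n}" by (simp add: matching_multigraph_def)
  have CH: "?C \<subseteq> ?H" by (simp add: core_set_def peel_subset)
  have clC: "closed_in M ?C" unfolding core_set_def by (rule closed_in_peel[OF assms(1)])
  have CI: "?C \<subseteq> inner_half_edges M (fst ` ?C)"
  proof
    fix x assume x: "x \<in> ?C"
    then obtain e where "e \<in> M" "x \<in> e" using CH M(1) by blast
    moreover then have "e \<subseteq> ?C" using clC x by (auto simp: closed_in_def)
    ultimately show "x \<in> inner_half_edges M (fst ` ?C)" by (auto simp: inner_half_edges_def)
  qed
  have hd: "k \<le> hdeg ?C (fst x)" if "x \<in> ?C" for x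
    using light_core_set[OF finH assms(1), of k] that unfolding light_def by (metis (mono_tags, lifting) empty_iff mem_Collect_eq not_less)
  have finI: "finite (inner_half_edges M S)" for S
    using finite_subset[OF _ finH, of "inner_half_edges M S"] M(1) by (auto simp: inner_half_edges_def)
  have adm: "min_degree_ge k (induced_subgraph ?G (fst ` ?C))"
    unfolding min_degree_ge_def
  proof
    fix v assume "v \<in> verts (induced_subgraph ?G (fst ` ?C))"
    then obtain x where x: "x \<in> ?C" "v = fst x" by (auto simp: induced_subgraph_def)
    then have "k \<le> hdeg ?C v" using hd by simp
    also have "\<dots> \<le> hdeg (inner_half_edges M (fst ` ?C)) v"
      by (rule hdeg_mono[OF finI CI])
    finally show "k \<le> vertex_degree (induced_subgraph ?G (fst ` ?C)) v"
      by (simp add: vertex_degree_induced_matching[OF assms(1)])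
  qed
  have IC: "inner_half_edges M S \<subseteq> ?C" if S: "min_degree_ge k (induced_subgraph ?G S)" for S
    unfolding core_set_def
  proof (rule subset_peel[OF finH assms(1)])
    show "inner_half_edges M S \<subseteq> ?H" using M(1) by (auto simp: inner_half_edges_def)
    show "closed_in M (inner_half_edges M S)"
      unfolding closed_in_def
    proof (intro ballI impI)
      fix e assume e: "e \<in> M" "e \<inter> inner_half_edges M S \<noteq> {}"
      then obtain e' where "e' \<in> M" "fst ` e' \<subseteq> S" "e \<inter> e' \<noteq> {}"
        by (auto simp: inner_half_edges_def)
      moreover from this have "e = e'" using M(2) e(1) by (auto simp: disjoint_def)
      ultimately show "e \<subseteq> inner_half_edges M S" by (auto simp: inner_half_edges_def)
    qed
    fix x assume "x \<in> inner_half_edges M S"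
    then have "fst x \<in> S" by (auto simp: inner_half_edges_def)
    then show "k \<le> hdeg (inner_half_edges M S) (fst x)"
      using S vertex_degree_induced_matching[OF assms(1), of S]
      by (auto simp: min_degree_ge_def induced_subgraph_def)
  qed
  have sub: "S \<subseteq> fst ` ?C" if S: "min_degree_ge k (induced_subgraph ?G S)" for S
  proof
    fix v assume "v \<in> S"
    then have "k \<le> hdeg (inner_half_edges M S) v"
      using S vertex_degree_induced_matching[OF assms(1), of S]
      by (auto simp: min_degree_ge_def induced_subgraph_def)
    then have "v \<in> fst ` inner_half_edges M S" by (rule in_fst_image_if_hdeg[OF assms(2)])
    then show "v \<in> fst ` ?C" using IC[OF S] by auto
  qed
  have "fst ` ?C \<subseteq> verts ?G" using CH by (auto simp: vG half_edges_def)
  then have U: "\<Union>{S. S \<subseteq> verts ?G \<and> min_degree_ge k (induced_subgraph ?G S)} = fst ` ?C"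
    using adm sub by blast
  have core: "kcore k ?G = induced_subgraph ?G (fst ` ?C)"
    by (simp add: kcore_eq_Union U)
  then show "verts (kcore k ?G) = fst ` ?C" by (simp add: induced_subgraph_def)
  let ?E = "{e\<in>M. fst ` e \<subseteq> fst ` ?C}"
  \<comment> \<open>The core consists of all half-edges of edges inside its own vertex set: one
    inclusion is closedness, the other is maximality applied to that vertex set.\<close>
  have "card ?C = card (\<Union>?E)"
    using equalityI[OF CI IC[OF adm]] unfolding inner_half_edges_def by (rule arg_cong)
  also have "\<dots> = (\<Sum>e\<in>?E. card e)"
    using M by (intro card_Union_disjoint) (auto simp: disjoint_def pairwise_def disjnt_def)
  also have "\<dots> = 2 * card ?E" using M by simp
  finally show "2 * size (edges (kcore k ?G)) = card ?C"
    by (simp add: core edges_induced_matching[OF assms(1)])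
qed

lemma card_fst_core_set:
  assumes "M \<in> perfect_matchings (half_edges n d)" "k \<ge> 1"
  shows "card (fst ` core_set k (half_edges n d) M)
       = card {v\<in>{1..n}. k \<le> hdeg (core_set k (half_edges n d) M) v}"
proof -
  let ?C = "core_set k (half_edges n d) M"
  have "k \<le> hdeg ?C (fst x)" if "x \<in> ?C" for x
    using light_core_set[OF finite_half_edges assms(1), of k] that unfolding light_def by (metis (mono_tags, lifting) empty_iff mem_Collect_eq not_less)
  moreover have "v \<in> fst ` ?C" if "k \<le> hdeg ?C v" for v
    using in_fst_image_if_hdeg[OF assms(2) that] .
  moreover have "fst ` ?C \<subseteq> {1..n}"
  proof -
    have "?C \<subseteq> half_edges n d" by (simp add: core_set_def peel_subset)
    moreover have "fst ` half_edges n d \<subseteq> {1..n}" by (auto simp: half_edges_def)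
    ultimately show ?thesis by blast
  qed
  ultimately have "fst ` ?C = {v\<in>{1..n}. k \<le> hdeg ?C v}" by auto
  then show ?thesis by simp
qed

section \<open>A martingale for the peeling process\<close>

text \<open>The conditional expectation of \<open>f\<close> of the degree of a vertex at the time when only \<open>s\<close>
  half-edges are left, given that it now has \<open>d\<close> of the remaining \<open>s + 2 * i\<close> half-edges.\<close>

fun mean_deg :: "(nat \<Rightarrow> real) \<Rightarrow> nat \<Rightarrow> nat \<Rightarrow> nat \<Rightarrow> real" where
  "mean_deg f s 0 d = f d"
| "mean_deg f s (Suc i) d = mean_deg f s i d
     - real d / real (s + 2 * i + 1) * (mean_deg f s i d - mean_deg f s i (d - 1))"

text \<open>The recursion consults only \<open>d\<close> and \<open>d - 1\<close>, so vanishing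
  below \<open>k\<close> persists. Light vertices contribute nothing, however they lose their
  half-edges.\<close>

lemma mean_deg_zero:
  assumes "\<And>d. d < k \<Longrightarrow> f d = 0" "d < k"
  shows "mean_deg f s i d = 0"
  using assms(2) by (induction i arbitrary: d) (auto simp: assms(1))

text \<open>An increment at level \<open>Suc i\<close> combines two increments at level
  \<open>i\<close> with non-negative coefficients \<open>1 - t\<close> and \<open>r\<close>, where
  \<open>r \<le> t\<close>. The hypothesis \<open>d \<le> s\<close> gives
  \<open>t \<le> 1\<close>.\<close>

lemma mean_deg_Lipschitz:
  assumes "\<And>d. \<bar>f (Suc d) - f d\<bar> \<le> L" "d \<le> s"
  shows "\<bar>mean_deg f s i (Suc d) - mean_deg f s i d\<bar> \<le> L"
  using assms(2)
proof (induction i arbitrary: d)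
  case 0
  then show ?case by (simp add: assms(1))
next
  case (Suc i)
  let ?M = "real (s + 2 * i + 1)"
  let ?g = "mean_deg f s i"
  define t where "t = (real d + 1) / ?M"
  define r where "r = real d / ?M"
  have L: "0 \<le> L" using assms(1)[of 0] by linarith
  have t: "0 \<le> 1 - t" "0 \<le> r" "r \<le> t"
    using Suc.prems by (auto simp: t_def r_def divide_simps)
  have "mean_deg f s (Suc i) (Suc d) - mean_deg f s (Suc i) d
      = (1 - t) * (?g (Suc d) - ?g d) + r * (?g d - ?g (d - 1))"
    by (simp add: t_def r_def algebra_simps add_divide_distrib)
  also have "\<bar>\<dots>\<bar> \<le> (1 - t) * L + r * L"
  proof -
    have "\<bar>?g (Suc d) - ?g d\<bar> \<le> L" using Suc by simp
    then have 1: "\<bar>(1 - t) * (?g (Suc d) - ?g d)\<bar> \<le> (1 - t) * L"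
      using t(1) by (simp add: abs_mult mult_left_mono)
    have "r * \<bar>?g d - ?g (d - 1)\<bar> \<le> r * L"
    proof (cases d)
      case 0 then show ?thesis by (simp add: r_def)
    next
      case (Suc d')
      then show ?thesis using Suc.IH[of d'] Suc.prems t(2) by (intro mult_left_mono) auto
    qed
    then have 2: "\<bar>r * (?g d - ?g (d - 1))\<bar> \<le> r * L" using t(2) by (simp add: abs_mult)
    show ?thesis using 1 2 by linarith
  qed
  also have "\<dots> = L - (t - r) * L" by (simp add: algebra_simps)
  also have "\<dots> \<le> L" using t L by simp
  finally show ?case .
qed

text \<open>For the case that peeling stops early: \<open>final_sum\<close> then still contains
  conditional means in place of indicators, and these must not exceed 1.\<close>

lemma mean_deg_le_1:
  assumes "\<And>d. f d \<le> 1" "d \<le> s + 1"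
  shows "mean_deg f s i d \<le> 1"
  using assms(2)
proof (induction i arbitrary: d)
  case 0
  then show ?case by (simp add: assms(1))
next
  case (Suc i)
  define t where "t = real d / real (s + 2 * i + 1)"
  have t: "0 \<le> t" "t \<le> 1" using Suc.prems by (auto simp: t_def divide_simps)
  have "mean_deg f s (Suc i) d = (1 - t) * mean_deg f s i d + t * mean_deg f s i (d - 1)"
    by (simp add: t_def algebra_simps diff_divide_distrib)
  also have "\<dots> \<le> (1 - t) * 1 + t * 1"
    using Suc t by (intro add_mono mult_left_mono) auto
  finally show ?case by simp
qed

definition degree_sum ::
    "(nat \<Rightarrow> real) \<Rightarrow> nat \<Rightarrow> 'v set \<Rightarrow> nat \<Rightarrow> ('v \<times> 'b) set \<Rightarrow> real" where
  "degree_sum f s V i R = (\<Sum>v\<in>V. mean_deg f s i (hdeg R v))"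

lemma hdeg_remove_pair:
  assumes "finite R" "x \<in> R" "y \<in> R" "v \<noteq> fst x"
  shows "hdeg (R - {x, y}) v = (if fst y = v then hdeg R v - 1 else hdeg R v)"
proof -
  have "{z\<in>R - {x, y}. fst z = v} = (if fst y = v then {z\<in>R. fst z = v} - {y} else {z\<in>R. fst z = v})"
    using assms by auto
  then show ?thesis using assms by (auto simp: hdeg_def)
qed

text \<open>The mean of the left-hand summand over the mate \<open>y\<close> is what the recursion for
  \<^const>\<open>mean_deg\<close> is made for: the light vertex does not contribute, and any other vertex of degree
  \<open>D\<close> loses a half-edge with probability \<open>D / (card R - 1)\<close>.\<close>

lemma sum_square_remove_pair:
  fixes f :: "nat \<Rightarrow> real" and R :: "('v \<times> 'b) set"
  assumes fin: "finite R" "finite V" and cR: "card R = s + 2 * Suc i"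
    and x: "x \<in> R" "hdeg R (fst x) < k"
    and f0: "\<And>d. d < k \<Longrightarrow> f d = 0" and fL: "\<And>d. \<bar>f (Suc d) - f d\<bar> \<le> L"
    and V: "\<And>v. v \<in> V \<Longrightarrow> hdeg R v \<le> s + 1"
  shows "(\<Sum>y\<in>R - {x}. (degree_sum f s V i (R - {x, y}) - a)\<^sup>2)
      \<le> (real (card R) - 1) * ((degree_sum f s V (Suc i) R - a)\<^sup>2 + L\<^sup>2)"
proof -
  let ?g = "mean_deg f s i"
  define M where "M = real (card R) - 1"
  define b where "b = degree_sum f s V i R"
  define \<mu> where "\<mu> = degree_sum f s V (Suc i) R"
  define \<delta> where "\<delta> v = ?g (hdeg R v) - ?g (hdeg R v - 1)" for v
  define D where "D y = (if fst y \<in> V then \<delta> (fst y) else 0)" for y :: "'v \<times> 'b"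
  have M: "M = real (s + 2 * i + 1)" "M > 0" using cR by (auto simp: M_def)
  have \<delta>x: "\<delta> (fst x) = 0"
    using mean_deg_zero[of k f _ s i] f0 x(2) by (auto simp: \<delta>_def)
  have step: "degree_sum f s V i (R - {x, y}) = b - D y" if y: "y \<in> R - {x}" for y
  proof -
    have "?g (hdeg (R - {x, y}) v) = ?g (hdeg R v) - (if v = fst y then \<delta> v else 0)" for v
    proof (cases "v = fst x")
      case True
      have "hdeg (R - {x, y}) v \<le> hdeg R v" using fin by (intro hdeg_mono) auto
      then have "hdeg (R - {x, y}) v < k" "hdeg R v < k" using True x(2) by auto
      then show ?thesis using True \<delta>x mean_deg_zero[of k f _ s i] f0 by auto
    next
      case False
      then show ?thesis using hdeg_remove_pair[OF fin(1) x(1) _ False, of y] y by (auto simp: \<delta>_def)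
    qed
    then have "degree_sum f s V i (R - {x, y}) = b - (\<Sum>v\<in>V. if v = fst y then \<delta> v else 0)"
      by (simp add: degree_sum_def b_def sum_subtractf)
    also have "(\<Sum>v\<in>V. if v = fst y then \<delta> v else 0) = D y"
      using fin by (simp add: D_def)
    finally show ?thesis .
  qed
  have cardM: "real (card (R - {x})) = M" using x(1) fin cR by (simp add: M_def)
  have "(\<Sum>y\<in>R - {x}. D y) = (\<Sum>y\<in>R - {x}. \<Sum>v\<in>V. if fst y = v then \<delta> v else 0)"
    using fin by (simp add: D_def)
  also have "\<dots> = (\<Sum>v\<in>V. \<Sum>y\<in>R - {x}. if fst y = v then \<delta> v else 0)"
    by (rule sum.swap)
  also have "\<dots> = (\<Sum>v\<in>V. real (hdeg R v) * \<delta> v)"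
  proof (intro sum.cong refl)
    fix v
    have "(\<Sum>y\<in>R - {x}. if fst y = v then \<delta> v else 0) = real (card {y\<in>R - {x}. fst y = v}) * \<delta> v"
      using fin by (simp add: sum.If_cases Int_def)
    also have "\<dots> = real (hdeg R v) * \<delta> v"
    \<comment> \<open>At the vertex of \<open>x\<close> the count is one short of
      \<open>hdeg R v\<close>, but \<open>\<delta> v\<close> is 0 there.\<close>
    proof (cases "v = fst x")
      case False
      then have "{y\<in>R - {x}. fst y = v} = {y\<in>R. fst y = v}" by auto
      then show ?thesis by (simp add: hdeg_def)
    qed (use \<delta>x in simp)
    finally show "(\<Sum>y\<in>R - {x}. if fst y = v then \<delta> v else 0) = real (hdeg R v) * \<delta> v" .
  qed
  also have "\<dots> = M * (b - \<mu>)"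
  proof -
    have "b - \<mu> = (\<Sum>v\<in>V. real (hdeg R v) / M * \<delta> v)"
      by (simp add: b_def \<mu>_def degree_sum_def \<delta>_def M(1) sum_subtractf)
    then show ?thesis using M(2) by (simp add: sum_distrib_left)
  qed
  finally have sumD: "(\<Sum>y\<in>R - {x}. D y) = M * (b - \<mu>)" .
  have "\<bar>\<delta> v\<bar> \<le> L" if "v \<in> V" for v
  proof (cases "hdeg R v")
    case 0
    then show ?thesis using fL[of 0] by (simp add: \<delta>_def)
  next
    case (Suc d')
    then show ?thesis using mean_deg_Lipschitz[of f L d' s i] fL V[OF that] by (simp add: \<delta>_def)
  qed
  moreover have "0 \<le> L" using fL[of 0] by linarith
  ultimately have "(D y)\<^sup>2 \<le> L\<^sup>2" for y
    by (auto simp: D_def abs_le_square_iff[symmetric])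
  then have sumD2: "(\<Sum>y\<in>R - {x}. (D y)\<^sup>2) \<le> M * L\<^sup>2"
    using sum_bounded_above[of "R - {x}" "\<lambda>y. (D y)\<^sup>2" "L\<^sup>2"] cardM by simp
  have "(\<Sum>y\<in>R - {x}. (degree_sum f s V i (R - {x, y}) - a)\<^sup>2)
      = (\<Sum>y\<in>R - {x}. (b - a)\<^sup>2 - 2 * (b - a) * D y + (D y)\<^sup>2)"
    by (intro sum.cong refl) (simp add: step power2_eq_square algebra_simps)
  also have "\<dots> = M * (b - a)\<^sup>2 - 2 * (b - a) * (M * (b - \<mu>)) + (\<Sum>y\<in>R - {x}. (D y)\<^sup>2)"
    using cardM by (simp add: sum.distrib sum_subtractf sum_distrib_left[symmetric] sumD)
  also have "\<dots> \<le> M * (b - a)\<^sup>2 - 2 * (b - a) * (M * (b - \<mu>)) + M * L\<^sup>2"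
    using sumD2 by simp
  \<comment> \<open>\<open>\<mu>\<close> is the mean after the step, so the second moment about
    \<open>a\<close> splits into \<open>(\<mu> - a)^2\<close> and a variance, here bounded by
    \<open>L^2 - (b - \<mu>)^2\<close>.\<close>
  also have "\<dots> = M * ((\<mu> - a)\<^sup>2 + L\<^sup>2) - M * (b - \<mu>)\<^sup>2"
    by (simp add: power2_eq_square algebra_simps)
  also have "\<dots> \<le> M * ((\<mu> - a)\<^sup>2 + L\<^sup>2)" using M by simp
  finally show ?thesis by (simp add: \<mu>_def M_def)
qed

lemma pmf_expectation_cong:
  fixes \<Phi> :: "'a \<Rightarrow> real"
  assumes "\<And>x. x \<in> set_pmf q \<Longrightarrow> \<Phi> x = \<Psi> x"
  shows "measure_pmf.expectation q \<Phi> = measure_pmf.expectation q \<Psi>"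
  using assms by (intro integral_cong_AE) (auto simp: AE_measure_pmf_iff)

lemma peel_insert:
  assumes "light k R \<noteq> {}" "y \<in> R - {pick k R}"
    "M \<in> perfect_matchings (R - {pick k R, y})"
  shows "peel k (Suc j) R (insert {pick k R, y} M) = peel k j (R - {pick k R, y}) M"
proof -
  note a = perfect_matchings_insert[OF pick_in[OF assms(1)] _ _ assms(3)]
  have "edge_at (insert {pick k R, y} M) (pick k R) = {pick k R, y}"
    using a(3) assms by (intro edge_at_insert) auto
  then show ?thesis using assms a(2) by auto
qed

text \<open>The peeling process freezes when it stops early, so the number of steps to go has to be read off
  from the number of half-edges left.\<close>

definition final_sum ::
    "(nat \<Rightarrow> real) \<Rightarrow> nat \<Rightarrow> 'v set \<Rightarrow> ('v \<times> 'b) set \<Rightarrow> real" where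
  "final_sum f s V R = degree_sum f s V ((card R - s) div 2) R"

text \<open>The variance grows by at most \<open>L^2\<close> per step. The centre \<open>a\<close>
  is arbitrary because the induction hypothesis is applied to all successors of \<open>R\<close>
  with one common centre, while their degree sums differ. If peeling has stopped,
  \<open>final_sum\<close> is the present degree sum and does not fluctuate.\<close>

lemma expectation_square_peel:
  fixes f :: "nat \<Rightarrow> real" and R :: "('v \<times> 'b) set"
  assumes fin: "finite R" "finite V" and cR: "card R = s + 2 * j" and ev: "even s"
    and f0: "\<And>d. d < k \<Longrightarrow> f d = 0" and fL: "\<And>d. \<bar>f (Suc d) - f d\<bar> \<le> L"
    and V: "\<And>v. v \<in> V \<Longrightarrow> hdeg R v \<le> s + 1"
  shows "measure_pmf.expectation (unif_matching R) (\<lambda>M. (final_sum f s V (peel k j R M) - a)\<^sup>2)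
      \<le> (degree_sum f s V j R - a)\<^sup>2 + real j * L\<^sup>2"
  using fin(1) cR V
proof (induction j arbitrary: R)
  case 0
  then show ?case by (simp add: final_sum_def)
next
  case (Suc j)
  show ?case
  proof (cases "light k R = {}")
    case True
    then show ?thesis using Suc.prems by (simp add: final_sum_def)
  next
    case False
    let ?x = "pick k R"
    have evR: "even (card R)" using Suc.prems ev by simp
    have x: "?x \<in> R" "hdeg R (fst ?x) < k" using pick_light[OF False] by (auto simp: light_def)
    have c1: "real (card R) - 1 > 0" using Suc.prems(2) by simp
    have "measure_pmf.expectation (unif_matching R) (\<lambda>M. (final_sum f s V (peel k (Suc j) R M) - a)\<^sup>2)
        = (\<Sum>y\<in>R - {?x}. measure_pmf.expectation (unif_matching (R - {?x, y}))
            (\<lambda>M. (final_sum f s V (peel k (Suc j) R (insert {?x, y} M)) - a)\<^sup>2)) / (real (card R) - 1)"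
      by (rule expectation_unif_matching[OF Suc.prems(1) evR x(1)])
    also have "\<dots> \<le> (\<Sum>y\<in>R - {?x}. (degree_sum f s V j (R - {?x, y}) - a)\<^sup>2 + real j * L\<^sup>2)
        / (real (card R) - 1)"
    proof (intro divide_right_mono sum_mono)
      fix y assume y: "y \<in> R - {?x}"
      have cd: "card (R - {?x, y}) = s + 2 * j"
        using y x Suc.prems by (subst card_Diff_subset) auto
      have finy: "finite (R - {?x, y})" using Suc.prems by simp
      have sy: "set_pmf (unif_matching (R - {?x, y})) = perfect_matchings (R - {?x, y})"
        using cd ev Suc.prems by (intro set_unif_matching) auto
      have "measure_pmf.expectation (unif_matching (R - {?x, y}))
            (\<lambda>M. (final_sum f s V (peel k (Suc j) R (insert {?x, y} M)) - a)\<^sup>2)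
          = measure_pmf.expectation (unif_matching (R - {?x, y}))
            (\<lambda>M. (final_sum f s V (peel k j (R - {?x, y}) M) - a)\<^sup>2)"
        by (intro pmf_expectation_cong) (metis sy peel_insert[OF False y])
      also have "\<dots> \<le> (degree_sum f s V j (R - {?x, y}) - a)\<^sup>2 + real j * L\<^sup>2"
      proof (rule Suc.IH[OF finy cd])
        fix v assume "v \<in> V"
        then have "hdeg R v \<le> s + 1" by (rule Suc.prems(3))
        moreover have "hdeg (R - {?x, y}) v \<le> hdeg R v"
          using Suc.prems by (intro hdeg_mono) auto
        ultimately show "hdeg (R - {?x, y}) v \<le> s + 1" by simp
      qed
      finally show "measure_pmf.expectation (unif_matching (R - {?x, y}))
            (\<lambda>M. (final_sum f s V (peel k (Suc j) R (insert {?x, y} M)) - a)\<^sup>2)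
          \<le> (degree_sum f s V j (R - {?x, y}) - a)\<^sup>2 + real j * L\<^sup>2" .
    qed (use c1 in simp)
    also have "\<dots> = ((\<Sum>y\<in>R - {?x}. (degree_sum f s V j (R - {?x, y}) - a)\<^sup>2)
          + (real (card R) - 1) * (real j * L\<^sup>2)) / (real (card R) - 1)"
      using x(1) Suc.prems(1,2) by (simp add: sum.distrib of_nat_diff)
    also have "\<dots> \<le> ((real (card R) - 1) * ((degree_sum f s V (Suc j) R - a)\<^sup>2 + L\<^sup>2)
          + (real (card R) - 1) * (real j * L\<^sup>2)) / (real (card R) - 1)"
      using c1 sum_square_remove_pair[where f = f and L = L and V = V and a = a,
          OF Suc.prems(1) fin(2) Suc.prems(2) x f0 fL Suc.prems(3)]
      by (intro divide_right_mono add_right_mono) auto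
    also have "\<dots> = ((degree_sum f s V (Suc j) R - a)\<^sup>2 + L\<^sup>2) + real j * L\<^sup>2"
      using c1 by (subst distrib_left[symmetric]) simp
    also have "\<dots> = (degree_sum f s V (Suc j) R - a)\<^sup>2 + real (Suc j) * L\<^sup>2"
      by (simp add: algebra_simps)
    finally show ?thesis .
  qed
qed

lemma pmf_Chebyshev:
  fixes X :: "'a \<Rightarrow> real"
  assumes "finite (set_pmf q)" "\<epsilon> > 0"
  shows "measure_pmf.prob q {x. \<epsilon> < \<bar>X x - a\<bar>}
      \<le> measure_pmf.expectation q (\<lambda>x. (X x - a)\<^sup>2) / \<epsilon>\<^sup>2"
proof -
  have int: "integrable (measure_pmf q) g" for g :: "'a \<Rightarrow> real"
    by (rule integrable_measure_pmf_finite[OF assms(1)])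
  have "measure_pmf.prob q {x. \<epsilon> < \<bar>X x - a\<bar>}
      = measure_pmf.expectation q (indicator {x. \<epsilon> < \<bar>X x - a\<bar>})" by simp
  also have "\<dots> \<le> measure_pmf.expectation q (\<lambda>x. (X x - a)\<^sup>2 / \<epsilon>\<^sup>2)"
  proof (intro integral_mono int)
    fix x
    show "indicator {x. \<epsilon> < \<bar>X x - a\<bar>} x \<le> (X x - a)\<^sup>2 / \<epsilon>\<^sup>2"
    proof (cases "\<epsilon> < \<bar>X x - a\<bar>")
      case True
      then have "\<epsilon>\<^sup>2 \<le> (X x - a)\<^sup>2" using assms(2) by (simp add: abs_le_square_iff[symmetric])
      then show ?thesis using assms(2) True by (simp add: divide_simps)
    qed simp
  qed
  finally show ?thesis by simp
qed

lemma prob_final_sum_deviation: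
  fixes f :: "nat \<Rightarrow> real" and R :: "('v \<times> 'b) set"
  assumes "finite R" "finite V" "card R = s + 2 * j" "even s"
    "\<And>d. d < k \<Longrightarrow> f d = 0" "\<And>d. \<bar>f (Suc d) - f d\<bar> \<le> L"
    "\<And>v. v \<in> V \<Longrightarrow> hdeg R v \<le> s + 1" "\<epsilon> > 0"
  shows "measure_pmf.prob (unif_matching R)
      {M. \<epsilon> < \<bar>final_sum f s V (peel k j R M) - degree_sum f s V j R\<bar>} \<le> real j * L\<^sup>2 / \<epsilon>\<^sup>2"
proof -
  have "finite (set_pmf (unif_matching R))"
    using assms by (subst set_unif_matching) (auto intro: finite_perfect_matchings)
  then have "measure_pmf.prob (unif_matching R)
      {M. \<epsilon> < \<bar>final_sum f s V (peel k j R M) - degree_sum f s V j R\<bar>}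
    \<le> measure_pmf.expectation (unif_matching R)
        (\<lambda>M. (final_sum f s V (peel k j R M) - degree_sum f s V j R)\<^sup>2) / \<epsilon>\<^sup>2"
    using assms(8) by (rule pmf_Chebyshev)
  also have "\<dots> \<le> real j * L\<^sup>2 / \<epsilon>\<^sup>2"
    using expectation_square_peel[where f = f and L = L and V = V and a = "degree_sum f s V j R",
        OF assms(1-7)]
    by (intro divide_right_mono) auto
  finally show ?thesis .
qed

section \<open>Binomial limits\<close>

text \<open>The mean of \<open>f\<close> under the binomial law, spelled out as a polynomial in
  \<open>q\<close>.\<close>

definition binom_mean :: "(nat \<Rightarrow> real) \<Rightarrow> nat \<Rightarrow> real \<Rightarrow> real" where
  "binom_mean f r q = (\<Sum>j\<le>r. f j * (real (r choose j) * q ^ j * (1 - q) ^ (r - j)))"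

lemma sum_binomial_weights: "(\<Sum>j\<le>r. real (r choose j) * q ^ j * (1 - q) ^ (r - j)) = 1" for q :: real
  using binomial_ring[of q "1 - q" r] by simp

lemma binom_mean_bounds:
  assumes "0 \<le> q" "q \<le> 1" "\<And>w. 0 \<le> f w" "\<And>w. f w \<le> real w"
  shows "0 \<le> binom_mean f r q" "binom_mean f r q \<le> real r"
proof -
  show "0 \<le> binom_mean f r q"
    unfolding binom_mean_def using assms by (intro sum_nonneg mult_nonneg_nonneg) auto
  have "binom_mean f r q \<le> (\<Sum>j\<le>r. real r * (real (r choose j) * q ^ j * (1 - q) ^ (r - j)))"
    unfolding binom_mean_def
  proof (intro sum_mono mult_right_mono)
    fix j assume "j \<in> {..r}"
    then show "f j \<le> real r" using assms(4)[of j] by simp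
  qed (use assms in auto)
  also have "\<dots> = real r * (\<Sum>j\<le>r. real (r choose j) * q ^ j * (1 - q) ^ (r - j))"
    by (simp only: sum_distrib_left)
  finally show "binom_mean f r q \<le> real r" by (simp add: sum_binomial_weights)
qed

lemma continuous_on_binom_mean: "continuous_on A (binom_mean f r)"
  unfolding binom_mean_def by (intro continuous_intros)

context
  fixes p :: "nat pmf" and f :: "nat \<Rightarrow> real"
  assumes mean: "summable (\<lambda>r. real r * pmf p r)"
    and f: "\<And>w. 0 \<le> f w" "\<And>w. f w \<le> real w"
begin

lemma binom_mean_summand_le:
  assumes "q \<in> {0..1}"
  shows "norm (pmf p r * binom_mean f r q) \<le> real r * pmf p r"
  using binom_mean_bounds[of q f r] assms f mult_left_mono[of "binom_mean f r q" "real r" "pmf p r"]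
  by (simp add: abs_mult mult.commute)

lemma summable_binom_mean:
  "q \<in> {0..1} \<Longrightarrow> summable (\<lambda>r. pmf p r * binom_mean f r q)"
  by (rule summable_comparison_test[OF _ mean]) (use binom_mean_summand_le in blast)

text \<open>Non-negative integrals let the mixture be integrated in two stages before finiteness is
  known; the series then converges because it is dominated by the mean of \<open>p\<close>.\<close>

lemma expectation_thinning:
  assumes q: "q \<in> {0..1}"
  shows "measure_pmf.expectation (thinning p q) f = (\<Sum>r. pmf p r * binom_mean f r q)"
proof -
  have nn: "0 \<le> binom_mean f r q" for r using binom_mean_bounds[of q f r] q f by simp
  have inner: "(\<integral>\<^sup>+y. ennreal (f y) \<partial>measure_pmf (binomial_pmf l q)) = ennreal (binom_mean f l q)" for l
  proof -
    have "(\<integral>\<^sup>+y. ennreal (f y) \<partial>measure_pmf (binomial_pmf l q))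
        = ennreal (measure_pmf.expectation (binomial_pmf l q) f)"
      using q f by (intro nn_integral_eq_integral) auto
    also have "measure_pmf.expectation (binomial_pmf l q) f = binom_mean f l q"
      using q by (subst expectation_binomial_pmf') (simp_all add: binom_mean_def mult.commute)
    finally show ?thesis .
  qed
  have "(\<integral>\<^sup>+y. ennreal (f y) \<partial>measure_pmf (thinning p q))
      = (\<integral>\<^sup>+l. ennreal (binom_mean f l q) \<partial>measure_pmf p)"
    by (simp add: thinning_def inner)
  also have "\<dots> = (\<Sum>l. ennreal (pmf p l * binom_mean f l q))"
    by (simp add: nn_integral_measure_pmf nn_integral_count_space_nat ennreal_mult' nn)
  also have "\<dots> = ennreal (\<Sum>l. pmf p l * binom_mean f l q)"
    using nn summable_binom_mean[OF q] by (intro suminf_ennreal2) auto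
  finally have "(\<integral>\<^sup>+y. ennreal (f y) \<partial>measure_pmf (thinning p q))
      = ennreal (\<Sum>l. pmf p l * binom_mean f l q)" .
  then have "measure_pmf.expectation (thinning p q) f = enn2real (ennreal (\<Sum>l. pmf p l * binom_mean f l q))"
    using f by (subst integral_eq_nn_integral) auto
  also have "\<dots> = (\<Sum>l. pmf p l * binom_mean f l q)"
    using nn summable_binom_mean[OF q] by (simp add: suminf_nonneg)
  finally show ?thesis .
qed

text \<open>M-test with the majorant \<open>r * pmf p r\<close>, which does not depend on
  \<open>q\<close>.\<close>

lemma continuous_on_expectation_thinning:
  "continuous_on {0..1} (\<lambda>q. measure_pmf.expectation (thinning p q) f)"
proof -
  have "uniform_limit {0..1} (\<lambda>n q. \<Sum>r<n. pmf p r * binom_mean f r q)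
      (\<lambda>q. \<Sum>r. pmf p r * binom_mean f r q) sequentially"
    by (rule Weierstrass_m_test[OF binom_mean_summand_le mean])
  then have "continuous_on {0..1} (\<lambda>q. \<Sum>r. pmf p r * binom_mean f r q)"
    by (rule uniform_limit_theorem[rotated])
       (auto intro!: always_eventually continuous_intros continuous_on_binom_mean)
  then show ?thesis
    by (rule continuous_on_eq) (use expectation_thinning in simp)
qed

text \<open>Terms beyond \<open>K\<close> are bounded by the corresponding terms of the mean, so the
  cost of truncation is uniform in \<open>q\<close>.\<close>

lemma truncated_expectation_thinning:
  assumes "q \<in> {0..1}"
  shows "(\<Sum>r\<le>K. pmf p r * binom_mean f r q) \<le> measure_pmf.expectation (thinning p q) f"
    "measure_pmf.expectation (thinning p q) f
      \<le> (\<Sum>r\<le>K. pmf p r * binom_mean f r q) + ((\<Sum>r. real r * pmf p r) - (\<Sum>r\<le>K. real r * pmf p r))"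
proof -
  have split: "(\<Sum>r. a r) = (\<Sum>r. a (r + Suc K)) + (\<Sum>r\<le>K. a r)" if "summable a" for a :: "nat \<Rightarrow> real"
    using suminf_split_initial_segment[OF that, of "Suc K"] by (simp add: lessThan_Suc_atMost)
  let ?a = "\<lambda>r. pmf p r * binom_mean f r q"
  note s = summable_binom_mean[OF assms]
  have nn: "0 \<le> ?a r" for r using binom_mean_bounds[of q f r] assms f by simp
  have E: "measure_pmf.expectation (thinning p q) f = (\<Sum>r. ?a (r + Suc K)) + (\<Sum>r\<le>K. ?a r)"
    using expectation_thinning[OF assms] split[OF s] by simp
  show "(\<Sum>r\<le>K. ?a r) \<le> measure_pmf.expectation (thinning p q) f"
    using E suminf_nonneg[OF summable_ignore_initial_segment[OF s, of "Suc K"]] nn by simp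
  have "(\<Sum>r. ?a (r + Suc K)) \<le> (\<Sum>r. real (r + Suc K) * pmf p (r + Suc K))"
    using binom_mean_summand_le[OF assms] nn s mean
    by (intro suminf_le summable_ignore_initial_segment[where f = ?a]
        summable_ignore_initial_segment[where f = "\<lambda>r. real r * pmf p r"])
      (smt (verit) real_norm_def)
  then show "measure_pmf.expectation (thinning p q) f
      \<le> (\<Sum>r\<le>K. ?a r) + ((\<Sum>r. real r * pmf p r) - (\<Sum>r\<le>K. real r * pmf p r))"
    using E split[OF mean] by linarith
qed

end

section \<open>Newton expansion and the limit of the conditional means\<close>

lemma newton_expansion:
  fixes f :: "nat \<Rightarrow> real"
  shows "\<exists>a. \<forall>d\<le>n. f d = (\<Sum>c\<le>d. a c * real (d choose c))"
proof (induction n)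
  case 0
  show ?case by (intro exI[of _ f]) simp
next
  case (Suc n)
  then obtain a where a: "\<forall>d\<le>n. f d = (\<Sum>c\<le>d. a c * real (d choose c))" by blast
  define b where "b = a(Suc n := f (Suc n) - (\<Sum>c\<le>n. a c * real (Suc n choose c)))"
  have "f d = (\<Sum>c\<le>d. b c * real (d choose c))" if "d \<le> Suc n" for d
  proof (cases "d = Suc n")
    case True
    have "(\<Sum>c\<le>n. b c * real (Suc n choose c)) = (\<Sum>c\<le>n. a c * real (Suc n choose c))"
      by (intro sum.cong) (auto simp: b_def)
    then show ?thesis by (simp add: True) (simp add: b_def)
  next
    case False
    then have "(\<Sum>c\<le>d. b c * real (d choose c)) = (\<Sum>c\<le>d. a c * real (d choose c))"
      using that by (intro sum.cong) (auto simp: b_def)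
    then show ?thesis using a False that by simp
  qed
  then show ?case by blast
qed

text \<open>Makes \<open>d choose c\<close> an eigenfunction of one step of \<open>mean_deg\<close>:
  a step multiplies it by \<open>1 - c / (s + 2 * i + 1)\<close>.\<close>

lemma times_binomial_pred:
  "real d * real ((d - 1) choose c) = (real d - real c) * real (d choose c)"
proof (cases "c \<le> d")
  case True
  show ?thesis
  proof (cases d)
    case (Suc e)
    have "Suc e * (e choose c) = (Suc e - c) * (Suc e choose c)"
      using binomial_absorb_comp[of "Suc e" c] by simp
    then have "real (Suc e * (e choose c)) = real ((Suc e - c) * (Suc e choose c))" by simp
    then show ?thesis using Suc True by (simp only: of_nat_mult of_nat_diff diff_Suc_1)
  qed (use True in simp)
qed (simp add: binomial_eq_0)

text \<open>In the Newton basis the recursion for \<^const>\<open>mean_deg\<close> is diagonal.\<close>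

lemma mean_deg_newton:
  assumes "\<And>d. d \<le> n \<Longrightarrow> f d = (\<Sum>c\<le>d. a c * real (d choose c))" "d \<le> n"
  shows "mean_deg f s i d
    = (\<Sum>c\<le>d. a c * real (d choose c) * (\<Prod>j<i. 1 - real c / real (s + 2 * j + 1)))"
  using assms(2)
proof (induction i arbitrary: d)
  case 0
  then show ?case by (simp add: assms(1))
next
  case (Suc i)
  let ?P = "\<lambda>c. \<Prod>j<i. 1 - real c / real (s + 2 * j + 1)"
  let ?M = "real (s + 2 * i + 1)"
  have sub: "mean_deg f s i (d - 1) = (\<Sum>c\<le>d. a c * real ((d - 1) choose c) * ?P c)"
  proof -
    have "mean_deg f s i (d - 1) = (\<Sum>c\<le>d - 1. a c * real ((d - 1) choose c) * ?P c)"
      using Suc by simp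
    also have "\<dots> = (\<Sum>c\<le>d. a c * real ((d - 1) choose c) * ?P c)"
      by (intro sum.mono_neutral_left) (auto simp: binomial_eq_0)
    finally show ?thesis .
  qed
  have "mean_deg f s (Suc i) d = (\<Sum>c\<le>d. a c * real (d choose c) * ?P c
      - real d / ?M * (a c * real (d choose c) * ?P c - a c * real ((d - 1) choose c) * ?P c))"
    unfolding mean_deg.simps sub Suc.IH[OF Suc.prems]
    unfolding sum_subtractf sum_distrib_left[symmetric] by (rule refl)
  also have "\<dots> = (\<Sum>c\<le>d. a c * real (d choose c) * (?P c * (1 - real c / ?M)))"
  proof (intro sum.cong refl)
    fix c
    have "a c * real (d choose c) * ?P c
      - real d / ?M * (a c * real (d choose c) * ?P c - a c * real ((d - 1) choose c) * ?P c)
      = a c * ?P c * (real (d choose c)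
         - (real d * real (d choose c) - real d * real ((d - 1) choose c)) / ?M)"
      by (simp add: field_simps)
    also have "\<dots> = a c * real (d choose c) * (?P c * (1 - real c / ?M))"
      unfolding times_binomial_pred by (simp add: field_simps)
    finally show "a c * real (d choose c) * ?P c
      - real d / ?M * (a c * real (d choose c) * ?P c - a c * real ((d - 1) choose c) * ?P c)
      = a c * real (d choose c) * (?P c * (1 - real c / ?M))" .
  qed
  finally show ?case by simp
qed

text \<open>Binomial factorial moments: the mean of \<open>j choose c\<close> is
  \<open>(d choose c) * q ^ c\<close>. Against \<open>mean_deg_newton\<close>, only the limit of the
  products remains to be found.\<close>

lemma binom_mean_newton:
  assumes "\<And>j. j \<le> d \<Longrightarrow> f j = (\<Sum>c\<le>j. a c * real (j choose c))"
  shows "binom_mean f d q = (\<Sum>c\<le>d. a c * real (d choose c) * q ^ c)"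
proof -
  let ?w = "\<lambda>j. real (d choose j) * q ^ j * (1 - q) ^ (d - j)"
  have "binom_mean f d q = (\<Sum>j\<le>d. \<Sum>c\<le>d. a c * real (j choose c) * ?w j)"
    unfolding binom_mean_def
  proof (intro sum.cong refl)
    fix j assume j: "j \<in> {..d}"
    then have "f j = (\<Sum>c\<le>d. a c * real (j choose c))"
      unfolding assms[of j, OF j[unfolded atMost_iff]]
      by (intro sum.mono_neutral_left) (auto simp: binomial_eq_0)
    then show "f j * ?w j = (\<Sum>c\<le>d. a c * real (j choose c) * ?w j)"
      by (simp add: sum_distrib_right)
  qed
  also have "\<dots> = (\<Sum>c\<le>d. \<Sum>j\<le>d. a c * real (j choose c) * ?w j)" by (rule sum.swap)
  also have "\<dots> = (\<Sum>c\<le>d. a c * real (d choose c) * q ^ c)"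
  proof (intro sum.cong refl)
    fix c assume c: "c \<in> {..d}"
    have "(\<Sum>j\<le>d. a c * real (j choose c) * ?w j) = (\<Sum>j\<in>{c..d}. a c * real (j choose c) * ?w j)"
      by (intro sum.mono_neutral_right) (auto simp: binomial_eq_0)
    also have "\<dots> = (\<Sum>j\<in>{c..d}. a c * real (d choose c) * q ^ c
        * (real ((d - c) choose (j - c)) * q ^ (j - c) * (1 - q) ^ (d - c - (j - c))))"
    proof (intro sum.cong refl)
      fix j assume j: "j \<in> {c..d}"
      then have "(d choose j) * (j choose c) = (d choose c) * ((d - c) choose (j - c))"
        by (intro choose_mult) auto
      then have "real (d choose j) * real (j choose c) = real (d choose c) * real ((d - c) choose (j - c))"
        by (metis of_nat_mult)
      moreover have "q ^ j = q ^ c * q ^ (j - c)" using j by (simp flip: power_add)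
      moreover have "d - c - (j - c) = d - j" using j by simp
      ultimately show "a c * real (j choose c) * ?w j = a c * real (d choose c) * q ^ c
        * (real ((d - c) choose (j - c)) * q ^ (j - c) * (1 - q) ^ (d - c - (j - c)))"
        by (simp add: algebra_simps)
    qed
    also have "\<dots> = a c * real (d choose c) * q ^ c
        * (\<Sum>j\<in>{c..d}. real ((d - c) choose (j - c)) * q ^ (j - c) * (1 - q) ^ (d - c - (j - c)))"
      by (simp only: sum_distrib_left)
    also have "(\<Sum>j\<in>{c..d}. real ((d - c) choose (j - c)) * q ^ (j - c) * (1 - q) ^ (d - c - (j - c)))
        = (\<Sum>j\<le>d - c. real ((d - c) choose j) * q ^ j * (1 - q) ^ (d - c - j))"
      by (rule sum.reindex_bij_witness[of _ "\<lambda>j. j + c" "\<lambda>j. j - c"]) (use c in auto)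
    also have "\<dots> = 1" by (rule sum_binomial_weights)
    finally show "(\<Sum>j\<le>d. a c * real (j choose c) * ?w j) = a c * real (d choose c) * q ^ c" by simp
  qed
  finally show ?thesis .
qed

text \<open>An error of second order allows the factors for general \<open>c\<close> to be replaced
  by \<open>c\<close>-th powers of the factors for \<open>c = 1\<close>.\<close>

lemma power_one_minus_bounds:
  fixes t :: real
  assumes "0 \<le> t" "t \<le> 1"
  shows "\<bar>(1 - real c * t) - (1 - t) ^ c\<bar> \<le> (real c)\<^sup>2 * t\<^sup>2"
proof -
  have "1 - real c * t \<le> (1 - t) ^ c"
    using Bernoulli_inequality[of "- t" c] assms by simp
  moreover have "(1 - t) ^ c \<le> 1 - real c * t + (real c)\<^sup>2 * t\<^sup>2"
  proof (induction c)
    case (Suc c)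
    have "(1 - t) ^ Suc c \<le> (1 - t) * (1 - real c * t + (real c)\<^sup>2 * t\<^sup>2)"
      using Suc assms by (simp add: mult_left_mono)
    also have "\<dots> = 1 - real (Suc c) * t + (real c + (real c)\<^sup>2) * t\<^sup>2 - (real c)\<^sup>2 * (t * t\<^sup>2)"
      by (simp add: algebra_simps power2_eq_square)
    also have "\<dots> \<le> 1 - real (Suc c) * t + (real c + (real c)\<^sup>2) * t\<^sup>2"
      using assms by simp
    also have "\<dots> \<le> 1 - real (Suc c) * t + (real (Suc c))\<^sup>2 * t\<^sup>2"
      by (intro add_left_mono mult_right_mono) (auto simp: power2_eq_square algebra_simps)
    finally show ?case .
  qed simp
  ultimately show ?thesis by linarith
qed

text \<open>A Wallis type estimate. With \<open>M = s + 2 * j + 1\<close>, the square of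
  \<open>(M - 1) / M\<close> lies between \<open>(M - 2) / M\<close> and
  \<open>(M - 1) / (M + 1)\<close>, and the products of both bounds telescope.\<close>

lemma square_prod_bounds:
  fixes s i :: nat
  assumes "s \<ge> 2"
  defines "P \<equiv> \<Prod>j<i. 1 - 1 / real (s + 2 * j + 1)"
  shows "(real s - 1) / (real (s + 2 * i) - 1) \<le> P\<^sup>2" "P\<^sup>2 \<le> real s / real (s + 2 * i)"
proof -
  have "(real s - 1) / (real (s + 2 * i) - 1) \<le> P\<^sup>2 \<and> P\<^sup>2 \<le> real s / real (s + 2 * i)"
    unfolding P_def
  proof (induction i)
    case 0
    then show ?case using assms by simp
  next
    case (Suc i)
    let ?P = "\<Prod>j<i. 1 - 1 / real (s + 2 * j + 1)"
    define M where "M = real (s + 2 * i + 1)"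
    have M: "M \<ge> 3" using assms by (simp add: M_def)
    have eq: "(\<Prod>j<Suc i. 1 - 1 / real (s + 2 * j + 1))\<^sup>2 = ?P\<^sup>2 * ((M - 1) / M)\<^sup>2"
      using M unfolding prod.lessThan_Suc power_mult_distrib M_def[symmetric]
      by (simp add: diff_divide_distrib)
    have IH: "(real s - 1) / (M - 2) \<le> ?P\<^sup>2" "?P\<^sup>2 \<le> real s / (M - 1)"
      using Suc by (simp_all add: M_def)
    have "(M - 2) / M \<le> ((M - 1) / M)\<^sup>2"
      using M by (simp add: power2_eq_square field_simps)
    then have "(real s - 1) / (M - 2) * ((M - 2) / M) \<le> ?P\<^sup>2 * ((M - 1) / M)\<^sup>2"
      using IH(1) M assms by (intro mult_mono) auto
    moreover have "((M - 1) / M)\<^sup>2 \<le> (M - 1) / (M + 1)"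
    proof -
      have "(M - 1) * (M + 1) \<le> M * M" by (simp add: algebra_simps)
      then have "(M - 1) * ((M - 1) * (M + 1)) \<le> (M - 1) * (M * M)" using M by (intro mult_left_mono) auto
      then show ?thesis using M by (simp add: power2_eq_square divide_simps mult.assoc)
    qed
    then have "?P\<^sup>2 * ((M - 1) / M)\<^sup>2 \<le> real s / (M - 1) * ((M - 1) / (M + 1))"
      using IH(2) M by (intro mult_mono) auto
    moreover have "real s / (M - 1) * ((M - 1) / (M + 1)) = real s / real (s + 2 * Suc i)"
      "(real s - 1) / (M - 2) * ((M - 2) / M) = (real s - 1) / (real (s + 2 * Suc i) - 1)"
      using M by (simp_all add: M_def)
    ultimately show ?case unfolding eq by simp
  qed
  then show "(real s - 1) / (real (s + 2 * i) - 1) \<le> P\<^sup>2" "P\<^sup>2 \<le> real s / real (s + 2 * i)"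
    by auto
qed

text \<open>For \<open>c = 1\<close> the square of the product is squeezed. In general the product
  differs from the \<open>c\<close>-th power of that one by at most \<open>i * c^2 / s^2\<close>,
  which vanishes because \<open>s\<close> and \<open>s + 2 * i\<close> have the same order.\<close>

lemma prod_limit:
  fixes s i :: "nat \<Rightarrow> nat"
  assumes N: "filterlim (\<lambda>n. real (s n + 2 * i n)) at_top sequentially"
    and u: "(\<lambda>n. real (s n) / real (s n + 2 * i n)) \<longlonglongrightarrow> u" "u > 0"
  shows "(\<lambda>n. \<Prod>j<i n. 1 - real c / real (s n + 2 * j + 1)) \<longlonglongrightarrow> sqrt u ^ c"
proof -
  let ?N = "\<lambda>n. real (s n + 2 * i n)"
  let ?P = "\<lambda>c n. \<Prod>j<i n. 1 - real c / real (s n + 2 * j + 1)"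
  have Npos: "eventually (\<lambda>n. ?N n > 1) sequentially"
    using N by (auto simp: filterlim_at_top_dense)
  have "filterlim (\<lambda>n. real (s n) / ?N n * ?N n) at_top sequentially"
    by (rule filterlim_tendsto_pos_mult_at_top[OF u N])
  moreover have "eventually (\<lambda>n. real (s n) / ?N n * ?N n = real (s n)) sequentially"
    using Npos by eventually_elim auto
  ultimately have s: "filterlim (\<lambda>n. real (s n)) at_top sequentially"
    using filterlim_cong by force
  have sc: "eventually (\<lambda>n. s n \<ge> b) sequentially" for b
    using s unfolding filterlim_at_top by (auto elim!: allE[of _ "real b"])
  have inv: "(\<lambda>n. 1 / ?N n) \<longlonglongrightarrow> 0"
    using N by (intro tendsto_divide_0[OF tendsto_const] filterlim_at_top_imp_at_infinity) auto
  have P1: "(\<lambda>n. (?P 1 n)\<^sup>2) \<longlonglongrightarrow> u"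
  proof (rule tendsto_sandwich)
    have "(\<lambda>n. (real (s n) / ?N n - 1 / ?N n) / (1 - 1 / ?N n)) \<longlonglongrightarrow> (u - 0) / (1 - 0)"
      by (intro tendsto_intros u inv) auto
    moreover have "eventually (\<lambda>n. (real (s n) / ?N n - 1 / ?N n) / (1 - 1 / ?N n)
        = (real (s n) - 1) / (?N n - 1)) sequentially"
      using Npos by eventually_elim (auto simp: divide_simps)
    ultimately show "(\<lambda>n. (real (s n) - 1) / (?N n - 1)) \<longlonglongrightarrow> u"
      by (simp add: tendsto_cong)
    show "eventually (\<lambda>n. (real (s n) - 1) / (?N n - 1) \<le> (?P 1 n)\<^sup>2) sequentially"
      using sc[of 2] by eventually_elim (use square_prod_bounds in simp)
    show "eventually (\<lambda>n. (?P 1 n)\<^sup>2 \<le> real (s n) / ?N n) sequentially"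
      using sc[of 2] by eventually_elim (use square_prod_bounds in simp)
  qed (rule u)
  have "0 \<le> ?P 1 n" for n by (intro prod_nonneg) auto
  then have "sqrt ((?P 1 n)\<^sup>2) = ?P 1 n" for n by (metis real_sqrt_abs abs_of_nonneg)
  then have "(\<lambda>n. ?P 1 n) \<longlonglongrightarrow> sqrt u"
    using tendsto_real_sqrt[OF P1] by simp
  then have P1c: "(\<lambda>n. ?P 1 n ^ c) \<longlonglongrightarrow> sqrt u ^ c" by (rule tendsto_power)
  have "(\<lambda>n. ?P c n - ?P 1 n ^ c) \<longlonglongrightarrow> 0"
  proof (rule Lim_null_comparison)
    have "(\<lambda>n. (real c)\<^sup>2 * (1 / ?N n) / (real (s n) / ?N n)\<^sup>2) \<longlonglongrightarrow> (real c)\<^sup>2 * 0 / u\<^sup>2"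
      using u(2) by (intro tendsto_intros u inv) auto
    then show "(\<lambda>n. (real c)\<^sup>2 * (1 / ?N n) / (real (s n) / ?N n)\<^sup>2) \<longlonglongrightarrow> 0" by simp
    show "eventually (\<lambda>n. norm (?P c n - ?P 1 n ^ c)
        \<le> (real c)\<^sup>2 * (1 / ?N n) / (real (s n) / ?N n)\<^sup>2) sequentially"
      using sc[of "c + 1"] Npos
    proof eventually_elim
      case (elim n)
      have spos: "real (s n) > 0" using elim by simp
      have "norm (?P c n - ?P 1 n ^ c)
          = norm ((\<Prod>j<i n. 1 - real c / real (s n + 2 * j + 1)) - (\<Prod>j<i n. (1 - 1 / real (s n + 2 * j + 1)) ^ c))"
        by (simp add: prod_power_distrib)
      also have "\<dots> \<le> (\<Sum>j<i n. norm ((1 - real c / real (s n + 2 * j + 1)) - (1 - 1 / real (s n + 2 * j + 1)) ^ c))"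
      proof (intro norm_prod_diff)
        fix j
        show "norm (1 - real c / real (s n + 2 * j + 1)) \<le> 1"
          using elim by (simp add: abs_if field_simps)
        show "norm ((1 - 1 / real (s n + 2 * j + 1)) ^ c) \<le> 1"
          by (simp add: norm_power power_le_one_iff)
      qed
      also have "\<dots> \<le> (\<Sum>j<i n. (real c)\<^sup>2 * (1 / real (s n))\<^sup>2)"
      proof (intro sum_mono)
        fix j
        have "norm ((1 - real c / real (s n + 2 * j + 1)) - (1 - 1 / real (s n + 2 * j + 1)) ^ c)
            \<le> (real c)\<^sup>2 * (1 / real (s n + 2 * j + 1))\<^sup>2"
          using power_one_minus_bounds[of "1 / real (s n + 2 * j + 1)" c] by simp
        also have "\<dots> \<le> (real c)\<^sup>2 * (1 / real (s n))\<^sup>2"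
          using spos by (intro mult_left_mono power_mono divide_left_mono) auto
        finally show "norm ((1 - real c / real (s n + 2 * j + 1)) - (1 - 1 / real (s n + 2 * j + 1)) ^ c)
            \<le> (real c)\<^sup>2 * (1 / real (s n))\<^sup>2" .
      qed
      also have "\<dots> = (real c)\<^sup>2 * (1 / real (s n))\<^sup>2 * real (i n)" by simp
      also have "\<dots> \<le> (real c)\<^sup>2 * (1 / real (s n))\<^sup>2 * ?N n" by (intro mult_left_mono) auto
      also have "\<dots> = (real c)\<^sup>2 * (1 / ?N n) / (real (s n) / ?N n)\<^sup>2"
      proof -
        have "c2 * (1 / S)\<^sup>2 * T = c2 * (1 / T) / (S / T)\<^sup>2" if "S > 0" "T > 0" for c2 S T :: real
          using that by (simp add: power2_eq_square field_simps)
        then show ?thesis using elim spos by simp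
      qed
      finally show ?case .
    qed
  qed
  then have "(\<lambda>n. (?P c n - ?P 1 n ^ c) + ?P 1 n ^ c) \<longlonglongrightarrow> 0 + sqrt u ^ c"
    by (intro tendsto_add P1c)
  then show ?thesis by simp
qed

lemma mean_deg_limit:
  fixes s i :: "nat \<Rightarrow> nat"
  assumes "filterlim (\<lambda>n. real (s n + 2 * i n)) at_top sequentially"
    and "(\<lambda>n. real (s n) / real (s n + 2 * i n)) \<longlonglongrightarrow> u" "u > 0"
  shows "(\<lambda>n. mean_deg f (s n) (i n) d) \<longlonglongrightarrow> binom_mean f d (sqrt u)"
proof -
  obtain a where a: "\<And>e. e \<le> d \<Longrightarrow> f e = (\<Sum>c\<le>e. a c * real (e choose c))"
    using newton_expansion[of d f] by blast
  have "(\<lambda>n. \<Sum>c\<le>d. a c * real (d choose c) * (\<Prod>j<i n. 1 - real c / real (s n + 2 * j + 1)))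
      \<longlonglongrightarrow> (\<Sum>c\<le>d. a c * real (d choose c) * sqrt u ^ c)"
    by (intro tendsto_sum tendsto_mult tendsto_const prod_limit assms)
  then show ?thesis
    by (simp only: mean_deg_newton[OF a order_refl] binom_mean_newton[OF a])
qed

section \<open>Events of vanishing probability\<close>

definition vanishing :: "(nat \<Rightarrow> 'a pmf) \<Rightarrow> (nat \<Rightarrow> 'a \<Rightarrow> bool) \<Rightarrow> bool" where
  "vanishing P E \<longleftrightarrow> (\<lambda>n. measure_pmf.prob (P n) {x. E n x}) \<longlonglongrightarrow> 0"

lemma pmf_prob_mono:
  assumes "\<And>x. x \<in> set_pmf q \<Longrightarrow> x \<in> A \<Longrightarrow> x \<in> B"
  shows "measure_pmf.prob q A \<le> measure_pmf.prob q B"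
proof -
  have "measure_pmf.prob q A = measure_pmf.prob q (A \<inter> set_pmf q)" by (simp add: measure_Int_set_pmf)
  also have "\<dots> \<le> measure_pmf.prob q B" using assms by (intro measure_pmf.finite_measure_mono) auto
  finally show ?thesis .
qed

text \<open>The inclusion is asked for on the support only, which in the applications consists of
  genuine perfect matchings.\<close>

lemma vanishing_mono:
  assumes "vanishing P F" "eventually (\<lambda>n. \<forall>x\<in>set_pmf (P n). E n x \<longrightarrow> F n x) sequentially"
  shows "vanishing P E"
  unfolding vanishing_def
proof (rule tendsto_sandwich[where f = "\<lambda>_. 0" and h = "\<lambda>n. measure_pmf.prob (P n) {x. F n x}"])
  show "eventually (\<lambda>n. measure_pmf.prob (P n) {x. E n x} \<le> measure_pmf.prob (P n) {x. F n x}) sequentially"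
    using assms(2) by eventually_elim (auto intro: pmf_prob_mono)
qed (use assms(1) in \<open>auto simp: vanishing_def\<close>)

lemma vanishing_disj:
  assumes "vanishing P E" "vanishing P F"
  shows "vanishing P (\<lambda>n x. E n x \<or> F n x)"
  unfolding vanishing_def
proof (rule tendsto_sandwich[where f = "\<lambda>_. 0"])
  show "(\<lambda>n. measure_pmf.prob (P n) {x. E n x} + measure_pmf.prob (P n) {x. F n x}) \<longlonglongrightarrow> 0"
    using tendsto_add[OF assms[unfolded vanishing_def]] by simp
  show "eventually (\<lambda>n. measure_pmf.prob (P n) {x. E n x \<or> F n x}
      \<le> measure_pmf.prob (P n) {x. E n x} + measure_pmf.prob (P n) {x. F n x}) sequentially"
    by (intro always_eventually allI) (simp add: Collect_disj_eq measure_Un_le)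
qed auto

lemma vanishing_impossible:
  assumes "eventually (\<lambda>n. \<forall>x\<in>set_pmf (P n). \<not> E n x) sequentially"
  shows "vanishing P E"
proof (rule vanishing_mono)
  show "vanishing P (\<lambda>_ _. False)" by (simp add: vanishing_def)
qed (use assms in auto)

lemma vanishing_if_bounded:
  assumes "eventually (\<lambda>n. measure_pmf.prob (P n) {x. E n x} \<le> b n) sequentially" "b \<longlonglongrightarrow> 0"
  shows "vanishing P E"
  unfolding vanishing_def by (rule tendsto_sandwich[OF _ assms(1) _ assms(2)]) auto

section \<open>The size of the core\<close>

lemma card_eq_sum_hdeg:
  assumes "finite V" "fst ` R \<subseteq> V" "finite R"
  shows "card R = (\<Sum>v\<in>V. hdeg R v)"
  using sum.group[OF assms(3,1,2), of "\<lambda>_. 1::nat"] by (simp add: hdeg_def)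

lemma sum_hdeg_le_card:
  assumes "finite V" "finite R"
  shows "(\<Sum>v\<in>V. hdeg R v) \<le> card R"
proof -
  have "(\<Sum>v\<in>V. hdeg R v) \<le> (\<Sum>v\<in>V \<union> fst ` R. hdeg R v)" using assms by (intro sum_mono2) auto
  also have "\<dots> = card R" using assms by (intro card_eq_sum_hdeg[symmetric]) auto
  finally show ?thesis .
qed

lemma hdeg_half_edges: "v \<in> {1..n} \<Longrightarrow> hdeg (half_edges n d) v = d v"
proof -
  assume "v \<in> {1..n}"
  then have "{x\<in>half_edges n d. fst x = v} = {v} \<times> {..<d v}" by (auto simp: half_edges_def)
  then show ?thesis by (simp add: hdeg_def card_cartesian_product)
qed

lemma fst_half_edges: "fst ` half_edges n d \<subseteq> {1..n}"
  by (auto simp: half_edges_def)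

lemma sum_by_degree:
  fixes \<phi> :: "nat \<Rightarrow> real" and d :: "nat \<Rightarrow> nat"
  shows "(\<Sum>v\<in>{v\<in>{1..n::nat}. d v \<le> K}. \<phi> (d v)) = (\<Sum>r\<le>K. real (card {i\<in>{1..n}. d i = r}) * \<phi> r)"
proof -
  let ?V = "{v\<in>{1..n}. d v \<le> K}"
  have fin: "finite ?V" by (rule finite_subset[of _ "{1..n}"]) auto
  have "(\<Sum>v\<in>?V. \<phi> (d v)) = (\<Sum>r\<le>K. \<Sum>v\<in>{v\<in>?V. d v = r}. \<phi> (d v))"
    by (rule sum.group[OF fin, symmetric]) auto
  also have "\<dots> = (\<Sum>r\<le>K. real (card {i\<in>{1..n}. d i = r}) * \<phi> r)"
  proof (intro sum.cong refl)
    fix r assume "r \<in> {..K}"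
    then have "{v\<in>?V. d v = r} = {i\<in>{1..n}. d i = r}" by auto
    then show "(\<Sum>v\<in>{v\<in>?V. d v = r}. \<phi> (d v)) = real (card {i\<in>{1..n}. d i = r}) * \<phi> r" by simp
  qed
  finally show ?thesis .
qed

text \<open>\<open>heavy_deg\<close> and \<open>heavy_ind\<close> are the test functions with
  thinned means \<open>core_h\<close> and \<open>core_h1\<close>. Both vanish below \<open>k\<close>
  and have bounded increments, as the martingale argument demands.\<close>

definition heavy_deg :: "nat \<Rightarrow> nat \<Rightarrow> real" where
  "heavy_deg k w = real w * indicator {k..} w"

definition heavy_ind :: "nat \<Rightarrow> nat \<Rightarrow> real" where
  "heavy_ind k w = indicator {k..} w"

lemma heavy_deg_simps: "heavy_deg k w = (if k \<le> w then real w else 0)"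
  by (simp add: heavy_deg_def)

lemma heavy_ind_simps: "heavy_ind k w = (if k \<le> w then 1 else 0)"
  by (simp add: heavy_ind_def)

locale degree_sequence =
  fixes k :: nat and d :: "nat \<Rightarrow> nat \<Rightarrow> nat" and p :: "nat pmf" and lam :: real
  assumes k: "k \<ge> 2"
    and even_total: "\<And>n. even (\<Sum>i=1..n. d n i)"
    and degree_conv: "\<And>r. (\<lambda>n. real (card {i\<in>{1..n}. d n i = r}) / real n) \<longlonglongrightarrow> pmf p r"
    and mean_sums: "(\<lambda>r. real r * pmf p r) sums lam" and lam_pos: "0 < lam"
    and total_conv: "(\<lambda>n. real (\<Sum>i=1..n. d n i) / real n) \<longlonglongrightarrow> lam"
begin

abbreviation H :: "nat \<Rightarrow> (nat \<times> nat) set" where "H n \<equiv> half_edges n (d n)"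
abbreviation N :: "nat \<Rightarrow> nat" where "N n \<equiv> card (H n)"
abbreviation P :: "nat \<Rightarrow> (nat \<times> nat) set set pmf" where "P n \<equiv> unif_matching (H n)"
abbreviation C :: "nat \<Rightarrow> (nat \<times> nat) set set \<Rightarrow> (nat \<times> nat) set" where
  "C n M \<equiv> core_set k (H n) M"

lemma even_N: "even (N n)"
  using even_total[of n] by (simp add: card_half_edges)

lemma set_P: "set_pmf (P n) = perfect_matchings (H n)"
  by (rule set_unif_matching[OF finite_half_edges even_N])

lemma N_conv: "(\<lambda>n. real (N n) / real n) \<longlonglongrightarrow> lam"
  using total_conv by (simp only: card_half_edges)

lemma N_at_top: "filterlim (\<lambda>n. real (N n)) at_top sequentially"
proof -
  have "filterlim (\<lambda>n. real (N n) / real n * real n) at_top sequentially"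
    by (rule filterlim_tendsto_pos_mult_at_top[OF N_conv lam_pos filterlim_real_sequentially])
  moreover have "eventually (\<lambda>n. real (N n) / real n * real n = real (N n)) sequentially"
    using eventually_gt_at_top[of 0] by eventually_elim simp
  ultimately show ?thesis using filterlim_cong by force
qed

lemma card_C_le: "M \<in> set_pmf (P n) \<Longrightarrow> card (C n M) \<le> N n"
  by (intro card_mono finite_half_edges) (simp add: core_set_def peel_subset)

lemma mean_summable: "summable (\<lambda>r. real r * pmf p r)"
  using mean_sums by (simp add: sums_iff)

lemma core_h_eq: "core_h k p q = measure_pmf.expectation (thinning p q) (heavy_deg k)"
  unfolding core_h_def heavy_deg_def by (rule refl)

lemma core_h1_eq: "core_h1 k p q = measure_pmf.expectation (thinning p q) (heavy_ind k)"
  unfolding core_h1_def heavy_ind_def by simp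

lemma heavy_deg_bounds: "0 \<le> heavy_deg k w" "heavy_deg k w \<le> real w"
  by (simp_all add: heavy_deg_simps)

lemma heavy_ind_bounds: "0 \<le> heavy_ind k w" "heavy_ind k w \<le> real w"
  using k by (simp_all add: heavy_ind_simps)

lemma continuous_core_h: "continuous_on {0..1} (core_h k p)"
  unfolding core_h_eq
  by (rule continuous_on_expectation_thinning[OF mean_summable heavy_deg_bounds])

lemma continuous_core_h1: "continuous_on {0..1} (core_h1 k p)"
  unfolding core_h1_eq
  by (rule continuous_on_expectation_thinning[OF mean_summable heavy_ind_bounds])

text \<open>The limiting density of half-edges at vertices of degree above \<open>K\<close>.\<close>

definition tail :: "nat \<Rightarrow> real" where
  "tail K = lam - (\<Sum>r\<le>K. real r * pmf p r)"

lemma tail_conv: "tail \<longlonglongrightarrow> 0"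
proof -
  have "(\<lambda>K. \<Sum>r\<le>K. real r * pmf p r) \<longlonglongrightarrow> lam"
    using mean_sums by (simp add: sums_def_le)
  then have "(\<lambda>K. lam - (\<Sum>r\<le>K. real r * pmf p r)) \<longlonglongrightarrow> lam - lam" by (intro tendsto_intros)
  then show ?thesis by (simp add: tail_def[abs_def])
qed

lemma small_tail:
  assumes "\<epsilon> > 0"
  obtains K where "tail K < \<epsilon>"
  using order_tendstoD(2)[OF tail_conv assms] by (auto dest: eventually_happens)

lemma truncated_core_h:
  assumes "q \<in> {0..1}"
  shows "(\<Sum>r\<le>K. pmf p r * binom_mean (heavy_deg k) r q) \<le> core_h k p q"
    "core_h k p q \<le> (\<Sum>r\<le>K. pmf p r * binom_mean (heavy_deg k) r q) + tail K"
  using truncated_expectation_thinning[OF mean_summable heavy_deg_bounds assms, of K] mean_sums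
  by (simp_all add: core_h_eq tail_def sums_iff)

lemma truncated_core_h1:
  assumes "q \<in> {0..1}"
  shows "(\<Sum>r\<le>K. pmf p r * binom_mean (heavy_ind k) r q) \<le> core_h1 k p q"
    "core_h1 k p q \<le> (\<Sum>r\<le>K. pmf p r * binom_mean (heavy_ind k) r q) + tail K"
  using truncated_expectation_thinning[OF mean_summable heavy_ind_bounds assms, of K] mean_sums
  by (simp_all add: core_h1_eq tail_def sums_iff)

text \<open>With finitely many degree classes pointwise convergence of the frequencies suffices, and
  \<open>K\<close> is eventually below \<open>S u n\<close>, as the increment bound
  requires.\<close>

definition V :: "nat \<Rightarrow> nat \<Rightarrow> nat set" where
  "V K n = {v\<in>{1..n}. d n v \<le> K}"

definition excess :: "nat \<Rightarrow> nat \<Rightarrow> real" where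
  "excess K n = (\<Sum>v\<in>{1..n} - V K n. real (d n v))"

lemma finite_V: "finite (V K n)"
  by (simp add: V_def)

lemma sum_V_conv:
  assumes "\<And>r. r \<le> K \<Longrightarrow> (\<lambda>n. \<phi> n r) \<longlonglongrightarrow> \<psi> r"
  shows "(\<lambda>n. (\<Sum>v\<in>V K n. \<phi> n (d n v)) / real n) \<longlonglongrightarrow> (\<Sum>r\<le>K. pmf p r * \<psi> r)"
proof -
  have "(\<Sum>v\<in>V K n. \<phi> n (d n v)) / real n
      = (\<Sum>r\<le>K. real (card {i\<in>{1..n}. d n i = r}) / real n * \<phi> n r)" for n
    unfolding V_def sum_by_degree sum_divide_distrib by (intro sum.cong) auto
  moreover have "(\<lambda>n. \<Sum>r\<le>K. real (card {i\<in>{1..n}. d n i = r}) / real n * \<phi> n r)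
      \<longlonglongrightarrow> (\<Sum>r\<le>K. pmf p r * \<psi> r)"
    by (intro tendsto_sum tendsto_mult degree_conv assms) auto
  ultimately show ?thesis by simp
qed

text \<open>Here the convergence of the total degree enters: no mass escapes to large degrees. The
  claim follows by subtracting the classes up to \<open>K\<close> from the total.\<close>

lemma excess_conv: "(\<lambda>n. excess K n / real n) \<longlonglongrightarrow> tail K"
proof -
  have "excess K n = real (N n) - (\<Sum>v\<in>V K n. real (d n v))" for n
    unfolding excess_def card_half_edges
    by (subst sum_diff) (auto simp: V_def)
  then have "excess K n / real n = real (N n) / real n - (\<Sum>v\<in>V K n. real (d n v)) / real n" for n
    by (simp add: diff_divide_distrib)
  moreover have "(\<lambda>n. real (N n) / real n - (\<Sum>v\<in>V K n. real (d n v)) / real n)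
      \<longlonglongrightarrow> lam - (\<Sum>r\<le>K. pmf p r * real r)"
    by (intro tendsto_diff N_conv sum_V_conv[where \<phi> = "\<lambda>_. real"]) auto
  ultimately show ?thesis by (simp add: tail_def mult.commute)
qed

text \<open>After \<open>J u n\<close> steps a proportion \<open>u\<close> of the half-edges is left, up to rounding.\<close>

definition J :: "real \<Rightarrow> nat \<Rightarrow> nat" where
  "J u n = nat \<lfloor>(1 - u) * real (N n) / 2\<rfloor>"

definition S :: "real \<Rightarrow> nat \<Rightarrow> nat" where
  "S u n = N n - 2 * J u n"

context
  fixes u :: real
  assumes u: "0 < u" "u \<le> 1"
begin

lemma J_bounds: "(1 - u) * real (N n) - 2 \<le> 2 * real (J u n)" "2 * real (J u n) \<le> (1 - u) * real (N n)"
proof -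
  have "0 \<le> (1 - u) * real (N n) / 2" using u by simp
  then have "real (J u n) = of_int \<lfloor>(1 - u) * real (N n) / 2\<rfloor>" by (simp add: J_def)
  then show "(1 - u) * real (N n) - 2 \<le> 2 * real (J u n)" "2 * real (J u n) \<le> (1 - u) * real (N n)"
    by linarith+
qed

lemma J_le: "2 * J u n \<le> N n"
proof -
  have "(1 - u) * real (N n) \<le> 1 * real (N n)" using u by (intro mult_right_mono) auto
  then have "real (2 * J u n) \<le> real (N n)" using J_bounds[of n] by simp
  then show ?thesis by linarith
qed

lemma S_eq: "S u n + 2 * J u n = N n"
  using J_le[of n] by (simp add: S_def)

lemma even_S: "even (S u n)"
  using even_N[of n] by (simp add: S_def)

lemma S_bounds: "u * real (N n) \<le> real (S u n)" "real (S u n) \<le> u * real (N n) + 2"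
  using J_bounds[of n] J_le[of n] by (simp_all add: S_def of_nat_diff algebra_simps)

lemma S_conv: "(\<lambda>n. real (S u n) / real (N n)) \<longlonglongrightarrow> u"
proof (rule tendsto_sandwich[where f = "\<lambda>_. u" and h = "\<lambda>n. u + 2 / real (N n)"])
  have inv: "(\<lambda>n. 2 / real (N n)) \<longlonglongrightarrow> 0"
    using N_at_top by (intro tendsto_divide_0[OF tendsto_const] filterlim_at_top_imp_at_infinity) auto
  then show "(\<lambda>n. u + 2 / real (N n)) \<longlonglongrightarrow> u"
    using tendsto_add[OF tendsto_const inv, of u] by simp
  have "eventually (\<lambda>n. real (N n) > 0) sequentially"
    using N_at_top unfolding filterlim_at_top_dense by blast
  then have "eventually (\<lambda>n. u \<le> real (S u n) / real (N n) \<and>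
      real (S u n) / real (N n) \<le> u + 2 / real (N n)) sequentially"
    by eventually_elim (use S_bounds in \<open>simp add: field_simps\<close>)
  then show "eventually (\<lambda>n. u \<le> real (S u n) / real (N n)) sequentially"
    "eventually (\<lambda>n. real (S u n) / real (N n) \<le> u + 2 / real (N n)) sequentially"
    by (simp_all add: eventually_conj_iff)
qed auto

lemma S_at_top: "filterlim (\<lambda>n. real (S u n)) at_top sequentially"
proof (rule filterlim_at_top_mono)
  show "filterlim (\<lambda>n. u * real (N n)) at_top sequentially"
    by (rule filterlim_tendsto_pos_mult_at_top[OF tendsto_const u(1) N_at_top])
qed (use S_bounds in auto)

lemma S_conv_n: "(\<lambda>n. real (S u n) / real n) \<longlonglongrightarrow> lam * u"
proof -
  have "(\<lambda>n. real (S u n) / real (N n) * (real (N n) / real n)) \<longlonglongrightarrow> u * lam"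
    by (intro tendsto_mult S_conv N_conv)
  moreover have "eventually (\<lambda>n. real (N n) > 0) sequentially"
    using N_at_top unfolding filterlim_at_top_dense by blast
  then have "eventually (\<lambda>n. real (S u n) / real (N n) * (real (N n) / real n) = real (S u n) / real n) sequentially"
    by eventually_elim simp
  ultimately show ?thesis by (simp add: tendsto_cong mult.commute)
qed

text \<open>The initial value of the martingale is deterministic and, divided by \<open>n\<close>,
  converges. The fluctuation around it has variance at most \<open>J u n * L^2\<close>, of order
  \<open>n\<close>, against the square of a deviation of order \<open>n\<close>. Each source gets
  half of \<open>\<epsilon>\<close>.\<close>

lemma final_sum_concentrated:
  assumes f0: "\<And>w. w < k \<Longrightarrow> f w = 0" and fL: "\<And>w. \<bar>f (Suc w) - f w\<bar> \<le> L" and e: "\<epsilon> > 0"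
  shows "vanishing P (\<lambda>n M. \<epsilon> * real n < \<bar>final_sum f (S u n) (V K n) (peel k (J u n) (H n) M)
      - real n * (\<Sum>r\<le>K. pmf p r * binom_mean f r (sqrt u))\<bar>)"
proof -
  let ?B = "\<Sum>r\<le>K. pmf p r * binom_mean f r (sqrt u)"
  let ?D = "\<lambda>n. degree_sum f (S u n) (V K n) (J u n) (H n)"
  let ?F = "\<lambda>n M. final_sum f (S u n) (V K n) (peel k (J u n) (H n) M)"
  have D: "?D n = (\<Sum>v\<in>V K n. mean_deg f (S u n) (J u n) (d n v))" for n
    unfolding degree_sum_def by (intro sum.cong refl) (simp add: V_def hdeg_half_edges)
  have "(\<lambda>n. mean_deg f (S u n) (J u n) r) \<longlonglongrightarrow> binom_mean f r (sqrt u)" for r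
    using N_at_top S_conv u by (intro mean_deg_limit) (simp_all only: S_eq)
  then have "(\<lambda>n. ?D n / real n) \<longlonglongrightarrow> ?B"
    unfolding D by (rule sum_V_conv)
  then have "eventually (\<lambda>n. dist (?D n / real n) ?B < \<epsilon> / 2) sequentially"
    using e by (intro tendstoD) auto
  moreover have "eventually (\<lambda>n. n > 0) sequentially" by (rule eventually_gt_at_top)
  ultimately have D_close: "eventually (\<lambda>n. \<bar>?D n - real n * ?B\<bar> \<le> \<epsilon> / 2 * real n) sequentially"
  proof eventually_elim
    case (elim n)
    have "\<bar>?D n - real n * ?B\<bar> = real n * \<bar>?D n / real n - ?B\<bar>"
      using elim by (subst abs_of_nat[of n, symmetric], subst abs_mult[symmetric])
        (simp add: right_diff_distrib)
    also have "\<dots> \<le> real n * (\<epsilon> / 2)" using elim by (intro mult_left_mono) (auto simp: dist_real_def)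
    finally show ?case by (simp add: mult.commute)
  qed
  have "eventually (\<lambda>n. real (S u n) \<ge> real K) sequentially"
    using S_at_top unfolding filterlim_at_top by blast
  then have bnd: "eventually (\<lambda>n. measure_pmf.prob (P n) {M. \<epsilon> / 2 * real n < \<bar>?F n M - ?D n\<bar>}
      \<le> real (J u n) * L\<^sup>2 / (\<epsilon> / 2 * real n)\<^sup>2) sequentially"
    using \<open>eventually (\<lambda>n. n > 0) sequentially\<close>
  proof eventually_elim
    case (elim n)
    show ?case
    proof (rule prob_final_sum_deviation[OF finite_half_edges finite_V _ even_S])
      show "N n = S u n + 2 * J u n" by (simp only: S_eq)
      fix v assume "v \<in> V K n"
      then show "hdeg (H n) v \<le> S u n + 1" using elim by (auto simp: V_def hdeg_half_edges)
    qed (use f0 fL e elim in auto)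
  qed
  have lim: "(\<lambda>n. real (J u n) * L\<^sup>2 / (\<epsilon> / 2 * real n)\<^sup>2) \<longlonglongrightarrow> 0"
  proof (rule tendsto_sandwich[where f = "\<lambda>_. 0"])
    have "(\<lambda>n. (4 * L\<^sup>2 / \<epsilon>\<^sup>2) * (real (N n) / real n) * inverse (real n)) \<longlonglongrightarrow> (4 * L\<^sup>2 / \<epsilon>\<^sup>2) * lam * 0"
      by (intro tendsto_mult tendsto_const N_conv LIMSEQ_inverse_real_of_nat[THEN LIMSEQ_imp_Suc])
    then show "(\<lambda>n. (4 * L\<^sup>2 / \<epsilon>\<^sup>2) * (real (N n) / real n) * inverse (real n)) \<longlonglongrightarrow> 0" by simp
    show "eventually (\<lambda>n. real (J u n) * L\<^sup>2 / (\<epsilon> / 2 * real n)\<^sup>2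
        \<le> (4 * L\<^sup>2 / \<epsilon>\<^sup>2) * (real (N n) / real n) * inverse (real n)) sequentially"
    proof (intro always_eventually allI)
      fix n
      have "real (J u n) * L\<^sup>2 / (\<epsilon> / 2 * real n)\<^sup>2 \<le> real (N n) * L\<^sup>2 / (\<epsilon> / 2 * real n)\<^sup>2"
        using J_le[of n] by (intro divide_right_mono mult_right_mono) auto
      also have "\<dots> = (4 * L\<^sup>2 / \<epsilon>\<^sup>2) * (real (N n) / real n) * inverse (real n)"
        by (simp add: power2_eq_square divide_simps)
      finally show "real (J u n) * L\<^sup>2 / (\<epsilon> / 2 * real n)\<^sup>2
        \<le> (4 * L\<^sup>2 / \<epsilon>\<^sup>2) * (real (N n) / real n) * inverse (real n)" .
    qed
  qed auto
  have "vanishing P (\<lambda>n M. \<epsilon> / 2 * real n < \<bar>?F n M - ?D n\<bar>)"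
    by (rule vanishing_if_bounded[OF bnd lim])
  then show ?thesis
  proof (rule vanishing_mono)
    show "eventually (\<lambda>n. \<forall>M\<in>set_pmf (P n). \<epsilon> * real n < \<bar>?F n M - real n * ?B\<bar>
        \<longrightarrow> \<epsilon> / 2 * real n < \<bar>?F n M - ?D n\<bar>) sequentially"
      using D_close by eventually_elim (auto simp: abs_if split: if_splits)
  qed
qed

lemma heavy_deg_concentrated:
  "\<epsilon> > 0 \<Longrightarrow> vanishing P (\<lambda>n M. \<epsilon> * real n <
      \<bar>final_sum (heavy_deg k) (S u n) (V K n) (peel k (J u n) (H n) M)
      - real n * (\<Sum>r\<le>K. pmf p r * binom_mean (heavy_deg k) r (sqrt u))\<bar>)"
  \<comment> \<open>The largest increment is the jump from 0 to \<open>k\<close> when the degree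
    reaches \<open>k\<close>.\<close>
  using k by (intro final_sum_concentrated[where L = "real k"]) (auto simp: heavy_deg_simps)

lemma heavy_ind_concentrated:
  "\<epsilon> > 0 \<Longrightarrow> vanishing P (\<lambda>n M. \<epsilon> * real n <
      \<bar>final_sum (heavy_ind k) (S u n) (V K n) (peel k (J u n) (H n) M)
      - real n * (\<Sum>r\<le>K. pmf p r * binom_mean (heavy_ind k) r (sqrt u))\<bar>)"
  by (intro final_sum_concentrated[where L = 1]) (auto simp: heavy_ind_simps)

lemma sqrt_u: "sqrt u \<in> {0..1}"
  using u by simp

context
  fixes n :: nat and M :: "(nat \<times> nat) set set"
  assumes M: "M \<in> set_pmf (P n)"
begin

abbreviation R :: "(nat \<times> nat) set" where "R \<equiv> peel k (J u n) (H n) M"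

lemma R_subset: "R \<subseteq> H n" "finite R" "C n M \<subseteq> R"
  using core_set_subset_peel[OF finite_half_edges M[unfolded set_P]]
  by (auto simp: peel_subset intro: finite_subset[OF peel_subset finite_half_edges])

text \<open>At the inspection time there are two cases. A core with at most \<open>S u n\<close>
  half-edges means that all \<open>J u n\<close> deletions took place; a larger one means that
  peeling has already stopped, as in \<open>R_eq_core_if_large_core\<close>.\<close>

lemma card_R_if_small_core:
  assumes "card (C n M) \<le> S u n"
  shows "card R = S u n"
  using card_peel_of_card_core_set[OF finite_half_edges M[unfolded set_P], of k "J u n"] assms S_eq[of n]
  by simp

lemma R_eq_core_if_large_core:
  assumes "card (C n M) > S u n"
  shows "R = C n M"
proof (rule peel_eq_core_set_of_card[OF finite_half_edges M[unfolded set_P]])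
  have "card (C n M) \<le> card R" using R_subset by (intro card_mono) auto
  then show "card R + 2 * J u n \<noteq> N n" using assms S_eq[of n] by simp
qed

lemma final_sum_R:
  assumes "card R = S u n"
  shows "final_sum f (S u n) (V K n) R = (\<Sum>v\<in>V K n. f (hdeg R v))"
  using assms by (simp add: final_sum_def degree_sum_def)

lemma hdeg_R_le: "v \<in> {1..n} \<Longrightarrow> hdeg R v \<le> d n v"
  using hdeg_mono[OF finite_half_edges R_subset(1), of v] by (simp add: hdeg_half_edges)

text \<open>A vertex of the core has degree at least \<open>k\<close> in the core, hence in
  \<open>R\<close>, so the core lies among the heavy half-edges of \<open>R\<close>. Vertices of
  degree above \<open>K\<close> are charged in full to \<open>excess\<close>.\<close>

lemma card_core_le:
  assumes "card R = S u n"
  shows "real (card (C n M)) \<le> final_sum (heavy_deg k) (S u n) (V K n) R + excess K n"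
proof -
  have CH: "C n M \<subseteq> H n" using R_subset by blast
  have light: "light k (C n M) = {}" by (rule light_core_set[OF finite_half_edges M[unfolded set_P]])
  have heavy: "hdeg (C n M) v = 0 \<or> k \<le> hdeg (C n M) v" for v
  proof (rule ccontr)
    assume h: "\<not> (hdeg (C n M) v = 0 \<or> k \<le> hdeg (C n M) v)"
    then have "v \<in> fst ` C n M" by (intro in_fst_image_if_hdeg[of 1]) auto
    then show False using light h by (auto simp: light_def)
  qed
  have "real (card (C n M)) = (\<Sum>v\<in>{1..n}. real (hdeg (C n M) v))"
    using card_eq_sum_hdeg[of "{1..n}" "C n M"] CH fst_half_edges[of n "d n"]
      finite_subset[OF CH finite_half_edges] by (simp add: image_mono subset_trans[OF image_mono])
  also have "\<dots> \<le> (\<Sum>v\<in>{1..n}. heavy_deg k (hdeg R v))"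
  proof (intro sum_mono)
    fix v
    have "hdeg (C n M) v \<le> hdeg R v" using R_subset by (intro hdeg_mono) auto
    then show "real (hdeg (C n M) v) \<le> heavy_deg k (hdeg R v)"
      using heavy[of v] by (auto simp: heavy_deg_simps)
  qed
  also have "\<dots> = (\<Sum>v\<in>V K n. heavy_deg k (hdeg R v)) + (\<Sum>v\<in>{1..n} - V K n. heavy_deg k (hdeg R v))"
    by (subst sum.subset_diff[of "V K n"]) (auto simp: V_def)
  also have "(\<Sum>v\<in>{1..n} - V K n. heavy_deg k (hdeg R v)) \<le> excess K n"
    unfolding excess_def
    by (intro sum_mono order.trans[OF heavy_deg_bounds(2)]) (use hdeg_R_le in auto)
  finally show ?thesis by (simp add: final_sum_R[OF assms])
qed

lemma card_core_verts_le:
  assumes "card R = S u n"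
  shows "real (card (fst ` C n M)) \<le> final_sum (heavy_ind k) (S u n) (V K n) R + excess K n"
proof -
  have "card (fst ` C n M) = card {v\<in>{1..n}. k \<le> hdeg (C n M) v}"
    using card_fst_core_set[OF M[unfolded set_P]] k by simp
  also have "real \<dots> = (\<Sum>v\<in>{1..n}. heavy_ind k (hdeg (C n M) v))"
    by (simp add: heavy_ind_simps sum.If_cases Int_def)
  also have "\<dots> \<le> (\<Sum>v\<in>{1..n}. heavy_ind k (hdeg R v))"
  proof (intro sum_mono)
    fix v
    have "hdeg (C n M) v \<le> hdeg R v" using R_subset by (intro hdeg_mono) auto
    then show "heavy_ind k (hdeg (C n M) v) \<le> heavy_ind k (hdeg R v)"
      by (auto simp: heavy_ind_simps)
  qed
  also have "\<dots> = (\<Sum>v\<in>V K n. heavy_ind k (hdeg R v)) + (\<Sum>v\<in>{1..n} - V K n. heavy_ind k (hdeg R v))"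
    by (subst sum.subset_diff[of "V K n"]) (auto simp: V_def)
  also have "(\<Sum>v\<in>{1..n} - V K n. heavy_ind k (hdeg R v)) \<le> excess K n"
    unfolding excess_def
    by (intro sum_mono order.trans[OF heavy_ind_bounds(2)]) (use hdeg_R_le in auto)
  finally show ?thesis by (simp add: final_sum_R[OF assms])
qed

text \<open>Here peeling stopped at an unknown earlier time, and \<open>final_sum\<close> consists
  of conditional means over the missing steps. They are at most 1, and 0 below \<open>k\<close>,
  hence bounded by the indicators; \<open>K \<le> S u n\<close> provides the degree bound.\<close>

lemma card_core_verts_ge:
  assumes "card (C n M) > S u n" "K \<le> S u n"
  shows "final_sum (heavy_ind k) (S u n) (V K n) R \<le> real (card (fst ` C n M))"
proof -
  have R: "R = C n M" by (rule R_eq_core_if_large_core[OF assms(1)])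
  have "final_sum (heavy_ind k) (S u n) (V K n) R \<le> (\<Sum>v\<in>V K n. heavy_ind k (hdeg R v))"
    unfolding final_sum_def degree_sum_def
  proof (intro sum_mono)
    fix v assume "v \<in> V K n"
    then have "hdeg R v \<le> S u n + 1" using hdeg_R_le[of v] assms(2) by (auto simp: V_def)
    then show "mean_deg (heavy_ind k) (S u n) ((card R - S u n) div 2) (hdeg R v) \<le> heavy_ind k (hdeg R v)"
      using mean_deg_le_1[of "heavy_ind k"] mean_deg_zero[of k "heavy_ind k"]
      by (cases "k \<le> hdeg R v") (auto simp: heavy_ind_simps)
  qed
  also have "\<dots> \<le> (\<Sum>v\<in>{1..n}. heavy_ind k (hdeg R v))"
    by (intro sum_mono2) (auto simp: V_def heavy_ind_simps)
  also have "\<dots> = real (card {v\<in>{1..n}. k \<le> hdeg (C n M) v})"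
    by (simp add: R heavy_ind_simps sum.If_cases Int_def)
  also have "\<dots> = real (card (fst ` C n M))"
    using card_fst_core_set[OF M[unfolded set_P]] k by simp
  finally show ?thesis .
qed

end

end

section \<open>Excluded ranges of core sizes\<close>

lemma eventually_mult_n:
  assumes "(\<lambda>n. x n / real n) \<longlonglongrightarrow> (c::real)"
  shows "c < b \<Longrightarrow> eventually (\<lambda>n. x n < b * real n) sequentially"
    "b < c \<Longrightarrow> eventually (\<lambda>n. b * real n < x n) sequentially"
proof -
  assume "c < b"
  then have "eventually (\<lambda>n. x n / real n < b) sequentially" using order_tendstoD(2)[OF assms] by simp
  then show "eventually (\<lambda>n. x n < b * real n) sequentially"
    using eventually_gt_at_top[of 0] by eventually_elim (simp add: field_simps)
next
  assume "b < c"
  then have "eventually (\<lambda>n. x n / real n > b) sequentially" using order_tendstoD(1)[OF assms] by simp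
  then show "eventually (\<lambda>n. b * real n < x n) sequentially"
    using eventually_gt_at_top[of 0] by eventually_elim (simp add: field_simps)
qed

text \<open>With so small a core all deletions up to the inspection time would take place, leaving
  \<open>S u n\<close> half-edges, about \<open>lam * u * n\<close>. The heavy ones among them would
  number about \<open>n * core_h k p (sqrt u)\<close>, which is more.\<close>

lemma core_size_lower:
  assumes u: "0 < u" "u \<le> 1" and less: "lam * u < core_h k p (sqrt u)"
  shows "vanishing P (\<lambda>n M. card (C n M) \<le> S u n)"
proof -
  \<comment> \<open>The gap is \<open>4 * \<delta>\<close>: one part for the tail, one for the
    approximation of \<open>S u n\<close>, one for the deviation and one to spare.\<close>
  define \<delta> where "\<delta> = (core_h k p (sqrt u) - lam * u) / 4"
  have \<delta>: "\<delta> > 0" using less by (simp add: \<delta>_def)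
  obtain K where K: "tail K < \<delta>" using small_tail[OF \<delta>] .
  let ?B = "\<Sum>r\<le>K. pmf p r * binom_mean (heavy_deg k) r (sqrt u)"
  have B: "lam * u + 3 * \<delta> \<le> ?B"
  proof -
    have "core_h k p (sqrt u) = lam * u + 4 * \<delta>" by (simp add: \<delta>_def field_simps)
    then show ?thesis using truncated_core_h(2)[OF sqrt_u[OF u], of K] K by linarith
  qed
  have ev: "eventually (\<lambda>n. real (S u n) < (lam * u + \<delta>) * real n) sequentially"
    using \<delta> by (intro eventually_mult_n(1)[OF S_conv_n[OF u]]) simp
  show ?thesis
  proof (rule vanishing_mono[OF heavy_deg_concentrated[OF u \<delta>]])
    show "eventually (\<lambda>n. \<forall>M\<in>set_pmf (P n). card (C n M) \<le> S u n \<longrightarrow>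
        \<delta> * real n < \<bar>final_sum (heavy_deg k) (S u n) (V K n) (peel k (J u n) (H n) M) - real n * ?B\<bar>) sequentially"
      using ev
    proof eventually_elim
      case (elim n)
      show ?case
      proof (intro ballI impI)
        fix M assume M: "M \<in> set_pmf (P n)" "card (C n M) \<le> S u n"
        let ?R = "peel k (J u n) (H n) M"
        have cR: "card ?R = S u n" by (rule card_R_if_small_core[OF u M])
        have "final_sum (heavy_deg k) (S u n) (V K n) ?R = (\<Sum>v\<in>V K n. heavy_deg k (hdeg ?R v))"
          by (rule final_sum_R[OF u M(1) cR])
        also have "\<dots> \<le> (\<Sum>v\<in>V K n. real (hdeg ?R v))"
          by (intro sum_mono heavy_deg_bounds)
        also have "\<dots> \<le> real (card ?R)"
          using sum_hdeg_le_card[OF finite_V R_subset(2)[OF u M(1)], of K n]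
          by (metis of_nat_le_iff of_nat_sum)
        also have "\<dots> < (lam * u + \<delta>) * real n" using elim cR by simp
        finally have F: "final_sum (heavy_deg k) (S u n) (V K n) ?R < (lam * u + \<delta>) * real n" .
        have "(lam * u + 3 * \<delta>) * real n \<le> ?B * real n" using B by (intro mult_right_mono) auto
        then have "(lam * u + \<delta>) * real n + \<delta> * real n + \<delta> * real n \<le> real n * ?B"
          by (simp add: algebra_simps)
        moreover have "0 \<le> \<delta> * real n" using \<delta> by simp
        ultimately show "\<delta> * real n < \<bar>final_sum (heavy_deg k) (S u n) (V K n) ?R - real n * ?B\<bar>"
          using F by linarith
      qed
    qed
  qed
qed

text \<open>A core of at most \<open>S u n\<close> half-edges lies among the heavy ones left at the
  inspection time, whose number falls short of \<open>lam * u * n\<close> by about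
  \<open>\<delta> * n\<close>. The window covers only half of that shortfall, so it is
  excluded.\<close>

lemma core_size_gap:
  assumes u: "0 < u" "u \<le> 1" and \<delta>: "\<delta> > 0" and less: "core_h k p (sqrt u) + \<delta> \<le> lam * u"
  shows "vanishing P (\<lambda>n M. real (N n) * (u - \<delta> / (2 * lam)) \<le> real (card (C n M)) \<and> card (C n M) \<le> S u n)"
proof -
  \<comment> \<open>In units of \<open>\<epsilon> * n\<close>: the window begins at most 9 below
    \<open>lam * u\<close>, the excess is less than 2, and the predicted value is at least 16 below.
    This leaves 5 where a deviation of 1 is claimed.\<close>
  define \<epsilon> where "\<epsilon> = \<delta> / 16"
  have \<epsilon>: "\<epsilon> > 0" using \<delta> by (simp add: \<epsilon>_def)
  obtain K where K: "tail K < \<epsilon>" using small_tail[OF \<epsilon>] .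
  let ?B = "\<Sum>r\<le>K. pmf p r * binom_mean (heavy_deg k) r (sqrt u)"
  have B: "?B + 16 * \<epsilon> \<le> lam * u"
    using truncated_core_h(1)[OF sqrt_u[OF u], of K] less by (simp add: \<epsilon>_def)
  have e1: "eventually (\<lambda>n. excess K n < (2 * \<epsilon>) * real n) sequentially"
    using K \<epsilon> by (intro eventually_mult_n(1)[OF excess_conv]) simp
  have "(\<lambda>n. (real (N n) / real n) * (u - \<delta> / (2 * lam))) \<longlonglongrightarrow> lam * (u - \<delta> / (2 * lam))"
    by (intro tendsto_mult N_conv tendsto_const)
  then have "(\<lambda>n. (real (N n) * (u - \<delta> / (2 * lam))) / real n) \<longlonglongrightarrow> lam * (u - \<delta> / (2 * lam))"
    by simp
  moreover have "lam * u - 9 * \<epsilon> < lam * (u - \<delta> / (2 * lam))"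
    using lam_pos \<delta> by (simp add: \<epsilon>_def field_simps)
  ultimately have e2: "eventually (\<lambda>n. (lam * u - 9 * \<epsilon>) * real n < real (N n) * (u - \<delta> / (2 * lam))) sequentially"
    by (rule eventually_mult_n(2))
  show ?thesis
  proof (rule vanishing_mono[OF heavy_deg_concentrated[OF u \<epsilon>]])
    show "eventually (\<lambda>n. \<forall>M\<in>set_pmf (P n).
        real (N n) * (u - \<delta> / (2 * lam)) \<le> real (card (C n M)) \<and> card (C n M) \<le> S u n \<longrightarrow>
        \<epsilon> * real n < \<bar>final_sum (heavy_deg k) (S u n) (V K n) (peel k (J u n) (H n) M) - real n * ?B\<bar>) sequentially"
      using e1 e2
    proof eventually_elim
      case (elim n)
      show ?case
      proof (intro ballI impI, elim conjE)
        fix M assume M: "M \<in> set_pmf (P n)"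
          and c: "real (N n) * (u - \<delta> / (2 * lam)) \<le> real (card (C n M))" "card (C n M) \<le> S u n"
        let ?F = "final_sum (heavy_deg k) (S u n) (V K n) (peel k (J u n) (H n) M)"
        have "real (card (C n M)) \<le> ?F + excess K n"
          by (rule card_core_le[OF u M card_R_if_small_core[OF u M c(2)]])
        then have F: "(lam * u - 9 * \<epsilon>) * real n < ?F + (2 * \<epsilon>) * real n" using elim c(1) by linarith
        have "(?B + 16 * \<epsilon>) * real n \<le> lam * u * real n" using B by (intro mult_right_mono) auto
        then have "real n * ?B + 16 * (\<epsilon> * real n) \<le> lam * u * real n" by (simp add: algebra_simps)
        moreover have "lam * u * real n - 9 * (\<epsilon> * real n) < ?F + 2 * (\<epsilon> * real n)"
          using F by (simp add: algebra_simps)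
        moreover have "0 \<le> \<epsilon> * real n" using \<epsilon> by simp
        ultimately show "\<epsilon> * real n < \<bar>?F - real n * ?B\<bar>" by linarith
      qed
    qed
  qed
qed

text \<open>By compactness the gap has a positive minimum, so all windows share one width
  \<open>\<eta>\<close>. From the trivial bound \<open>N n\<close>, finitely many windows lead down
  to \<open>N n * u0\<close>. The alternative \<open>u0 = 1\<close> is that trivial bound and serves
  the case of a largest root equal to 1.\<close>

lemma core_size_upper:
  assumes u0: "0 < u0" "u0 \<le> 1"
    and less: "u0 = 1 \<or> (\<forall>q\<in>{sqrt u0..1}. core_h k p q < lam * q\<^sup>2)"
  shows "vanishing P (\<lambda>n M. real (N n) * u0 < real (card (C n M)))"
proof (cases "u0 = 1")
  case True
  then show ?thesis using card_C_le by (intro vanishing_impossible) (auto simp: not_less)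
next
  case False
  then have less: "core_h k p q < lam * q\<^sup>2" if "q \<in> {sqrt u0..1}" for q using less that by blast
  have "continuous_on {sqrt u0..1} (\<lambda>q. lam * q\<^sup>2 - core_h k p q)"
    using u0 by (intro continuous_intros continuous_on_subset[OF continuous_core_h]) auto
  moreover have "sqrt u0 \<le> 1" using u0 by simp
  ultimately obtain q0 where q0: "q0 \<in> {sqrt u0..1}"
    "\<And>q. q \<in> {sqrt u0..1} \<Longrightarrow> lam * q0\<^sup>2 - core_h k p q0 \<le> lam * q\<^sup>2 - core_h k p q"
    using continuous_attains_inf[of "{sqrt u0..1}" "\<lambda>q. lam * q\<^sup>2 - core_h k p q"] by auto
  define \<delta> where "\<delta> = lam * q0\<^sup>2 - core_h k p q0"
  have \<delta>: "\<delta> > 0" using less[OF q0(1)] by (simp add: \<delta>_def)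
  define \<eta> where "\<eta> = \<delta> / (2 * lam)"
  have \<eta>: "\<eta> > 0" using \<delta> lam_pos by (simp add: \<eta>_def)
  have step: "vanishing P (\<lambda>n M. real (N n) * max u0 (1 - real i * \<eta>) < real (card (C n M)))" for i
  proof (induction i)
    case 0
    then show ?case using card_C_le u0 by (intro vanishing_impossible) (auto simp: not_less)
  next
    case (Suc i)
    \<comment> \<open>The maximum keeps \<open>sqrt w\<close> in the interval on which the gap is
      known.\<close>
    define w where "w = max u0 (1 - real i * \<eta>)"
    have w: "0 < w" "w \<le> 1" "u0 \<le> w" using u0 \<eta> by (auto simp: w_def)
    have "sqrt w \<in> {sqrt u0..1}" using w by simp
    then have "core_h k p (sqrt w) + \<delta> \<le> lam * w"
      using q0(2)[of "sqrt w"] w by (simp add: \<delta>_def)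
    then have gap: "vanishing P (\<lambda>n M. real (N n) * (w - \<eta>) \<le> real (card (C n M)) \<and> card (C n M) \<le> S w n)"
      using core_size_gap[OF w(1,2) \<delta>] by (simp add: \<eta>_def)
    show ?case
    proof (rule vanishing_mono[OF vanishing_disj[OF Suc gap]], intro always_eventually allI ballI impI)
      fix n M assume h: "real (N n) * max u0 (1 - real (Suc i) * \<eta>) < real (card (C n M))"
      show "real (N n) * max u0 (1 - real i * \<eta>) < real (card (C n M)) \<or>
         (real (N n) * (w - \<eta>) \<le> real (card (C n M)) \<and> card (C n M) \<le> S w n)"
      proof (cases "real (N n) * w < real (card (C n M))")
        case False
        \<comment> \<open>Rounding makes \<open>S w n\<close> at least \<open>w * N n\<close>, so
          consecutive windows leave no hole.\<close>
        then have "real (card (C n M)) \<le> real (S w n)"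
          using S_bounds(1)[OF w(1,2), of n] by (simp add: mult.commute)
        moreover have "real (N n) * (w - \<eta>) \<le> real (N n) * max u0 (1 - real (Suc i) * \<eta>)"
          using \<eta> by (intro mult_left_mono) (auto simp: w_def algebra_simps max_def)
        ultimately show ?thesis using h by linarith
      qed (simp add: w_def)
    qed
  qed
  obtain i where "1 / \<eta> < real i" using reals_Archimedean2 by blast
  then have "1 - real i * \<eta> \<le> u0" using \<eta> u0 by (simp add: field_simps)
  then show ?thesis using step[of i] by (simp add: max_def)
qed

end

section \<open>Convergence at the largest root\<close>

context degree_sequence
begin

context
  fixes q0 \<epsilon>0 :: real
  assumes q0: "0 < q0" "q0 \<le> 1"
    and above: "\<And>q. q \<in> {q0<..1} \<Longrightarrow> core_h k p q < lam * q\<^sup>2"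
    and below: "\<epsilon>0 > 0" "\<And>q. q \<in> {q0 - \<epsilon>0<..<q0} \<inter> {0..1} \<Longrightarrow> lam * q\<^sup>2 < core_h k p q"
begin

lemma core_size_bracket:
  assumes "\<delta> > 0"
  obtains a b where "q0 \<le> a" "a \<le> 1" "a < q0 + \<delta>"
    "vanishing P (\<lambda>n M. real (N n) * a\<^sup>2 < real (card (C n M)))"
    "0 < b" "b < q0" "q0 - \<delta> < b" "vanishing P (\<lambda>n M. card (C n M) \<le> S (b\<^sup>2) n)"
proof -
  \<comment> \<open>At the cap \<open>a = 1\<close> the upper bound is trivial; this covers
    \<open>q0 = 1\<close>, where there is no room above. In \<open>b\<close> the minimum with
    \<open>q0\<close> keeps \<open>b\<close> positive, and that with \<open>\<epsilon>0\<close>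
    keeps it where \<open>below\<close> applies.\<close>
  define a where "a = min 1 (q0 + \<delta> / 2)"
  define b where "b = q0 - min (min \<delta> \<epsilon>0) q0 / 2"
  have a: "q0 \<le> a" "a \<le> 1" "a < q0 + \<delta>" "0 < a" using q0 assms by (auto simp: a_def)
  have b: "0 < b" "b < q0" "q0 - \<delta> < b" "q0 - \<epsilon>0 < b" "b \<le> 1"
    using q0 assms below(1) by (auto simp: b_def min_def)
  have "a\<^sup>2 = 1 \<or> (\<forall>q\<in>{sqrt (a\<^sup>2)..1}. core_h k p q < lam * q\<^sup>2)"
  proof (cases "a = 1")
    case False
    then have "q0 < a" using q0 assms by (auto simp: a_def min_def)
    then show ?thesis using a above by auto
  qed simp
  then have up: "vanishing P (\<lambda>n M. real (N n) * a\<^sup>2 < real (card (C n M)))"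
    using a by (intro core_size_upper) (auto simp: power_le_one)
  have lo: "vanishing P (\<lambda>n M. card (C n M) \<le> S (b\<^sup>2) n)"
    using b below(2)[of b] by (intro core_size_lower) (auto simp: power_le_one)
  show ?thesis using that[OF a(1-3) up b(1-3) lo] .
qed

lemma core_size_conv:
  assumes e: "e > 0"
  shows "vanishing P (\<lambda>n M. e < \<bar>real (card (C n M)) / real n - lam * q0\<^sup>2\<bar>)"
proof -
  \<comment> \<open>Squares of numbers in the unit interval at distance below
    \<open>\<delta>\<close> differ by at most \<open>2 * \<delta>\<close>, which \<open>lam\<close>
    turns into \<open>e / 3\<close>.\<close>
  define \<delta> where "\<delta> = e / (6 * lam)"
  have \<delta>: "\<delta> > 0" using e lam_pos by (simp add: \<delta>_def)
  obtain a b where a: "q0 \<le> a" "a \<le> 1" "a < q0 + \<delta>"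
    "vanishing P (\<lambda>n M. real (N n) * a\<^sup>2 < real (card (C n M)))"
    and b: "0 < b" "b < q0" "q0 - \<delta> < b" "vanishing P (\<lambda>n M. card (C n M) \<le> S (b\<^sup>2) n)"
    using core_size_bracket[OF \<delta>] .
  have sq: "x\<^sup>2 \<le> y\<^sup>2 + 2 * \<delta>" if "0 \<le> y" "y \<le> x" "x \<le> 1" "x < y + \<delta>" for x y :: real
  proof -
    have "x\<^sup>2 - y\<^sup>2 = (x + y) * (x - y)" by (simp add: power2_eq_square algebra_simps)
    also have "\<dots> \<le> 2 * \<delta>" using that \<delta> by (intro mult_mono) auto
    finally show ?thesis by simp
  qed
  have lam\<delta>: "lam * (2 * \<delta>) = e / 3" using lam_pos by (simp add: \<delta>_def)
  have A: "lam * a\<^sup>2 < lam * q0\<^sup>2 + e"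
    using mult_left_mono[OF sq[of q0 a], of lam] a q0 lam_pos lam\<delta> e by (simp add: distrib_left)
  have B: "lam * q0\<^sup>2 - e < lam * b\<^sup>2"
    using mult_left_mono[OF sq[of b q0], of lam] b q0 lam_pos lam\<delta> e by (simp add: distrib_left)
  have "(\<lambda>n. real (N n) / real n * a\<^sup>2) \<longlonglongrightarrow> lam * a\<^sup>2"
    by (intro tendsto_mult N_conv tendsto_const)
  then have "(\<lambda>n. real (N n) * a\<^sup>2 / real n) \<longlonglongrightarrow> lam * a\<^sup>2" by simp
  then have e1: "eventually (\<lambda>n. real (N n) * a\<^sup>2 < (lam * q0\<^sup>2 + e) * real n) sequentially"
    using A by (rule eventually_mult_n(1))
  have e2: "eventually (\<lambda>n. (lam * q0\<^sup>2 - e) * real n < real (S (b\<^sup>2) n)) sequentially"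
    using B b q0 by (intro eventually_mult_n(2)[OF S_conv_n]) (auto simp: power_le_one)
  show ?thesis
  proof (rule vanishing_mono[OF vanishing_disj[OF a(4) b(4)]])
    show "eventually (\<lambda>n. \<forall>M\<in>set_pmf (P n). e < \<bar>real (card (C n M)) / real n - lam * q0\<^sup>2\<bar> \<longrightarrow>
        real (N n) * a\<^sup>2 < real (card (C n M)) \<or> card (C n M) \<le> S (b\<^sup>2) n) sequentially"
      using e1 e2 eventually_gt_at_top[of 0]
    proof eventually_elim
      case (elim n)
      show ?case
      proof (intro ballI impI, rule ccontr)
        fix M assume h: "e < \<bar>real (card (C n M)) / real n - lam * q0\<^sup>2\<bar>"
          "\<not> (real (N n) * a\<^sup>2 < real (card (C n M)) \<or> card (C n M) \<le> S (b\<^sup>2) n)"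
        then have "real (card (C n M)) < (lam * q0\<^sup>2 + e) * real n"
          "(lam * q0\<^sup>2 - e) * real n < real (card (C n M))" using elim by auto
        then have "real (card (C n M)) / real n < lam * q0\<^sup>2 + e"
          "lam * q0\<^sup>2 - e < real (card (C n M)) / real n" using elim by (simp_all add: field_simps)
        then show False using h(1) by linarith
      qed
    qed
  qed
qed

lemma core_nonempty: "vanishing P (\<lambda>n M. C n M = {})"
proof -
  obtain b where b: "vanishing P (\<lambda>n M. card (C n M) \<le> S (b\<^sup>2) n)"
    using core_size_bracket[of 1] by (metis zero_less_one)
  show ?thesis by (rule vanishing_mono[OF b]) simp
qed

text \<open>The stopping time is caught between two inspection times. At \<open>a^2\<close> all
  scheduled deletions have taken place and the heavy vertices bound those of the core from above; by
  \<open>b^2\<close> peeling has stopped, which gives the lower bound. Continuity of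
  \<open>core_h1\<close> closes the gap.\<close>

lemma core_verts_conv:
  assumes e: "e > 0"
  shows "vanishing P (\<lambda>n M. e < \<bar>real (card (fst ` C n M)) / real n - core_h1 k p q0\<bar>)"
proof -
  have "q0 \<in> {0..1}" using q0 by simp
  then obtain \<delta> where \<delta>: "\<delta> > 0"
    "\<And>q. q \<in> {0..1} \<Longrightarrow> dist q q0 < \<delta> \<Longrightarrow> dist (core_h1 k p q) (core_h1 k p q0) < e / 4"
    using continuous_core_h1 e unfolding continuous_on_iff by (metis zero_less_divide_iff zero_less_numeral)
  obtain a b where a: "q0 \<le> a" "a \<le> 1" "a < q0 + \<delta>"
    "vanishing P (\<lambda>n M. real (N n) * a\<^sup>2 < real (card (C n M)))"
    and b: "0 < b" "b < q0" "q0 - \<delta> < b" "vanishing P (\<lambda>n M. card (C n M) \<le> S (b\<^sup>2) n)"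
    using core_size_bracket[OF \<delta>(1)] .
  have A: "core_h1 k p a < core_h1 k p q0 + e / 4"
  proof -
    have "dist (core_h1 k p a) (core_h1 k p q0) < e / 4"
      using a q0 by (intro \<delta>(2)) (auto simp: dist_real_def)
    then show ?thesis unfolding dist_real_def by linarith
  qed
  have B: "core_h1 k p q0 - e / 4 < core_h1 k p b"
  proof -
    have "dist (core_h1 k p b) (core_h1 k p q0) < e / 4"
      using b q0 by (intro \<delta>(2)) (auto simp: dist_real_def)
    then show ?thesis unfolding dist_real_def by linarith
  qed
  have ua: "0 < a\<^sup>2" "a\<^sup>2 \<le> 1" and ub: "0 < b\<^sup>2" "b\<^sup>2 \<le> 1" using a b q0 by (auto simp: power_le_one)
  have sa: "sqrt (a\<^sup>2) = a" and sb: "sqrt (b\<^sup>2) = b" using a b q0 by auto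
  \<comment> \<open>On either side continuity, truncation and deviation cost at most
    \<open>e / 4\<close> each.\<close>
  obtain K where K: "tail K < e / 4" using small_tail[of "e / 4"] e by auto
  let ?B = "\<lambda>q. \<Sum>r\<le>K. pmf p r * binom_mean (heavy_ind k) r q"
  let ?F = "\<lambda>u n M. final_sum (heavy_ind k) (S u n) (V K n) (peel k (J u n) (H n) M)"
  have e4: "e / 4 > 0" using e by simp
  have Ba: "?B a < core_h1 k p q0 + e / 4"
    using truncated_core_h1(1)[of a K] A a q0 by auto
  have Bb: "core_h1 k p q0 - e / 2 < ?B b"
    using truncated_core_h1(2)[of b K] B K b q0 by auto
  have e1: "eventually (\<lambda>n. excess K n < (e / 4) * real n) sequentially"
    by (rule eventually_mult_n(1)[OF excess_conv K])
  have e2: "eventually (\<lambda>n. real (S (b\<^sup>2) n) \<ge> real K) sequentially"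
    using S_at_top[OF ub] unfolding filterlim_at_top by blast
  note neg = vanishing_disj[OF vanishing_disj[OF a(4) b(4)]
      vanishing_disj[OF heavy_ind_concentrated[OF ua e4, of K] heavy_ind_concentrated[OF ub e4, of K]]]
  show ?thesis
  proof (rule vanishing_mono[OF neg])
    show "eventually (\<lambda>n. \<forall>M\<in>set_pmf (P n). e < \<bar>real (card (fst ` C n M)) / real n - core_h1 k p q0\<bar> \<longrightarrow>
        (real (N n) * a\<^sup>2 < real (card (C n M)) \<or> card (C n M) \<le> S (b\<^sup>2) n) \<or>
        (e / 4 * real n < \<bar>?F (a\<^sup>2) n M - real n * ?B (sqrt (a\<^sup>2))\<bar> \<or>
         e / 4 * real n < \<bar>?F (b\<^sup>2) n M - real n * ?B (sqrt (b\<^sup>2))\<bar>)) sequentially"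
      using e1 e2 eventually_gt_at_top[of 0]
    proof eventually_elim
      case (elim n)
      show ?case unfolding sa sb
      proof (intro ballI impI, rule ccontr)
        fix M assume M: "M \<in> set_pmf (P n)"
          and h: "e < \<bar>real (card (fst ` C n M)) / real n - core_h1 k p q0\<bar>"
          "\<not> ((real (N n) * a\<^sup>2 < real (card (C n M)) \<or> card (C n M) \<le> S (b\<^sup>2) n) \<or>
            (e / 4 * real n < \<bar>?F (a\<^sup>2) n M - real n * ?B a\<bar> \<or>
             e / 4 * real n < \<bar>?F (b\<^sup>2) n M - real n * ?B b\<bar>))"
        have "real (card (C n M)) \<le> real (S (a\<^sup>2) n)"
          using h(2) S_bounds(1)[OF ua, of n] by (simp add: mult.commute)
        then have "card (C n M) \<le> S (a\<^sup>2) n" by simp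
        then have up: "real (card (fst ` C n M)) \<le> ?F (a\<^sup>2) n M + excess K n"
          by (intro card_core_verts_le[OF ua M] card_R_if_small_core[OF ua M])
        have lo: "?F (b\<^sup>2) n M \<le> real (card (fst ` C n M))"
          using h(2) elim by (intro card_core_verts_ge[OF ub M]) auto
        have n: "real n > 0" using elim by simp
        define x where "x = e / 4 * real n"
        have x: "x > 0" "e * real n = 4 * x" "e / 2 * real n = 2 * x" using n e by (simp_all add: x_def)
        have close: "\<bar>?F (a\<^sup>2) n M - real n * ?B a\<bar> \<le> x" "\<bar>?F (b\<^sup>2) n M - real n * ?B b\<bar> \<le> x"
          "excess K n < x" using h(2) elim(1) by (auto simp: x_def)
        have "real n * ?B a < real n * (core_h1 k p q0 + e / 4)"
          using Ba n by (intro mult_strict_left_mono)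
        then have "real n * ?B a < core_h1 k p q0 * real n + x" by (simp add: x_def algebra_simps)
        then have "real (card (fst ` C n M)) < core_h1 k p q0 * real n + e * real n"
          using up close x by linarith
        then have "real (card (fst ` C n M)) < (core_h1 k p q0 + e) * real n"
          by (simp add: distrib_right)
        moreover have "real n * (core_h1 k p q0 - e / 2) < real n * ?B b"
          using Bb n by (intro mult_strict_left_mono)
        then have "core_h1 k p q0 * real n - e / 2 * real n < real n * ?B b" by (simp add: algebra_simps)
        then have "core_h1 k p q0 * real n - e * real n < real (card (fst ` C n M))"
          using lo close x by linarith
        then have "(core_h1 k p q0 - e) * real n < real (card (fst ` C n M))"
          by (simp add: left_diff_distrib)
        ultimately have "real (card (fst ` C n M)) / real n < core_h1 k p q0 + e"
          "core_h1 k p q0 - e < real (card (fst ` C n M)) / real n" using n by (simp_all add: field_simps)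
        then show False using h(1) by linarith
      qed
    qed
  qed
qed

end

lemma small_core:
  assumes "\<And>q. q \<in> {0<..1} \<Longrightarrow> core_h k p q < lam * q\<^sup>2" and e: "e > 0"
  shows "vanishing P (\<lambda>n M. e * real n < real (card (C n M)))"
proof -
  \<comment> \<open>Then \<open>lam * u \<le> e / 2\<close>, so \<open>N n * u\<close> is eventually
    below \<open>e * n\<close>.\<close>
  define u where "u = min 1 (e / (2 * lam))"
  have u: "0 < u" "u \<le> 1" using e lam_pos by (auto simp: u_def)
  have "vanishing P (\<lambda>n M. real (N n) * u < real (card (C n M)))"
  proof (rule core_size_upper[OF u])
    have "0 < q" if "sqrt u \<le> q" for q
      using that u(1) real_sqrt_gt_0_iff[of u] by linarith
    then show "u = 1 \<or> (\<forall>q\<in>{sqrt u..1}. core_h k p q < lam * q\<^sup>2)" using assms(1) by auto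
  qed
  moreover have "eventually (\<lambda>n. real (N n) * u < e * real n) sequentially"
  proof (rule eventually_mult_n(1))
    have "(\<lambda>n. real (N n) / real n * u) \<longlonglongrightarrow> lam * u"
      by (intro tendsto_mult N_conv tendsto_const)
    then show "(\<lambda>n. real (N n) * u / real n) \<longlonglongrightarrow> lam * u" by simp
    have "lam * u \<le> lam * (e / (2 * lam))" using lam_pos by (intro mult_left_mono) (auto simp: u_def)
    then show "lam * u < e" using lam_pos e by simp
  qed
  then have "eventually (\<lambda>n. \<forall>M\<in>set_pmf (P n). e * real n < real (card (C n M))
      \<longrightarrow> real (N n) * u < real (card (C n M))) sequentially"
    by eventually_elim auto
  ultimately show ?thesis by (rule vanishing_mono)
qed

end

section \<open>There are no small cores\<close>

text \<open>Expose the mate of some \<open>x \<in> A\<close>. It must fall into \<open>A\<close>,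
  which has probability \<open>(card A - 1) / (card R - 1)\<close>, at most
  \<open>card A / card R\<close>; deleting the pair from both sets does not raise this
  ratio.\<close>

lemma prob_closed_in:
  assumes "finite R" "even (card R)" "A \<subseteq> R" "card A = 2 * a"
  shows "measure_pmf.prob (unif_matching R) {M. closed_in M A} \<le> (real (2 * a) / real (card R)) ^ a"
  using assms
proof (induction a arbitrary: A R)
  case 0
  then show ?case by simp
next
  case (Suc a)
  then obtain x where x: "x \<in> A" by (metis card.empty ex_in_conv mult_is_0 old.nat.distinct(2) zero_neq_numeral)
  have xR: "x \<in> R" using x Suc.prems by auto
  have le: "2 * Suc a \<le> card R" using Suc.prems card_mono[OF Suc.prems(1,3)] by simp
  let ?E = "\<lambda>y. measure_pmf.expectation (unif_matching (R - {x, y}))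
      (\<lambda>M. indicator {M. closed_in M A} (insert {x, y} M) :: real)"
  let ?b = "(real (2 * Suc a) / real (card R)) ^ a"
  have E: "?E y \<le> (if y \<in> A then ?b else 0)" if y: "y \<in> R - {x}" for y
  proof (cases "y \<in> A")
    case False
    then have "\<not> closed_in (insert {x, y} M) A" for M using x by (auto simp: closed_in_def)
    then show ?thesis using False by simp
  next
    case True
    have cR: "card (R - {x, y}) = card R - 2" using y xR Suc.prems by (subst card_Diff_subset) auto
    have cA: "card (A - {x, y}) = 2 * a"
      using y x True Suc.prems finite_subset[OF Suc.prems(3,1)] by (subst card_Diff_subset) auto
    have ev: "even (card (R - {x, y}))" using Suc.prems cR by simp
    have fin: "finite (R - {x, y})" using Suc.prems by simp
    have "?E y \<le> measure_pmf.prob (unif_matching (R - {x, y})) {M. closed_in M (A - {x, y})}"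
    proof -
      have "?E y = measure_pmf.prob (unif_matching (R - {x, y})) {M. closed_in (insert {x, y} M) A}"
      proof -
        have "(\<lambda>M. indicator {M. closed_in M A} (insert {x, y} M) :: real)
            = indicator {M. closed_in (insert {x, y} M) A}" by (auto simp: indicator_def)
        then show ?thesis by simp
      qed
      also have "\<dots> \<le> measure_pmf.prob (unif_matching (R - {x, y})) {M. closed_in M (A - {x, y})}"
      proof (rule pmf_prob_mono)
        fix M assume "M \<in> set_pmf (unif_matching (R - {x, y}))" "M \<in> {M. closed_in (insert {x, y} M) A}"
        then have "M \<in> perfect_matchings (R - {x, y})" "closed_in (insert {x, y} M) A"
          using set_unif_matching[OF fin ev] by auto
        then show "M \<in> {M. closed_in M (A - {x, y})}"
          unfolding closed_in_def perfect_matchings_def partition_on_def by blast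
      qed
      finally show ?thesis .
    qed
    also have "\<dots> \<le> (real (2 * a) / real (card (R - {x, y}))) ^ a"
      using Suc.prems by (intro Suc.IH[OF fin ev _ cA]) auto
    also have "\<dots> \<le> ?b"
    \<comment> \<open>\<open>card R = 2\<close> forces \<open>a = 0\<close>: both powers are then 1,
      although the quotient on the left divides by 0.\<close>
    proof (cases "card R = 2")
      case True
      then show ?thesis using le by simp
    next
      case False
      moreover have "2 \<le> card R" using le by simp
      ultimately have "card R > 2" by simp
      then have c: "real (card R) > 2" by simp
      have "real (2 * a) / real (card (R - {x, y})) \<le> real (2 * Suc a) / real (card R)"
        using c le unfolding cR by (simp add: of_nat_diff field_simps)
      then show ?thesis by (intro power_mono) auto
    qed
    finally show ?thesis using True by simp
  qed
  have "measure_pmf.prob (unif_matching R) {M. closed_in M A}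
      = measure_pmf.expectation (unif_matching R) (indicator {M. closed_in M A})" by simp
  also have "\<dots> = (\<Sum>y\<in>R - {x}. ?E y) / (real (card R) - 1)"
    by (rule expectation_unif_matching[OF Suc.prems(1,2) xR])
  also have "\<dots> \<le> (\<Sum>y\<in>R - {x}. if y \<in> A then ?b else 0) / (real (card R) - 1)"
    using le E by (intro divide_right_mono sum_mono) auto
  also have "(\<Sum>y\<in>R - {x}. if y \<in> A then ?b else 0) = real (2 * Suc a - 1) * ?b"
  proof -
    have "(R - {x}) \<inter> A = A - {x}" using Suc.prems by auto
    moreover have "card (A - {x}) = 2 * Suc a - 1"
      using Suc.prems x finite_subset[OF Suc.prems(3,1)] by (subst card_Diff_singleton) auto
    ultimately show ?thesis using Suc.prems(1) by (simp add: sum.If_cases Int_def)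
  qed
  also have "real (2 * Suc a - 1) * ?b / (real (card R) - 1)
      = (real (2 * Suc a - 1) / (real (card R) - 1)) * ?b" by simp
  also have "\<dots> \<le> (real (2 * Suc a) / real (card R)) * ?b"
    using le by (intro mult_right_mono) (auto simp: field_simps)
  finally show ?case by simp
qed

lemma sum_Pow_power_card:
  fixes y :: real
  assumes "finite F"
  shows "(\<Sum>B\<in>Pow F. y ^ card B) = (1 + y) ^ card F"
proof -
  have "(\<Prod>x\<in>F. y + 1) = (\<Sum>B\<in>Pow F. (\<Prod>x\<in>B. y) * (\<Prod>x\<in>F - B. 1))"
    by (rule prod_add[OF assms])
  then show ?thesis by (simp add: add.commute)
qed

text \<open>The possible half-edge sets of a core with \<open>k \<ge> 3\<close>, described without
  reference to the matching so that they can be counted.\<close>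

definition dense_sets :: "('v \<times> 'b) set \<Rightarrow> ('v \<times> 'b) set set" where
  "dense_sets R = {A. A \<subseteq> R \<and> (\<forall>x\<in>A. 3 \<le> hdeg A (fst x))}"

lemma finite_dense_sets: "finite R \<Longrightarrow> finite (dense_sets R)"
  by (rule finite_subset[of _ "Pow R"]) (auto simp: dense_sets_def)

text \<open>A fibre of a dense set is empty or has at least three elements; for these
  \<open>z ^ b \<le> (z / y) ^ 3 * y ^ b\<close>.\<close>

lemma dense_sets_generating_function:
  fixes y z :: real
  assumes "0 < z" "z \<le> y"
  shows "(\<Sum>A\<in>dense_sets (half_edges n d). z ^ card A)
      \<le> (\<Prod>v=1..n. 1 + (z / y) ^ 3 * (1 + y) ^ d v)"
proof (induction n)
  case 0
  have "half_edges 0 d = {}" by (simp add: half_edges_def)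
  then have "dense_sets (half_edges 0 d) = {{}}" by (auto simp: dense_sets_def)
  then show ?case by simp
next
  case (Suc n)
  let ?H = "half_edges n d" and ?F = "{Suc n} \<times> {..<d (Suc n)}"
  let ?B = "{B\<in>Pow ?F. B = {} \<or> 3 \<le> card B}"
  \<comment> \<open>Splits off the fibre over the last vertex. For an upper bound an injection into
    the product is enough.\<close>
  let ?r = "\<lambda>A. (A \<inter> ?H, A \<inter> ?F)"
  have H: "half_edges (Suc n) d = ?H \<union> ?F" by (auto simp: half_edges_def le_Suc_eq)
  have disj: "?H \<inter> ?F = {}" by (auto simp: half_edges_def)
  have finF: "finite ?F" by simp
  have r: "?r ` dense_sets (half_edges (Suc n) d) \<subseteq> dense_sets ?H \<times> ?B"
  proof (rule image_subsetI)
    fix A assume A: "A \<in> dense_sets (half_edges (Suc n) d)"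
    have "hdeg (A \<inter> ?H) (fst x) = hdeg A (fst x)" if "x \<in> A \<inter> ?H" for x
    proof -
      have "{w \<in> A \<inter> ?H. fst w = fst x} = {w \<in> A. fst w = fst x}"
        using A that unfolding dense_sets_def H by (auto simp: half_edges_def)
      then show ?thesis by (simp add: hdeg_def)
    qed
    then have 1: "A \<inter> ?H \<in> dense_sets ?H" using A by (auto simp: dense_sets_def)
    have "3 \<le> card (A \<inter> ?F)" if "x \<in> A \<inter> ?F" for x
    proof -
      have "{w \<in> A. fst w = fst x} = A \<inter> ?F"
        using A that unfolding dense_sets_def H by (auto simp: half_edges_def)
      moreover have "3 \<le> hdeg A (fst x)" using A that by (auto simp: dense_sets_def)
      ultimately show ?thesis by (simp add: hdeg_def)
    qed
    then have "A \<inter> ?F \<in> ?B" by blast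
    with 1 show "?r A \<in> dense_sets ?H \<times> ?B" by simp
  qed
  have inj: "inj_on ?r (dense_sets (half_edges (Suc n) d))"
  proof (rule inj_onI)
    fix A A' assume "A \<in> dense_sets (half_edges (Suc n) d)" "A' \<in> dense_sets (half_edges (Suc n) d)"
      "?r A = ?r A'"
    then show "A = A'" unfolding dense_sets_def H by blast
  qed
  have card: "z ^ card A = z ^ card (A \<inter> ?H) * z ^ card (A \<inter> ?F)"
    if "A \<in> dense_sets (half_edges (Suc n) d)" for A
  proof -
    have A: "A = (A \<inter> ?H) \<union> (A \<inter> ?F)" using that unfolding dense_sets_def H by blast
    have "card A = card (A \<inter> ?H) + card (A \<inter> ?F)"
      using disj finite_half_edges[of n d] by (subst A, intro card_Un_disjoint) auto
    then show ?thesis by (simp add: power_add)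
  qed
  have zy: "0 \<le> z / y" "z / y \<le> 1" "0 < y" using assms by auto
  have B: "(\<Sum>B\<in>?B. z ^ card B) \<le> 1 + (z / y) ^ 3 * (1 + y) ^ d (Suc n)"
  proof -
    have "(\<Sum>B\<in>?B. z ^ card B) \<le> (\<Sum>B\<in>Pow ?F. (if B = {} then 1 else 0) + (z / y) ^ 3 * y ^ card B)"
    proof (rule order.trans[OF sum_mono])
      fix B assume B: "B \<in> ?B"
      show "z ^ card B \<le> (if B = {} then 1 else 0) + (z / y) ^ 3 * y ^ card B"
      proof (cases "B = {}")
        case False
        have "z ^ card B = (z / y) ^ card B * y ^ card B" using zy by (simp flip: power_mult_distrib)
        also have "\<dots> \<le> (z / y) ^ 3 * y ^ card B"
          using B False zy by (intro mult_right_mono power_decreasing) auto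
        finally show ?thesis using False by simp
      qed (use zy in simp)
    next
      show "(\<Sum>B\<in>?B. (if B = {} then 1 else 0) + (z / y) ^ 3 * y ^ card B)
          \<le> (\<Sum>B\<in>Pow ?F. (if B = {} then 1 else 0) + (z / y) ^ 3 * y ^ card B)"
        using zy finF by (intro sum_mono2) auto
    qed
    also have "\<dots> = 1 + (z / y) ^ 3 * (1 + y) ^ card ?F"
      using finF by (simp add: sum.distrib sum_distrib_left[symmetric] sum_Pow_power_card
          del: card_Pow)
    finally show ?thesis by (simp add: card_cartesian_product)
  qed
  have "(\<Sum>A\<in>dense_sets (half_edges (Suc n) d). z ^ card A)
      = (\<Sum>w\<in>?r ` dense_sets (half_edges (Suc n) d). z ^ card (fst w) * z ^ card (snd w))"
    by (subst sum.reindex[OF inj]) (simp add: card)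
  also have "\<dots> \<le> (\<Sum>w\<in>dense_sets ?H \<times> ?B. z ^ card (fst w) * z ^ card (snd w))"
    using assms finF by (intro sum_mono2 r finite_cartesian_product finite_dense_sets finite_half_edges) auto
  also have "\<dots> = (\<Sum>A\<in>dense_sets ?H. z ^ card A) * (\<Sum>B\<in>?B. z ^ card B)"
    by (simp add: sum_product sum.cartesian_product case_prod_unfold)
  also have "\<dots> \<le> (\<Prod>v=1..n. 1 + (z / y) ^ 3 * (1 + y) ^ d v) * (1 + (z / y) ^ 3 * (1 + y) ^ d (Suc n))"
    using assms by (intro mult_mono Suc.IH B sum_nonneg prod_nonneg) auto
  finally show ?case by simp
qed

text \<open>A Chernoff type bound: each set gets the weight \<open>z ^ card A\<close> with
  \<open>z\<close> at choice, and the factors are estimated by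
  \<open>1 + x \<le> exp x\<close>.\<close>

lemma card_dense_sets_le:
  fixes y z :: real
  assumes "0 < z" "z \<le> y"
  shows "real (card {A\<in>dense_sets (half_edges n d). card A = l})
      \<le> exp ((z / y) ^ 3 * (\<Sum>v=1..n. (1 + y) ^ d v)) / z ^ l"
proof -
  let ?D = "dense_sets (half_edges n d)"
  have fin: "finite ?D" by (intro finite_dense_sets finite_half_edges)
  have "real (card {A\<in>?D. card A = l}) * z ^ l = (\<Sum>A\<in>{A\<in>?D. card A = l}. z ^ card A)" by simp
  also have "\<dots> \<le> (\<Sum>A\<in>?D. z ^ card A)" using fin assms by (intro sum_mono2) auto
  also have "\<dots> \<le> (\<Prod>v=1..n. 1 + (z / y) ^ 3 * (1 + y) ^ d v)"
    by (rule dense_sets_generating_function[OF assms])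
  also have "\<dots> \<le> (\<Prod>v=1..n. exp ((z / y) ^ 3 * (1 + y) ^ d v))"
    using assms by (intro prod_mono) (auto intro: exp_ge_add_one_self)
  also have "\<dots> = exp ((z / y) ^ 3 * (\<Sum>v=1..n. (1 + y) ^ d v))"
    by (simp add: exp_sum sum_distrib_left)
  finally show ?thesis using assms by (simp add: field_simps)
qed

text \<open>Union bound over the sizes and over the dense sets that the core could be. The weight
  \<open>z a\<close> may vary with the size, so it can be optimised for each
  \<open>a\<close>.\<close>

lemma prob_small_core_le:
  fixes d :: "nat \<Rightarrow> nat" and y :: real and z :: "nat \<Rightarrow> real"
  assumes k: "k \<ge> 3" and ev: "even (card (half_edges n d))"
    and z: "\<And>a. a \<in> {1..m} \<Longrightarrow> 0 < z a \<and> z a \<le> y"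
  shows "measure_pmf.prob (unif_matching (half_edges n d))
      {M. core_set k (half_edges n d) M \<noteq> {} \<and> card (core_set k (half_edges n d) M) \<le> 2 * m}
    \<le> (\<Sum>a=1..m. exp ((z a / y) ^ 3 * (\<Sum>v=1..n. (1 + y) ^ d v)) / z a ^ (2 * a)
        * (real (2 * a) / real (card (half_edges n d))) ^ a)"
proof -
  let ?H = "half_edges n d"
  let ?P = "unif_matching ?H"
  let ?D = "\<lambda>a. {A\<in>dense_sets ?H. card A = 2 * a}"
  have finH: "finite ?H" by (rule finite_half_edges)
  have finD: "finite (?D a)" for a using finite_dense_sets[OF finH] by simp
  have "measure_pmf.prob ?P {M. core_set k ?H M \<noteq> {} \<and> card (core_set k ?H M) \<le> 2 * m}
      \<le> measure_pmf.prob ?P (\<Union>a\<in>{1..m}. \<Union>A\<in>?D a. {M. closed_in M A})"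
  proof (rule pmf_prob_mono)
    fix M assume M: "M \<in> set_pmf ?P"
      "M \<in> {M. core_set k ?H M \<noteq> {} \<and> card (core_set k ?H M) \<le> 2 * m}"
    let ?C = "core_set k ?H M"
    have PM: "M \<in> perfect_matchings ?H" using M(1) set_unif_matching[OF finH ev] by simp
    have CH: "?C \<subseteq> ?H" by (simp add: core_set_def peel_subset)
    have "even (card ?C)" unfolding core_set_def by (rule even_card_peel[OF finH PM ev])
    then obtain a where a: "card ?C = 2 * a" by blast
    have "card ?C > 0" using M(2) finite_subset[OF CH finH] by (simp add: card_gt_0_iff)
    then have "a \<in> {1..m}" using a M(2) by auto
    moreover have "?C \<in> ?D a"
    proof -
      have "3 \<le> hdeg ?C (fst x)" if "x \<in> ?C" for x
      proof (rule ccontr)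
        assume "\<not> 3 \<le> hdeg ?C (fst x)"
        then have "x \<in> light k ?C" using that k by (simp add: light_def)
        then show False using light_core_set[OF finH PM, of k] by simp
      qed
      then show ?thesis using CH a by (simp add: dense_sets_def)
    qed
    moreover have "closed_in M ?C" unfolding core_set_def by (rule closed_in_peel[OF PM])
    ultimately show "M \<in> (\<Union>a\<in>{1..m}. \<Union>A\<in>?D a. {M. closed_in M A})" by blast
  qed
  also have "\<dots> \<le> (\<Sum>a=1..m. measure_pmf.prob ?P (\<Union>A\<in>?D a. {M. closed_in M A}))"
    by (intro measure_UNION_le) auto
  also have "\<dots> \<le> (\<Sum>a=1..m. \<Sum>A\<in>?D a. measure_pmf.prob ?P {M. closed_in M A})"
    using finD by (intro sum_mono measure_UNION_le) auto
  also have "\<dots> \<le> (\<Sum>a=1..m. \<Sum>A\<in>?D a. (real (2 * a) / real (card ?H)) ^ a)"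
    by (intro sum_mono prob_closed_in[OF finH ev]) (auto simp: dense_sets_def)
  also have "\<dots> = (\<Sum>a=1..m. real (card (?D a)) * (real (2 * a) / real (card ?H)) ^ a)" by simp
  also have "\<dots> \<le> (\<Sum>a=1..m. exp ((z a / y) ^ 3 * (\<Sum>v=1..n. (1 + y) ^ d v)) / z a ^ (2 * a)
        * (real (2 * a) / real (card ?H)) ^ a)"
    using z by (intro sum_mono mult_right_mono card_dense_sets_le) auto
  finally show ?thesis .
qed

text \<open>Each term vanishes for fixed \<open>a\<close>, and the cut-off
  \<open>n / (2 * b) ^ 3\<close> keeps the base at most \<open>1 / 2\<close>. The terms are thus
  dominated by \<open>(1 / 2) ^ a\<close>, and Tannery's theorem exchanges limit and sum.\<close>

lemma small_core_series_limit:
  fixes b :: real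
  assumes "b > 0"
  shows "(\<lambda>n. \<Sum>a=1..nat \<lfloor>real n / (2 * b) ^ 3\<rfloor>. (b * root 3 (real a / real n)) ^ a) \<longlonglongrightarrow> 0"
proof -
  define m where "m n = nat \<lfloor>real n / (2 * b) ^ 3\<rfloor>" for n :: nat
  define t where "t a n = (if a \<in> {1..m n} then (b * root 3 (real a / real n)) ^ a else 0)" for a n :: nat
  have lim: "(\<lambda>n. t a n) \<longlonglongrightarrow> 0" for a
  proof (cases "a = 0")
    case False
    have "(\<lambda>n. real a / real n) \<longlonglongrightarrow> 0" by (rule lim_const_over_n)
    then have "(\<lambda>n. (b * root 3 (real a / real n)) ^ a) \<longlonglongrightarrow> (b * root 3 0) ^ a"
      by (intro tendsto_intros)
    moreover have "(b * root 3 0) ^ a = 0" using False by (simp add: power_0_left)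
    ultimately have "(\<lambda>n. (b * root 3 (real a / real n)) ^ a) \<longlonglongrightarrow> 0" by metis
    then show ?thesis
      by (rule Lim_null_comparison[rotated]) (use assms in \<open>auto simp: t_def\<close>)
  qed (simp add: t_def)
  have bound: "norm (t a n) \<le> (1 / 2) ^ a" for a n
  proof (cases "a \<in> {1..m n}")
    case True
    then have n: "real n > 0" by (cases "n = 0") (auto simp: m_def)
    have "real a \<le> real n / (2 * b) ^ 3" using True assms by (simp add: m_def le_nat_iff le_floor_iff)
    then have "real a / real n \<le> (1 / (2 * b)) ^ 3" using n assms by (simp add: field_simps)
    then have "root 3 (real a / real n) \<le> root 3 ((1 / (2 * b)) ^ 3)" by simp
    also have "\<dots> = 1 / (2 * b)" using assms by (intro real_root_power_cancel) auto
    finally have "b * root 3 (real a / real n) \<le> b * (1 / (2 * b))"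
      using assms by (intro mult_left_mono) auto
    then have "b * root 3 (real a / real n) \<le> 1 / 2" using assms by simp
    moreover have "0 \<le> b * root 3 (real a / real n)" using assms by simp
    ultimately have "(b * root 3 (real a / real n)) ^ a \<le> (1 / 2) ^ a" by (intro power_mono)
    then show ?thesis using True assms by (simp add: t_def)
  qed (auto simp: t_def)
  have "(\<lambda>n. suminf (\<lambda>a. t a n)) \<longlonglongrightarrow> suminf (\<lambda>_::nat. 0)"
  proof -
    have "eventually (\<lambda>(a, n). norm (t a n) \<le> (1 / 2) ^ a) (sequentially \<times>\<^sub>F sequentially)"
      using bound by (intro always_eventually) auto
    moreover have "summable (\<lambda>a. (1 / 2 :: real) ^ a)" by (intro summable_geometric) simp
    ultimately show ?thesis using tannerys_theorem[of t, OF lim] sequentially_bot by blast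
  qed
  moreover have "suminf (\<lambda>a. t a n) = (\<Sum>a=1..m n. (b * root 3 (real a / real n)) ^ a)" for n
    by (subst suminf_finite[of "{1..m n}"]) (auto simp: t_def)
  ultimately show ?thesis by (simp add: m_def)
qed

section \<open>Emptiness under an exponential moment\<close>

context degree_sequence
begin

text \<open>Non-empty cores with at most \<open>2 * m n\<close> half-edges are excluded by the first
  moment, cores of linear size by \<open>small_core\<close>.\<close>

lemma core_empty:
  assumes k3: "k \<ge> 3" and \<alpha>: "\<alpha> > 0"
    and exp_moment: "(\<lambda>n. \<Sum>i=1..n. exp (\<alpha> * real (d n i))) \<in> O(\<lambda>n. real n)"
    and above: "\<And>q. q \<in> {0<..1} \<Longrightarrow> core_h k p q < lam * q\<^sup>2"
  shows "vanishing P (\<lambda>n M. C n M \<noteq> {})"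
proof -
  \<comment> \<open>With this \<open>y\<close> the sum of \<open>(1 + y) ^ d n v\<close> is the
    exponential moment, eventually at most \<open>c * n\<close>.\<close>
  define y where "y = exp \<alpha> - 1"
  have y: "y > 0" using \<alpha> by (simp add: y_def)
  have y_exp: "(1 + y) ^ w = exp (\<alpha> * real w)" for w
    by (simp add: y_def exp_of_nat_mult[symmetric] mult.commute)
  obtain c where c: "c > 0" "eventually (\<lambda>n. norm (\<Sum>i=1..n. exp (\<alpha> * real (d n i))) \<le> c * norm (real n)) sequentially"
    using landau_o.bigE[OF exp_moment] .
  \<comment> \<open>Collects the constants of one term: \<open>exp c\<close> from the generating
    function, \<open>y^2\<close> from \<open>z a ^ (2 * a)\<close>, and 4 from \<open>2 * a\<close>
    together with \<open>N n > lam / 2 * n\<close>. The lower bound 1 gives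
    \<open>a \<le> n\<close>, hence \<open>z a \<le> y\<close>.\<close>
  define b where "b = max 1 (4 * exp c / (lam * y\<^sup>2))"
  have b: "b \<ge> 1" "4 * exp c / (lam * y\<^sup>2) \<le> b" by (auto simp: b_def)
  define m where "m n = nat \<lfloor>real n / (2 * b) ^ 3\<rfloor>" for n :: nat
  have "1 \<le> (2 * b) ^ 3" using b by (intro one_le_power) simp
  have m_le: "real (m n) \<le> real n / (2 * b) ^ 3" for n using b by (simp add: m_def)
  have N_ge: "eventually (\<lambda>n. lam / 2 * real n < real (N n)) sequentially"
    using lam_pos by (intro eventually_mult_n(2)[OF N_conv]) simp
  have small: "vanishing P (\<lambda>n M. C n M \<noteq> {} \<and> card (C n M) \<le> 2 * m n)"
  proof (rule vanishing_if_bounded)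
    show "(\<lambda>n. \<Sum>a=1..m n. (b * root 3 (real a / real n)) ^ a) \<longlonglongrightarrow> 0"
      unfolding m_def using b by (intro small_core_series_limit) simp
    show "eventually (\<lambda>n. measure_pmf.prob (P n) {M. C n M \<noteq> {} \<and> card (C n M) \<le> 2 * m n}
        \<le> (\<Sum>a=1..m n. (b * root 3 (real a / real n)) ^ a)) sequentially"
      using c(2) N_ge eventually_gt_at_top[of 0]
    proof eventually_elim
      case (elim n)
      have n: "real n > 0" using elim by simp
      have Epos: "0 \<le> (\<Sum>v=1..n. (1 + y) ^ d n v)" using y by (intro sum_nonneg) auto
      have E: "(\<Sum>v=1..n. (1 + y) ^ d n v) \<le> c * real n"
        using elim(1) Epos by (simp add: y_exp)
      \<comment> \<open>Chosen so that the exponent, at most \<open>(z a / y) ^ 3 * c * n\<close>,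
        becomes \<open>c * a\<close>, comparable with the other factors raised to the power
        \<open>a\<close>.\<close>
      define z where "z a = y * root 3 (real a / real n)" for a
      have t: "0 < root 3 (real a / real n)" "root 3 (real a / real n) \<le> 1"
        "root 3 (real a / real n) ^ 3 = real a / real n" if "a \<in> {1..m n}" for a
      proof -
        have "real a \<le> real n / (2 * b) ^ 3" using that m_le[of n] by auto
        also have "\<dots> \<le> real n / 1" using \<open>1 \<le> (2 * b) ^ 3\<close> b by (intro divide_left_mono) auto
        finally have "real a / real n \<le> 1" using n by simp
        then show "root 3 (real a / real n) \<le> 1" by simp
        show "0 < root 3 (real a / real n)" using that n by simp
        show "root 3 (real a / real n) ^ 3 = real a / real n" by simp
      qed
      have "measure_pmf.prob (P n) {M. C n M \<noteq> {} \<and> card (C n M) \<le> 2 * m n}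
        \<le> (\<Sum>a=1..m n. exp ((z a / y) ^ 3 * (\<Sum>v=1..n. (1 + y) ^ d n v)) / z a ^ (2 * a)
          * (real (2 * a) / real (N n)) ^ a)"
        using y t n by (intro prob_small_core_le[OF k3 even_N]) (auto simp: z_def mult_le_cancel_left1)
      also have "\<dots> \<le> (\<Sum>a=1..m n. (b * root 3 (real a / real n)) ^ a)"
      proof (intro sum_mono)
        fix a assume a: "a \<in> {1..m n}"
        define s where "s = root 3 (real a / real n)"
        have s: "0 < s" "s \<le> 1" "s ^ 3 = real a / real n" using t[OF a] by (auto simp: s_def)
        have "exp ((z a / y) ^ 3 * (\<Sum>v=1..n. (1 + y) ^ d n v)) \<le> exp (real a * c)"
        proof -
          have "(z a / y) ^ 3 * (\<Sum>v=1..n. (1 + y) ^ d n v) \<le> real a / real n * (c * real n)"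
            using y E s(3) n by (intro mult_mono Epos) (auto simp: z_def s_def)
          then show ?thesis using n by (simp add: mult.commute)
        qed
        then have 1: "exp ((z a / y) ^ 3 * (\<Sum>v=1..n. (1 + y) ^ d n v)) \<le> exp c ^ a"
          by (simp add: exp_of_nat_mult)
        have "real (2 * a) / real (N n) \<le> real (2 * a) / (lam / 2 * real n)"
        proof (intro divide_left_mono)
          have pos: "0 < lam / 2 * real n" using n lam_pos by simp
          then have "0 < real (N n)" using elim(2) by linarith
          then show "0 < real (N n) * (lam / 2 * real n)" using pos by (rule mult_pos_pos)
        qed (use elim(2) in auto)
        also have "\<dots> = 4 / lam * s ^ 3" using s(3) by simp
        finally have 2: "(real (2 * a) / real (N n)) ^ a \<le> (4 / lam * s ^ 3) ^ a"
          by (intro power_mono) auto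
        have "exp ((z a / y) ^ 3 * (\<Sum>v=1..n. (1 + y) ^ d n v)) / z a ^ (2 * a) * (real (2 * a) / real (N n)) ^ a
            \<le> exp c ^ a / z a ^ (2 * a) * (4 / lam * s ^ 3) ^ a"
          using 1 2 y s by (intro mult_mono divide_right_mono) (auto simp: z_def s_def)
        also have "\<dots> = (exp c / (y * s)\<^sup>2 * (4 / lam * s ^ 3)) ^ a"
          by (simp add: z_def s_def[symmetric] power_mult power_mult_distrib power_divide)
        also have "exp c / (y * s)\<^sup>2 * (4 / lam * s ^ 3) = 4 * exp c / (lam * y\<^sup>2) * s"
        proof -
          have "E / (y * r)\<^sup>2 * (4 / l * r ^ 3) = 4 * E / (l * y\<^sup>2) * r" if "r > 0" for E l r :: real
            using that by (simp add: power2_eq_square power3_eq_cube mult_ac)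
          then show ?thesis using s(1) by blast
        qed
        also have "(4 * exp c / (lam * y\<^sup>2) * s) ^ a \<le> (b * s) ^ a"
          using b s lam_pos y by (intro power_mono mult_right_mono) auto
        finally show "exp ((z a / y) ^ 3 * (\<Sum>v=1..n. (1 + y) ^ d n v)) / z a ^ (2 * a)
            * (real (2 * a) / real (N n)) ^ a \<le> (b * root 3 (real a / real n)) ^ a"
          by (simp add: s_def)
      qed
      finally show ?case .
    qed
  qed
  define \<epsilon> where "\<epsilon> = 1 / (2 * b) ^ 3"
  have \<epsilon>: "\<epsilon> > 0" using b by (simp add: \<epsilon>_def)
  have large: "vanishing P (\<lambda>n M. \<epsilon> * real n < real (card (C n M)))"
    by (rule small_core[OF above \<epsilon>])
  show ?thesis
  proof (rule vanishing_mono[OF vanishing_disj[OF small large]])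
    have "eventually (\<lambda>n. real n > (2 * b) ^ 3) sequentially"
      using filterlim_real_sequentially unfolding filterlim_at_top_dense by blast
    then show "eventually (\<lambda>n. \<forall>M\<in>set_pmf (P n). C n M \<noteq> {} \<longrightarrow>
        (C n M \<noteq> {} \<and> card (C n M) \<le> 2 * m n) \<or> \<epsilon> * real n < real (card (C n M))) sequentially"
    proof eventually_elim
      case (elim n)
      \<comment> \<open>Twice the floor of a number above 1 is at least that number, so the two
        excluded ranges overlap.\<close>
      have "1 < real n / (2 * b) ^ 3" using elim b by (simp add: field_simps)
      then have "1 \<le> \<lfloor>real n / (2 * b) ^ 3\<rfloor>" by (simp add: le_floor_iff)
      then have "1 \<le> real (m n)" "real n / (2 * b) ^ 3 < real (m n) + 1"
        unfolding m_def by linarith+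
      then have "\<epsilon> * real n \<le> real (2 * m n)" unfolding \<epsilon>_def by simp
      then show ?case by (auto simp: not_less)
    qed
  qed
qed

section \<open>The largest root\<close>

lemma core_h_0: "core_h k p 0 = 0"
proof -
  have "binom_mean (heavy_deg k) r 0 = 0" for r
    using k unfolding binom_mean_def
    by (intro sum.neutral ballI) (auto simp: heavy_deg_simps power_0_left)
  then show ?thesis
    by (simp add: core_h_eq expectation_thinning[OF mean_summable heavy_deg_bounds])
qed

lemma core_h_le: "q \<in> {0..1} \<Longrightarrow> core_h k p q \<le> lam"
  using truncated_core_h(2)[of q 0]
    suminf_le[of "\<lambda>r. pmf p r * binom_mean (heavy_deg k) r q" "\<lambda>r. real r * pmf p r"]
    summable_binom_mean[OF mean_summable heavy_deg_bounds, of q] mean_summable mean_sums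
    binom_mean_summand_le[OF mean_summable heavy_deg_bounds, of q]
    expectation_thinning[OF mean_summable heavy_deg_bounds, of q]
  by (force simp: core_h_eq sums_iff abs_le_iff)

text \<open>The roots form a compact set containing 0, so a greatest one exists. Above it
  \<open>lam * q^2 - core_h k p q\<close> has no zero and is non-negative at 1, hence positive by
  the intermediate value theorem.\<close>

lemma p_hat_props:
  shows "0 \<le> p_hat k lam p" "p_hat k lam p \<le> 1"
    "lam * (p_hat k lam p)\<^sup>2 = core_h k p (p_hat k lam p)"
    "\<And>q. q \<in> {p_hat k lam p<..1} \<Longrightarrow> core_h k p q < lam * q\<^sup>2"
proof -
  let ?g = "\<lambda>q. lam * q\<^sup>2 - core_h k p q"
  let ?Q = "{q\<in>{0..1}. ?g q = 0}"
  have cont: "continuous_on {0..1} ?g"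
    by (intro continuous_intros continuous_core_h)
  have "closed ?Q" by (rule continuous_closed_preimage_constant[OF cont]) simp
  then have "compact ({0..1} \<inter> ?Q)" by (intro compact_Int_closed) auto
  moreover have "0 \<in> {0..1} \<inter> ?Q" by (simp add: core_h_0)
  ultimately obtain s where s: "s \<in> {0..1} \<inter> ?Q" "\<And>q. q \<in> {0..1} \<inter> ?Q \<Longrightarrow> q \<le> s"
    using compact_attains_sup[of "{0..1} \<inter> ?Q"] by blast
  have hat: "p_hat k lam p = s"
    unfolding p_hat_def by (rule Greatest_equality) (use s in auto)
  show "0 \<le> p_hat k lam p" "p_hat k lam p \<le> 1"
    "lam * (p_hat k lam p)\<^sup>2 = core_h k p (p_hat k lam p)" using s(1) by (auto simp: hat)
  fix q assume q: "q \<in> {p_hat k lam p<..1}"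
  show "core_h k p q < lam * q\<^sup>2"
  proof (rule ccontr)
    assume "\<not> core_h k p q < lam * q\<^sup>2"
    then have "?g q \<le> 0" by simp
    moreover have "0 \<le> ?g 1" using core_h_le[of 1] by simp
    moreover have "q \<le> 1" using q by simp
    moreover have "continuous_on {q..1} ?g"
      using q s(1) by (intro continuous_on_subset[OF cont]) (auto simp: hat)
    ultimately obtain r where "q \<le> r" "r \<le> 1" "?g r = 0"
      using IVT'[of ?g q 0 1] by blast
    moreover from this have "r \<le> s" using s q by (intro s(2)) (auto simp: hat)
    ultimately show False using q by (simp add: hat)
  qed
qed

lemma p_hat_eq_0_iff: "p_hat k lam p = 0 \<longleftrightarrow> (\<forall>q\<in>{0<..1}. core_h k p q < lam * q\<^sup>2)"
proof
  assume "p_hat k lam p = 0"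
  then show "\<forall>q\<in>{0<..1}. core_h k p q < lam * q\<^sup>2" using p_hat_props(4) by auto
next
  assume "\<forall>q\<in>{0<..1}. core_h k p q < lam * q\<^sup>2"
  then show "p_hat k lam p = 0"
    using p_hat_props(1-3) by (metis antisym_conv1 greaterThanAtMost_iff less_irrefl order_le_less)
qed

section \<open>Transfer from matchings to the configuration model\<close>

lemma prob_config_model:
  "measure_pmf.prob (config_model n (d n)) {G. Q G}
    = measure_pmf.prob (P n) {M. Q (matching_multigraph n M)}"
  by (simp add: config_model_def vimage_def)

lemma kcore_facts:
  assumes "M \<in> set_pmf (P n)"
  shows "verts (kcore k (matching_multigraph n M)) = fst ` C n M"
    "real (size (edges (kcore k (matching_multigraph n M)))) = real (card (C n M)) / 2"
  using kcore_matching_multigraph[of M n "d n" k] assms k by (simp_all add: set_P)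

lemma converges_in_prob_config:
  assumes "\<And>e. e > 0 \<Longrightarrow> vanishing P (\<lambda>n M. e < \<bar>Y n M - c\<bar>)"
    and "\<And>n M. M \<in> set_pmf (P n) \<Longrightarrow> X n (matching_multigraph n M) = Y n M"
  shows "converges_in_prob (\<lambda>n. config_model n (d n)) X c"
proof -
  have "vanishing P (\<lambda>n M. e < \<bar>X n (matching_multigraph n M) - c\<bar>)" if "e > 0" for e
    by (rule vanishing_mono[OF assms(1)[OF that]]) (simp add: assms(2))
  then show ?thesis by (simp add: converges_in_prob_def vanishing_def prob_config_model)
qed

lemma whp_config:
  assumes "vanishing P (\<lambda>n M. \<not> Y n M)"
    and "\<And>n M. M \<in> set_pmf (P n) \<Longrightarrow> Y n M \<Longrightarrow> X n (matching_multigraph n M)"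
  shows "whp (\<lambda>n. config_model n (d n)) X"
proof -
  have "vanishing P (\<lambda>n M. \<not> X n (matching_multigraph n M))"
    by (rule vanishing_mono[OF assms(1)], rule always_eventually) (use assms(2) in blast)
  then have "(\<lambda>n. 1 - measure_pmf.prob (P n) {M. \<not> X n (matching_multigraph n M)}) \<longlonglongrightarrow> 1 - 0"
    unfolding vanishing_def by (intro tendsto_intros)
  moreover have "measure_pmf.prob (P n) {M. X n (matching_multigraph n M)}
      = 1 - measure_pmf.prob (P n) {M. \<not> X n (matching_multigraph n M)}" for n
    using measure_pmf.prob_compl[of "{M. \<not> X n (matching_multigraph n M)}" "P n"]
    by (simp add: Compl_eq_Diff_UNIV[symmetric] Collect_neg_eq)
  ultimately show ?thesis by (simp add: whp_def prob_config_model)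
qed

end

theorem theorem2p3:
  fixes k :: nat and d :: "nat \<Rightarrow> nat \<Rightarrow> nat" and p :: "nat pmf" and lam :: real
  assumes "k \<ge> 2"
    and "\<And>n. even (\<Sum>i=1..n. d n i)"
    and "\<And>r. (\<lambda>n. real (card {i\<in>{1..n}. d n i = r}) / real n) \<longlonglongrightarrow> pmf p r"
    and "(\<lambda>r. real r * pmf p r) sums lam" and "0 < lam"
    and "(\<lambda>n. real (\<Sum>i=1..n. d n i) / real n) \<longlonglongrightarrow> lam"
  shows "(p_hat k lam p = 0 \<longleftrightarrow> (\<forall>q\<in>{0<..1}. lam * q\<^sup>2 > core_h k p q)) \<and>
    (p_hat k lam p = 0 \<longrightarrow>
      little_op (\<lambda>n. config_model n (d n)) (\<lambda>n G. real (card (verts (kcore k G)))) \<and>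
      little_op (\<lambda>n. config_model n (d n)) (\<lambda>n G. real (size (edges (kcore k G)))) \<and>
      (k \<ge> 3 \<and> (\<exists>\<alpha>>0. (\<lambda>n. \<Sum>i=1..n. exp (\<alpha> * real (d n i))) \<in> O(\<lambda>n. real n)) \<longrightarrow>
        whp (\<lambda>n. config_model n (d n)) (\<lambda>n G. verts (kcore k G) = {}))) \<and>
    (p_hat k lam p > 0 \<and>
     (\<exists>\<epsilon>>0. \<forall>q\<in>{p_hat k lam p - \<epsilon><..<p_hat k lam p} \<inter> {0..1}.
        lam * q\<^sup>2 < core_h k p q) \<longrightarrow>
      whp (\<lambda>n. config_model n (d n)) (\<lambda>n G. verts (kcore k G) \<noteq> {}) \<and>
      converges_in_prob (\<lambda>n. config_model n (d n))
        (\<lambda>n G. real (card (verts (kcore k G))) / real n) (core_h1 k p (p_hat k lam p)) \<and>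
      converges_in_prob (\<lambda>n. config_model n (d n))
        (\<lambda>n G. real (size (edges (kcore k G))) / real n) (core_h k p (p_hat k lam p) / 2) \<and>
      core_h k p (p_hat k lam p) / 2 = lam * (p_hat k lam p)\<^sup>2 / 2)"
proof -
  interpret degree_sequence k d p lam
    using assms by unfold_locales
  let ?q = "p_hat k lam p"
  \<comment> \<open>Vertices and edges of the core are both at most as many as its half-edges, so
    one estimate serves for both.\<close>
  have van: "vanishing P (\<lambda>n M. e < \<bar>Y n M / real n - 0\<bar>)"
    if "?q = 0" "e > 0" "\<And>n M. M \<in> set_pmf (P n) \<Longrightarrow> 0 \<le> Y n M \<and> Y n M \<le> real (card (C n M))"
    for e and Y :: "nat \<Rightarrow> (nat \<times> nat) set set \<Rightarrow> real"
  proof (rule vanishing_mono[OF small_core[of e]])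
    show "core_h k p q < lam * q\<^sup>2" if "q \<in> {0<..1}" for q
      using p_hat_props(4)[of q] that \<open>?q = 0\<close> by simp
    show "eventually (\<lambda>n. \<forall>M\<in>set_pmf (P n). e < \<bar>Y n M / real n - 0\<bar> \<longrightarrow> e * real n < real (card (C n M))) sequentially"
      using eventually_gt_at_top[of 0]
    proof eventually_elim
      case (elim n)
      show ?case
      proof (intro ballI impI)
        fix M assume M: "M \<in> set_pmf (P n)" "e < \<bar>Y n M / real n - 0\<bar>"
        then have "e * real n < Y n M" using that(3)[OF M(1)] elim by (simp add: field_simps)
        then show "e * real n < real (card (C n M))" using that(3)[OF M(1)] by simp
      qed
    qed
  qed (rule that(2))
  have finC: "finite (C n M)" for n M
    by (rule finite_subset[OF _ finite_half_edges[of n "d n"]]) (simp add: core_set_def peel_subset)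
  have 1: "little_op (\<lambda>n. config_model n (d n)) (\<lambda>n G. real (card (verts (kcore k G))))" if "?q = 0"
    unfolding little_op_def
    by (rule converges_in_prob_config[where Y = "\<lambda>n M. real (card (fst ` C n M)) / real n"], rule van[OF that])
       (auto simp: kcore_facts card_image_le[OF finC])
  have 2: "little_op (\<lambda>n. config_model n (d n)) (\<lambda>n G. real (size (edges (kcore k G))))" if "?q = 0"
    unfolding little_op_def
    by (rule converges_in_prob_config[where Y = "\<lambda>n M. (real (card (C n M)) / 2) / real n"], rule van[OF that])
       (auto simp: kcore_facts)
  have 3: "whp (\<lambda>n. config_model n (d n)) (\<lambda>n G. verts (kcore k G) = {})"
    if "?q = 0" "k \<ge> 3" "\<alpha> > 0" "(\<lambda>n. \<Sum>i=1..n. exp (\<alpha> * real (d n i))) \<in> O(\<lambda>n. real n)" for \<alpha>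
  proof (rule whp_config)
    show "vanishing P (\<lambda>n M. \<not> C n M = {})"
      by (rule core_empty[OF that(2-4)]) (use p_hat_props(4) that(1) in auto)
  qed (simp add: kcore_facts)
  have 4: "whp (\<lambda>n. config_model n (d n)) (\<lambda>n G. verts (kcore k G) \<noteq> {}) \<and>
      converges_in_prob (\<lambda>n. config_model n (d n))
        (\<lambda>n G. real (card (verts (kcore k G))) / real n) (core_h1 k p ?q) \<and>
      converges_in_prob (\<lambda>n. config_model n (d n))
        (\<lambda>n G. real (size (edges (kcore k G))) / real n) (core_h k p ?q / 2)"
    if q: "?q > 0" and "\<epsilon> > 0" and "\<forall>q\<in>{?q - \<epsilon><..<?q} \<inter> {0..1}. lam * q\<^sup>2 < core_h k p q" for \<epsilon>
  proof -
    note hyps = q p_hat_props(2,4) that(2) bspec[OF that(3)]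
    have "whp (\<lambda>n. config_model n (d n)) (\<lambda>n G. verts (kcore k G) \<noteq> {})"
      by (rule whp_config[where Y = "\<lambda>n M. C n M \<noteq> {}"]) (use core_nonempty[OF hyps] in \<open>auto simp: kcore_facts\<close>)
    moreover have "converges_in_prob (\<lambda>n. config_model n (d n))
        (\<lambda>n G. real (card (verts (kcore k G))) / real n) (core_h1 k p ?q)"
      by (rule converges_in_prob_config[OF core_verts_conv[OF hyps]]) (simp_all add: kcore_facts)
    moreover have "converges_in_prob (\<lambda>n. config_model n (d n))
        (\<lambda>n G. real (size (edges (kcore k G))) / real n) (core_h k p ?q / 2)"
    proof (rule converges_in_prob_config)
      fix e :: real assume e: "e > 0"
      \<comment> \<open>An edge has two half-edges, so precision \<open>e\<close> for edges is
        precision \<open>2 * e\<close> for half-edges.\<close>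
      have "e < \<bar>x / 2 / m - c / 2\<bar> \<longleftrightarrow> 2 * e < \<bar>x / m - c\<bar>" for x m c :: real
      proof -
        have "x / 2 / m - c / 2 = (x / m - c) / 2" by (simp add: diff_divide_distrib mult.commute)
        then show ?thesis by (simp only: abs_divide) linarith
      qed
      then show "vanishing P (\<lambda>n M. e < \<bar>real (card (C n M)) / 2 / real n - core_h k p ?q / 2\<bar>)"
        using core_size_conv[OF hyps, of "2 * e"] e p_hat_props(3) by simp
    qed (simp add: kcore_facts)
    ultimately show ?thesis by blast
  qed
  show ?thesis
    using p_hat_eq_0_iff 1 2 3 4 p_hat_props(3) by auto
qed

end
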